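(* Let $\alpha\in(0,1]$. Let $X$ be a solution of the one-dimensional reflected SDE $$X_t=x_0+\int_0^t b(X_s)\,ds+\sigma W_t+L^0_t(X),\qquad L^0_t(X)=\int_0^t\mathbf{1}_{(X_s=0)}\,dL^0_s(X),\qquad t\in[0,T],$$ with values in $[0,\infty)$, and for $h>0$ let $X^h$ be its Euler-Maruyama approximation $$X^h_t=x_0+\int_0^t b(X^h_{\eta_h(s)})\,ds+\sigma W_t+L^0_t(X^h).$$ Suppose that the drift coefficient $b$ is of sub-linear growth and $\alpha$-Hölder continuous. Let $f:C([0,T];\mathbb{R})\to\mathbb{R}$ be bounded and measurable. Then there exists a constant $C$, which does not depend on $h$, such that $$|\mathbb{E}[f(X)]-\mathbb{E}[f(X^h)]|\le C\,h^{\alpha/2}.$$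
   Context: Fix $T>0$, $x_0\in[0,\infty)$, a constant $\sigma\ne0$ and $b:[0,\infty)\to\mathbb{R}$. $W$ is a one-dimensional standard Brownian motion on a filtered probability space $(\Omega,\mathcal{F},(\mathcal{F}_t),\mathbb{P})$. In the reflected SDE, $X$ is continuous with values in $[0,\infty)$ and $(L^0_t(X))_{0\le t\le T}$ is a non-decreasing continuous process starting at $0$ with $L^0_t(X)=\int_0^t\mathbf{1}_{(X_s=0)}dL^0_s(X)$. Standing assumption: the reflected SDE has a weak solution which is unique in the sense of probability law. Euler-Maruyama scheme: $\eta_h(s)=kh$ if $kh\le s<(k+1)h$, $k\in\{0,1,2,\dots\}$; $X^h_0=x_0$, and the pair $(X^h,L^0(X^h))$ is determined by the Skorohod problem: $X^h\geq 0$ is continuous, and $L^0(X^h)$ is continuous, non-decreasing, starts at $0$ and satisfies $L^0_t(X^h)=\int_0^t\mathbf{1}_{(X^h_s=0)}dL^0_s(X^h)$. Sub-linear growth: $b$ is bounded on compact sets and $b(y)=o(|y|)$ as $|y|\to\infty$. $\alpha$-Hölder continuous: $|b(x)-b(y)|\le C|x-y|^\alpha$ for all $x,y$, for some constant $C>0$. *)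

theory Defs
  imports "HOL-Probability.Probability"
begin

subsection \<open>The path space \<open>C([0,T];\<real>)\<close>\<close>

text \<open>Continuous functions on \<open>[0,T]\<close> (extensional, i.e. \<open>undefined\<close> outside of \<open>[0,T]\<close>) with
  the uniform metric.\<close>

definition path_metric :: "real \<Rightarrow> (real \<Rightarrow> real) metric" where
  "path_metric T = cfunspace (top_of_set {0..T}) euclidean_metric"

definition path_space :: "real \<Rightarrow> (real \<Rightarrow> real) measure" where
  "path_space T = sigma (mspace (path_metric T)) {U. openin (mtopology_of (path_metric T)) U}"

definition path_of :: "real \<Rightarrow> (real \<Rightarrow> 'a \<Rightarrow> real) \<Rightarrow> 'a \<Rightarrow> (real \<Rightarrow> real)" where
  "path_of T X \<omega> = restrict (\<lambda>t. X t \<omega>) {0..T}"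

subsection \<open>Filtrations and Brownian motion\<close>

text \<open>The filtration is indexed by all reals in order to reuse the library locale; only the times
  in \<open>[0,T]\<close> matter below, and a filtration over \<open>[0,T]\<close> extends constantly. No usual
  conditions are required.\<close>

locale filtered_prob_space = prob_space M + filtration "space M" F
  for M :: "'a measure" and F :: "real \<Rightarrow> 'a measure" +
  assumes subalgebra_F: "\<And>t. subalgebra M (F t)"

definition adapted :: "(real \<Rightarrow> 'a measure) \<Rightarrow> real \<Rightarrow> (real \<Rightarrow> 'a \<Rightarrow> real) \<Rightarrow> bool" where
  "adapted F T X \<longleftrightarrow> (\<forall>t\<in>{0..T}. X t \<in> borel_measurable (F t))"

definition brownian_motion ::
  "'a measure \<Rightarrow> (real \<Rightarrow> 'a measure) \<Rightarrow> real \<Rightarrow> (real \<Rightarrow> 'a \<Rightarrow> real) \<Rightarrow> bool" where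
  "brownian_motion M F T W \<longleftrightarrow>
     adapted F T W \<and>
     (\<forall>\<omega>\<in>space M. continuous_on {0..T} (\<lambda>t. W t \<omega>)) \<and>
     (AE \<omega> in M. W 0 \<omega> = 0) \<and>
     (\<forall>s t. 0 \<le> s \<longrightarrow> s < t \<longrightarrow> t \<le> T \<longrightarrow>
        distributed M lborel (\<lambda>\<omega>. W t \<omega> - W s \<omega>) (normal_density 0 (sqrt (t - s))) \<and>
        prob_space.indep_set M (sets (F s))
          {(\<lambda>\<omega>. W t \<omega> - W s \<omega>) -` A \<inter> space M | A. A \<in> sets borel})"

subsection \<open>Reflection at zero\<close>

text \<open>\<open>stieltjes_measure T l\<close> is the measure \<open>dl\<close> of a continuous non-decreasing
  \<open>l\<close> on \<open>[0,T]\<close>. As \<open>interval_measure\<close> expects a function on all of \<open>\<real>\<close>, \<open>l\<close> is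
  extended constantly to the left of \<open>0\<close> and to the right of \<open>T\<close>.\<close>

definition stieltjes_measure :: "real \<Rightarrow> (real \<Rightarrow> real) \<Rightarrow> real measure" where
  "stieltjes_measure T l = interval_measure (\<lambda>s. l (max 0 (min T s)))"

text \<open>\<open>(x, l)\<close> solves the Skorohod problem on \<open>[0,T]\<close> for the driving path \<open>y\<close>.\<close>

definition skorohod_problem ::
  "real \<Rightarrow> (real \<Rightarrow> real) \<Rightarrow> (real \<Rightarrow> real) \<Rightarrow> (real \<Rightarrow> real) \<Rightarrow> bool" where
  "skorohod_problem T y x l \<longleftrightarrow>
     (\<forall>t\<in>{0..T}. x t = y t + l t) \<and>
     continuous_on {0..T} x \<and> (\<forall>t\<in>{0..T}. 0 \<le> x t) \<and>
     continuous_on {0..T} l \<and> mono_on {0..T} l \<and> l 0 = 0 \<and>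
     (\<forall>t\<in>{0..T}. l t = (LINT s:{0..t}|stieltjes_measure T l. indicat_real {s. x s = 0} s))"

subsection \<open>The reflected SDE\<close>

text \<open>Drift coefficients are total functions on \<open>\<real>\<close>, but only their values on \<open>[0,\<infinity>)\<close> are used.
  The equations hold almost surely; the paths of \<open>X\<close> are surely continuous and non-negative, so that
  \<open>path_of T X\<close> always takes values in \<open>C([0,T];\<real>)\<close>.\<close>

definition reflected_sde ::
  "'a measure \<Rightarrow> (real \<Rightarrow> 'a measure) \<Rightarrow> real \<Rightarrow> real \<Rightarrow> (real \<Rightarrow> real) \<Rightarrow> real \<Rightarrow>
   (real \<Rightarrow> 'a \<Rightarrow> real) \<Rightarrow> (real \<Rightarrow> 'a \<Rightarrow> real) \<Rightarrow> (real \<Rightarrow> 'a \<Rightarrow> real) \<Rightarrow> bool" where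
  "reflected_sde M F T x0 b \<sigma> W X L \<longleftrightarrow>
     adapted F T X \<and> adapted F T L \<and>
     (\<forall>\<omega>\<in>space M. continuous_on {0..T} (\<lambda>t. X t \<omega>) \<and> (\<forall>t\<in>{0..T}. 0 \<le> X t \<omega>)) \<and>
     (AE \<omega> in M. set_integrable lborel {0..T} (\<lambda>s. b (X s \<omega>)) \<and>
        skorohod_problem T (\<lambda>t. x0 + (LBINT s:{0..t}. b (X s \<omega>)) + \<sigma> * W t \<omega>)
          (\<lambda>t. X t \<omega>) (\<lambda>t. L t \<omega>))"

definition weak_solution ::
  "'a measure \<Rightarrow> (real \<Rightarrow> 'a measure) \<Rightarrow> real \<Rightarrow> real \<Rightarrow> (real \<Rightarrow> real) \<Rightarrow> real \<Rightarrow>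
   (real \<Rightarrow> 'a \<Rightarrow> real) \<Rightarrow> (real \<Rightarrow> 'a \<Rightarrow> real) \<Rightarrow> (real \<Rightarrow> 'a \<Rightarrow> real) \<Rightarrow> bool" where
  "weak_solution M F T x0 b \<sigma> W X L \<longleftrightarrow>
     filtered_prob_space M F \<and> brownian_motion M F T W \<and> reflected_sde M F T x0 b \<sigma> W X L"

text \<open>Types cannot be quantified inside a formula, so existence and uniqueness in law quantify over
  all filtered probability spaces carried by a set of pairs of paths. This is no restriction: the law
  of \<open>(X, W)\<close> under any weak solution is realised on such a space, with \<open>L\<close> recovered from
  the equation and the filtration generated by \<open>(X, W)\<close>.\<close>

type_synonym sample = "(real \<Rightarrow> real) \<times> (real \<Rightarrow> real)"

definition weakly_well_posed :: "real \<Rightarrow> real \<Rightarrow> (real \<Rightarrow> real) \<Rightarrow> real \<Rightarrow> bool" where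
  "weakly_well_posed T x0 b \<sigma> \<longleftrightarrow>
     (\<exists>(M :: sample measure) F W X L. weak_solution M F T x0 b \<sigma> W X L) \<and>
     (\<forall>(M :: sample measure) F W X L (M' :: sample measure) F' W' X' L'.
        weak_solution M F T x0 b \<sigma> W X L \<longrightarrow> weak_solution M' F' T x0 b \<sigma> W' X' L' \<longrightarrow>
        distr M (path_space T) (path_of T X) = distr M' (path_space T) (path_of T X'))"

subsection \<open>The Euler--Maruyama scheme\<close>

text \<open>For \<open>h > 0\<close> and \<open>s \<ge> 0\<close> this is \<open>k h\<close> for the unique \<open>k\<close> with \<open>k h \<le> s < (k + 1) h\<close>.\<close>

definition euler_grid :: "real \<Rightarrow> real \<Rightarrow> real" where
  "euler_grid h s = of_int \<lfloor>s / h\<rfloor> * h"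

definition euler_maruyama ::
  "'a measure \<Rightarrow> (real \<Rightarrow> 'a measure) \<Rightarrow> real \<Rightarrow> real \<Rightarrow> (real \<Rightarrow> real) \<Rightarrow> real \<Rightarrow>
   (real \<Rightarrow> 'a \<Rightarrow> real) \<Rightarrow> real \<Rightarrow> (real \<Rightarrow> 'a \<Rightarrow> real) \<Rightarrow> (real \<Rightarrow> 'a \<Rightarrow> real) \<Rightarrow> bool" where
  "euler_maruyama M F T x0 b \<sigma> W h X L \<longleftrightarrow>
     adapted F T X \<and> adapted F T L \<and>
     (\<forall>\<omega>\<in>space M. continuous_on {0..T} (\<lambda>t. X t \<omega>) \<and> (\<forall>t\<in>{0..T}. 0 \<le> X t \<omega>)) \<and>
     (AE \<omega> in M. X 0 \<omega> = x0 \<and>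
        skorohod_problem T
          (\<lambda>t. x0 + (LBINT s:{0..t}. b (X (euler_grid h s) \<omega>)) + \<sigma> * W t \<omega>)
          (\<lambda>t. X t \<omega>) (\<lambda>t. L t \<omega>))"

subsection \<open>Conditions on the drift\<close>

definition sublinear_growth :: "(real \<Rightarrow> real) \<Rightarrow> bool" where
  "sublinear_growth b \<longleftrightarrow>
     (\<forall>K. compact K \<and> K \<subseteq> {0..} \<longrightarrow> bounded (b ` K)) \<and> b \<in> o[at_top](\<lambda>y. \<bar>y\<bar>)"

definition hoelder_continuous :: "real \<Rightarrow> (real \<Rightarrow> real) \<Rightarrow> bool" where
  "hoelder_continuous \<alpha> b \<longleftrightarrow>
     (\<exists>C>0. \<forall>x\<in>{0..}. \<forall>y\<in>{0..}. \<bar>b x - b y\<bar> \<le> C * \<bar>x - y\<bar> powr \<alpha>)"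

end

theory Submission
  imports Defs
begin

text \<open>
  The exact solution \<open>X\<close> also solves the Euler scheme, only with a different driving path: the error made by
  freezing the drift is moved into the noise. With \<open>\<beta>\<^sub>t = (b (X\<^sub>t) - b (X\<^bsub>\<eta>(t)\<^esub>)) / \<sigma>\<close> and \<open>V\<^sub>t = W\<^sub>t + \<integral>\<^sub>0\<^sup>t \<beta>\<^sub>s ds\<close> the
  reflected equation reads \<open>X\<^sub>t = x0 + \<integral>\<^sub>0\<^sup>t b (X\<^bsub>\<eta>(s)\<^esub>) ds + \<sigma> V\<^sub>t + L\<^sub>t\<close>. The Skorohod problem on the half-line
  determines its solution, and between two grid points the drift of the scheme is a constant, so the
  scheme is an explicit measurable functional of its driving path (\<open>euler_functional_correct\<close>). Hence \<open>X\<close> is the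
  image of \<open>V\<close> and \<open>X\<^sup>h\<close> is the image of \<open>W\<close> under one and the same map, and the total variation distance
  between the laws of \<open>X\<close> and \<open>X\<^sup>h\<close> is at most that between the laws of \<open>V\<close> and \<open>W\<close>.

  By Girsanov's theorem and Pinsker's inequality that distance is of order \<open>(\<integral>\<^sub>0\<^sup>T E \<beta>\<^sub>s\<^sup>2 ds)\<^bsup>1/2\<^esup>\<close>. No
  stochastic integral is involved in the argument below: along a partition with step \<open>\<tau>\<close> the integral of \<open>\<beta>\<close> is
  replaced by the Riemann sum of the adapted values \<open>\<tau> \<beta>\<^bsub>i \<tau>\<^esub>\<close>, for which the change of measure is a finite
  product of one-dimensional Gaussian densities (\<open>girsanov_finite_dimensional\<close>, \<open>shifted_expectation_le\<close>).
  The resulting bound does not depend on \<open>\<tau>\<close>. It passes to the limit for continuous functionals, and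
  from there to all Borel sets, by regularity of measures on the Polish space of real sequences
  (\<open>drifted_brownian_motion_law_le\<close>). Sequences suffice, because a continuous path is determined by its
  values on a countable dense set of times and these values generate the Borel sets of the path space
  (\<open>path_space_generated_by_dense_times\<close>).

  It remains to see that \<open>E \<beta>\<^sub>t\<^sup>2 \<le> C h\<^sup>\<alpha>\<close>. By Hoelder continuity of \<open>b\<close> this follows from
  \<open>E (X\<^sub>t - X\<^sub>s)\<^sup>2 \<le> C (t - s)\<close>. Reflection at most doubles the oscillation of the
  driving path (\<open>skorohod_increment_bound\<close>), so that this moment bound is a consequence of the linear growth of \<open>b\<close>,
  Gronwall's lemma and Doob's maximal inequality for \<open>W\<close>. Only rates for \<open>h \<le> 1\<close> matter, as \<open>f\<close> is bounded.
\<close>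

section \<open>The path space is generated by countably many evaluations\<close>

text \<open>On a compact interval the boundedness required of the members of \<open>cfunspace\<close> is automatic.\<close>

lemma mspace_path_metric:
  assumes "0 < T"
  shows "mspace (path_metric T) = {p \<in> extensional {0..T}. continuous_on {0..T} p}"
proof -
  have "compactin (top_of_set {0..T}) (topspace (top_of_set {0..T}))"
    by (simp add: compactin_subtopology)
  from compactin_mspace_cfunspace[OF this, of euclidean_metric] show ?thesis
    by (auto simp: path_metric_def continuous_map_iff_continuous)
qed

lemma mdist_path_metric_le:
  assumes "0 < T" "p \<in> mspace (path_metric T)" "q \<in> mspace (path_metric T)"
  shows "mdist (path_metric T) p q \<le> a \<longleftrightarrow> (\<forall>t\<in>{0..T}. \<bar>p t - q t\<bar> \<le> a)"
  using assms cfunspace_mdist_le[of p "top_of_set {0..T}" euclidean_metric q a]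
  by (auto simp: path_metric_def dist_real_def)

lemma path_of_in_path_space:
  assumes "0 < T" "continuous_on {0..T} (\<lambda>t. X t \<omega>)"
  shows "path_of T X \<omega> \<in> space (path_space T)"
proof -
  have "continuous_on {0..T} (restrict (\<lambda>t. X t \<omega>) {0..T})"
    using assms by (subst continuous_on_cong[OF refl, of _ _ "\<lambda>t. X t \<omega>"]) auto
  then show ?thesis
    using assms by (auto simp: path_of_def path_space_def space_measure_of_conv mspace_path_metric)
qed

text \<open>Bernstein polynomials, rescaled to \<open>[0,T]\<close>, with the entries of a list as coefficients: taking lists of
  rationals gives a countable dense set of paths.\<close>

definition bernstein_path :: "real \<Rightarrow> real list \<Rightarrow> real \<Rightarrow> real" where
  "bernstein_path T c = restrict (\<lambda>t. \<Sum>k\<le>length c - 1. c ! k * Bernstein (length c - 1) k (t / T)) {0..T}"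

lemma bernstein_path_in_mspace:
  assumes "0 < T" shows "bernstein_path T c \<in> mspace (path_metric T)"
proof -
  have "continuous_on {0..T} (bernstein_path T c)"
    unfolding bernstein_path_def Bernstein_def
    using assms
    by (subst continuous_on_cong[OF refl restrict_apply']) (auto intro!: continuous_intros)
  then show ?thesis using assms by (auto simp: mspace_path_metric bernstein_path_def)
qed

text \<open>Bernstein's theorem gives approximation by polynomials with real coefficients. Since the Bernstein
  polynomials are a partition of unity, moving all coefficients by less than \<open>e/2\<close> moves the polynomial by at
  most \<open>e/2\<close>, so rational coefficients suffice.\<close>

lemma bernstein_paths_dense:
  assumes T: "0 < T" and p: "p \<in> mspace (path_metric T)" and e: "0 < e"
  shows "\<exists>c\<in>lists \<rat>. mdist (path_metric T) p (bernstein_path T c) \<le> e"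
proof -
  have cp: "continuous_on {0..T} p" using p T by (simp add: mspace_path_metric)
  define f where "f x = p (x * T)" for x
  have "continuous_on {0..1} f"
    unfolding f_def by (rule continuous_on_compose2[OF cp]) (use T in \<open>auto intro!: continuous_intros\<close>)
  from Bernstein_Weierstrass[OF this, of "e/2"] e obtain N where
    N: "\<And>n x. N \<le> n \<Longrightarrow> x \<in> {0..1} \<Longrightarrow> \<bar>f x - (\<Sum>k\<le>n. f (real k / real n) * Bernstein n k x)\<bar> < e / 2"
    by auto
  have "\<exists>q. q \<in> \<rat> \<and> \<bar>f (real k / real N) - q\<bar> < e / 2" for k
  proof -
    obtain q where "q \<in> \<rat>" "f (real k / real N) - e/2 < q" "q < f (real k / real N) + e/2"
      using Rats_dense_in_real[of "f (real k / real N) - e/2" "f (real k / real N) + e/2"] e by auto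
    then show ?thesis by (intro exI[of _ q]) (auto simp: abs_if)
  qed
  then obtain q where q: "\<And>k. q k \<in> \<rat>" "\<And>k. \<bar>f (real k / real N) - q k\<bar> < e / 2" by metis
  define c where "c = map q [0..<Suc N]"
  have len: "length c - Suc 0 = N" by (simp add: c_def)
  have ck: "c ! k = q k" if "k \<le> N" for k
    using that nth_map[of k "[0..<Suc N]" q] by (simp add: c_def del: upt_Suc)
  have cQ: "c \<in> lists \<rat>" using q by (auto simp: c_def)
  have "\<bar>p t - bernstein_path T c t\<bar> \<le> e" if t: "t \<in> {0..T}" for t
  proof -
    define x where "x = t / T"
    have x: "x \<in> {0..1}" and px: "p t = f x" using t T by (auto simp: x_def f_def)
    have "bernstein_path T c t = (\<Sum>k\<le>N. q k * Bernstein N k x)"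
      using t by (auto simp: bernstein_path_def len x_def ck intro!: sum.cong)
    then have "\<bar>(\<Sum>k\<le>N. f (real k / real N) * Bernstein N k x) - bernstein_path T c t\<bar>
        = \<bar>\<Sum>k\<le>N. (f (real k / real N) - q k) * Bernstein N k x\<bar>"
      by (simp add: sum_subtractf left_diff_distrib)
    also have "\<dots> \<le> (\<Sum>k\<le>N. \<bar>(f (real k / real N) - q k) * Bernstein N k x\<bar>)"
      by (rule sum_abs)
    also have "\<dots> \<le> (\<Sum>k\<le>N. e / 2 * Bernstein N k x)"
    proof (rule sum_mono)
      fix k
      show "\<bar>(f (real k / real N) - q k) * Bernstein N k x\<bar> \<le> e / 2 * Bernstein N k x"
        using mult_right_mono[OF less_imp_le[OF q(2)], of "Bernstein N k x" k] x
        by (simp add: abs_mult Bernstein_nonneg)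
    qed
    also have "\<dots> = e / 2" by (simp only: sum_distrib_left[symmetric] sum_Bernstein mult_1_right)
    finally show ?thesis using N[OF order_refl x] px by linarith
  qed
  then have "mdist (path_metric T) p (bernstein_path T c) \<le> e"
    using mdist_path_metric_le[OF T p bernstein_path_in_mspace[OF T]] by blast
  with cQ show ?thesis by blast
qed

text \<open>By continuity the uniform distance is a supremum over the dense times only, so closed balls are preimages of
  closed sets of sequences. As the space is separable, every open set is a countable union of such balls.\<close>

lemma path_space_generated_by_dense_times:
  fixes d :: "nat \<Rightarrow> real"
  assumes T: "0 < T" and d: "range d \<subseteq> {0..T}" and dense: "{0..T} \<subseteq> closure (range d)"
    and A: "A \<in> sets (path_space T)"
  shows "\<exists>B \<in> sets (borel :: (nat \<Rightarrow> real) measure). A = {p \<in> space (path_space T). (\<lambda>n. p (d n)) \<in> B}"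
proof -
  let ?m = "path_metric T" let ?S = "mspace ?m"
  interpret ms: Metric_space "mspace ?m" "mdist ?m" by (rule Metric_space_mspace_mdist)
  let ?V = "vimage_algebra ?S (\<lambda>p n. p (d n)) (borel :: (nat \<Rightarrow> real) measure)"
  have sp: "space (path_space T) = ?S" by (simp add: path_space_def space_measure_of_conv)
  have ball_sets: "{p \<in> ?S. mdist ?m p q \<le> r} \<in> sets ?V" if q: "q \<in> ?S" for q r
  proof -
    have cq: "continuous_on {0..T} q" using q T by (simp add: mspace_path_metric)
    have eq: "{p \<in> ?S. mdist ?m p q \<le> r} = (\<lambda>p n. p (d n)) -` {v. \<forall>n. \<bar>v n - q (d n)\<bar> \<le> r} \<inter> ?S"
    proof (intro set_eqI iffI)
      fix p assume "p \<in> {p \<in> ?S. mdist ?m p q \<le> r}"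
      then show "p \<in> (\<lambda>p n. p (d n)) -` {v. \<forall>n. \<bar>v n - q (d n)\<bar> \<le> r} \<inter> ?S"
        using mdist_path_metric_le[OF T _ q] rangeI[of d, THEN subsetD[OF d]] by auto
    next
      fix p assume p: "p \<in> (\<lambda>p n. p (d n)) -` {v. \<forall>n. \<bar>v n - q (d n)\<bar> \<le> r} \<inter> ?S"
      then have cp: "continuous_on {0..T} p" using T by (simp add: mspace_path_metric)
      have cl: "closure (range d) = {0..T}"
        using dense d closure_minimal[of "range d" "{0..T}"] by auto
      have "\<bar>p t - q t\<bar> \<le> r" if "t \<in> {0..T}" for t
      proof (rule continuous_le_on_closure[of "range d" "\<lambda>t. \<bar>p t - q t\<bar>" t r])
        show "continuous_on (closure (range d)) (\<lambda>t. \<bar>p t - q t\<bar>)"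
          unfolding cl by (intro continuous_intros cp cq)
      qed (use p that cl in auto)
      with p show "p \<in> {p \<in> ?S. mdist ?m p q \<le> r}" using mdist_path_metric_le[OF T _ q] by auto
    qed
    have "{v. \<forall>n. \<bar>v n - q (d n)\<bar> \<le> r} \<in> sets (borel :: (nat \<Rightarrow> real) measure)"
    proof -
      have "closed {v :: nat \<Rightarrow> real. \<forall>n. \<bar>v n - q (d n)\<bar> \<le> r}"
        by (intro closed_Collect_all closed_Collect_le continuous_intros continuous_on_product_coordinates)
      then show ?thesis by simp
    qed
    then show ?thesis unfolding eq by (rule in_vimage_algebra)
  qed
  have "openin (mtopology_of ?m) U \<Longrightarrow> U \<in> sets ?V" for U
  proof -
    assume U: "openin (mtopology_of ?m) U"
    define I where "I = {(c, r). c \<in> lists \<rat> \<and> r \<in> \<rat> \<and> {p \<in> ?S. mdist ?m p (bernstein_path T c) \<le> r} \<subseteq> U}"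
    have "countable I"
      by (rule countable_subset[of _ "lists \<rat> \<times> \<rat>"]) (auto simp: I_def countable_rat)
    have "U = (\<Union>(c, r)\<in>I. {p \<in> ?S. mdist ?m p (bernstein_path T c) \<le> r})"
    proof (intro equalityI subsetI)
      fix p assume p: "p \<in> U"
      with U have pS: "p \<in> ?S" and "\<exists>e>0. ms.mball p e \<subseteq> U"
        by (auto simp: mtopology_of_def ms.openin_mtopology)
      then obtain e where e: "e > 0" "ms.mball p e \<subseteq> U" by auto
      obtain r where r: "r \<in> \<rat>" "e / 4 < r" "r < e / 2"
        using Rats_dense_in_real[of "e/4" "e/2"] e by auto
      obtain c where c: "c \<in> lists \<rat>" "mdist ?m p (bernstein_path T c) \<le> r"
        using bernstein_paths_dense[OF T pS, of r] r e by auto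
      have "{p' \<in> ?S. mdist ?m p' (bernstein_path T c) \<le> r} \<subseteq> U"
      proof safe
        fix p' assume p': "p' \<in> ?S" "mdist ?m p' (bernstein_path T c) \<le> r"
        have "mdist ?m p p' \<le> mdist ?m p (bernstein_path T c) + mdist ?m (bernstein_path T c) p'"
          by (rule ms.triangle[OF pS bernstein_path_in_mspace[OF T] p'(1)])
        also have "\<dots> \<le> r + r" using c p' by (simp add: ms.commute)
        finally have "p' \<in> ms.mball p e" using r pS p' by auto
        then show "p' \<in> U" using e by auto
      qed
      then have "(c, r) \<in> I" using c r by (auto simp: I_def)
      then show "p \<in> (\<Union>(c, r)\<in>I. {p \<in> ?S. mdist ?m p (bernstein_path T c) \<le> r})" using c pS by auto
    qed (auto simp: I_def)
    moreover have "(\<Union>(c, r)\<in>I. {p \<in> ?S. mdist ?m p (bernstein_path T c) \<le> r}) \<in> sets ?V"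
      using \<open>countable I\<close> ball_sets[OF bernstein_path_in_mspace[OF T]]
      by (intro sets.countable_UN') auto
    ultimately show "U \<in> sets ?V" by simp
  qed
  then have "{U. openin (mtopology_of ?m) U} \<subseteq> sets ?V" by auto
  then have "sigma_sets ?S {U. openin (mtopology_of ?m) U} \<subseteq> sets ?V"
    using sets.sigma_sets_subset[of _ ?V] by simp
  moreover have "{U. openin (mtopology_of ?m) U} \<subseteq> Pow ?S"
    using openin_subset[of "mtopology_of ?m"] by auto
  ultimately have "sets (path_space T) \<subseteq> sets ?V"
    by (simp add: path_space_def sets_measure_of)
  with A have "A \<in> sets ?V" by auto
  then obtain B where "B \<in> sets (borel :: (nat \<Rightarrow> real) measure)" "A = (\<lambda>p n. p (d n)) -` B \<inter> ?S"
    by (auto simp: sets_vimage_algebra2)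
  then show ?thesis by (intro bexI[of _ B]) (auto simp: sp)
qed

text \<open>The Euler scheme is evaluated at its grid points, hence these have to be among the dense times.\<close>

lemma dense_times_with_grid:
  fixes T h :: real
  assumes T: "0 < T" and h: "0 < h"
  shows "\<exists>d :: nat \<Rightarrow> real. range d \<subseteq> {0..T} \<and> {0..T} \<subseteq> closure (range d) \<and>
    (\<forall>k. real k * h \<le> T \<longrightarrow> real k * h \<in> range d)"
proof -
  define D where "D = ({0..T} \<inter> \<rat>) \<union> ({0..T} \<inter> range (\<lambda>k::nat. real k * h))"
  have D: "countable D" "0 \<in> D"
    using T by (auto simp: D_def intro: countable_Int2 countable_rat)
  then have range: "range (from_nat_into D) = D" by (intro range_from_nat_into) auto
  have "{0<..<T} \<subseteq> {0<..<T} \<inter> closure \<rat>" using Rats_closure_real by simp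
  also have "\<dots> \<subseteq> closure ({0<..<T} \<inter> \<rat>)" by (rule open_Int_closure_subset) simp
  also have "\<dots> \<subseteq> closure D" by (rule closure_mono) (auto simp: D_def)
  finally have "closure {0<..<T} \<subseteq> closure D" by (rule closure_minimal) simp
  then have "{0..T} \<subseteq> closure D" using T by (simp add: closure_greaterThanLessThan)
  moreover have "real k * h \<in> D" if "real k * h \<le> T" for k using that h by (auto simp: D_def)
  moreover have "D \<subseteq> {0..T}" by (auto simp: D_def)
  ultimately show ?thesis by (intro exI[of _ "from_nat_into D"]) (auto simp: range)
qed

text \<open>Translates events about paths into events about sequences.\<close>

lemma path_of_mem_iff:
  assumes "0 < T" and d: "range d \<subseteq> {0..T}" and "continuous_on {0..T} (\<lambda>t. X t \<omega>)"
  shows "path_of T X \<omega> \<in> {p \<in> space (path_space T). (\<lambda>n. p (d n)) \<in> B} \<longleftrightarrow> (\<lambda>n. X (d n) \<omega>) \<in> B"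
proof -
  have "d n \<in> {0..T}" for n using d by blast
  then have "(\<lambda>n. path_of T X \<omega> (d n)) = (\<lambda>n. X (d n) \<omega>)" by (auto simp: path_of_def)
  then show ?thesis using path_of_in_path_space[where X=X and \<omega>=\<omega>, OF assms(1,3)] by simp
qed

lemma measurable_path_of:
  assumes T: "0 < T" and X: "\<And>t. t \<in> {0..T} \<Longrightarrow> X t \<in> borel_measurable M"
    and cont: "\<And>\<omega>. \<omega> \<in> space M \<Longrightarrow> continuous_on {0..T} (\<lambda>t. X t \<omega>)"
  shows "path_of T X \<in> measurable M (path_space T)"
proof (rule measurableI)
  obtain d :: "nat \<Rightarrow> real" where d: "range d \<subseteq> {0..T}" "{0..T} \<subseteq> closure (range d)"
    using dense_times_with_grid[OF T zero_less_one] by blast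
  have dn: "d n \<in> {0..T}" for n using d by blast
  fix A assume "A \<in> sets (path_space T)"
  then obtain B where B: "B \<in> sets (borel :: (nat \<Rightarrow> real) measure)"
    and A: "A = {p \<in> space (path_space T). (\<lambda>n. p (d n)) \<in> B}"
    using path_space_generated_by_dense_times[OF T d] by blast
  have "(\<lambda>\<omega> n. X (d n) \<omega>) \<in> borel_measurable M"
    by (rule measurable_coordinatewise_then_product) (rule X[OF dn])
  from measurable_sets[OF this B]
  show "path_of T X -` A \<inter> space M \<in> sets M"
    using path_of_mem_iff[where X=X, OF T d(1) cont]
    by (auto simp: A cong: conj_cong elim!: back_subst[of "\<lambda>S. S \<in> sets M"])
qed (rule path_of_in_path_space[where X=X, OF T cont])

section \<open>Reflection at zero\<close>

lemma skorohod_problem_cong: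
  assumes "\<And>t. t \<in> {0..T} \<Longrightarrow> y t = y' t"
  shows "skorohod_problem T y x l = skorohod_problem T y' x l"
  using assms by (simp add: skorohod_problem_def)

lemma skorohod_initial_value:
  assumes "skorohod_problem T y x l" "0 \<le> T" shows "x 0 = y 0"
  using assms by (auto simp: skorohod_problem_def)

text \<open>The reflection term is recovered from the Stieltjes integral over \<open>[0,t]\<close>; while the path is away from zero
  the integrand vanishes, so the integrals over \<open>[0,s]\<close> and \<open>[0,t]\<close> have the same integrand.\<close>

lemma skorohod_local_time_constant:
  assumes sk: "skorohod_problem T y x l" and st: "0 \<le> s" "s \<le> t" "t \<le> T"
    and pos: "\<And>r. r \<in> {s<..t} \<Longrightarrow> x r \<noteq> 0"
  shows "l t = l s"
proof -
  have "l t = (LINT r:{0..t}|stieltjes_measure T l. indicat_real {r. x r = 0} r)"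
    using sk st by (auto simp: skorohod_problem_def)
  also have "\<dots> = (LINT r:{0..s}|stieltjes_measure T l. indicat_real {r. x r = 0} r)"
    unfolding set_lebesgue_integral_def
    by (rule Bochner_Integration.integral_cong) (use st pos in \<open>auto simp: indicator_def\<close>)
  also have "\<dots> = l s"
    using sk st by (auto simp: skorohod_problem_def)
  finally show ?thesis .
qed

text \<open>Half of the explicit solution \<open>l t - l s = max 0 (sup (- (x s + y u - y s)))\<close> of the Skorohod problem restarted at
  time \<open>s\<close>. The witness \<open>u\<close> is the first time at which \<open>l\<close> reaches its final value \<open>l t\<close>: it increases up to there,
  so the path must be at zero at time \<open>u\<close>.\<close>

lemma skorohod_local_time_increment_attained:
  assumes sk: "skorohod_problem T y x l" and st: "0 \<le> s" "s \<le> t" "t \<le> T"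
    and inc: "l s < l t"
  shows "\<exists>u\<in>{s..t}. l t - l s = - (x s + (y u - y s))"
proof -
  have cx: "continuous_on {0..T} x" and cl: "continuous_on {0..T} l"
    and eq: "\<And>r. r \<in> {0..T} \<Longrightarrow> x r = y r + l r"
    using sk by (auto simp: skorohod_problem_def)
  define S where "S = {r\<in>{s..t}. l r = l t}"
  have "closed S"
    unfolding S_def
    by (rule continuous_closed_preimage_constant)
       (use st in \<open>auto intro: continuous_on_subset[OF cl]\<close>)
  moreover have "S \<noteq> {}" "bdd_below S"
    using st by (auto simp: S_def intro!: exI[of _ t] bdd_belowI[of _ s])
  ultimately have "Inf S \<in> S" by (intro closed_contains_Inf)
  define u where "u = Inf S"
  have u: "s < u" "u \<le> t" "l u = l t"
    using \<open>Inf S \<in> S\<close> inc by (auto simp: S_def u_def less_le)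
  have "x u = 0"
  proof (rule ccontr)
    assume "x u \<noteq> 0"
    have "u \<in> {0..T}" using u st by auto
    with cx have "continuous (at u within {0..T}) x" by (auto simp: continuous_on_eq_continuous_within)
    from continuous_within_avoid[OF this \<open>x u \<noteq> 0\<close>] obtain \<delta> where
      \<delta>: "\<delta> > 0" "\<And>r. r \<in> {0..T} \<Longrightarrow> dist u r < \<delta> \<Longrightarrow> x r \<noteq> 0" by auto
    \<comment> \<open>otherwise \<open>l\<close> would already be constant shortly before its first hitting time \<open>u\<close> of the value \<open>l t\<close>\<close>
    define r where "r = max s (u - \<delta> / 2)"
    have r: "s \<le> r" "r < u" using \<delta> u by (auto simp: r_def)
    have "l u = l r"
      by (rule skorohod_local_time_constant[OF sk])
         (use r u st \<delta> in \<open>auto simp: r_def dist_real_def intro!: \<delta>(2)\<close>)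
    then have "r \<in> S" using r u by (auto simp: S_def)
    then have "u \<le> r" unfolding u_def by (rule cInf_lower) (rule \<open>bdd_below S\<close>)
    with r show False by simp
  qed
  then show ?thesis using eq[of u] eq[of s] u st by (intro bexI[of _ u]) auto
qed

text \<open>The other half of the explicit solution: the path has to stay non-negative at time \<open>u\<close>, and \<open>l\<close> is
  non-decreasing.\<close>

lemma skorohod_local_time_increment_ge:
  assumes sk: "skorohod_problem T y x l" and st: "0 \<le> s" "s \<le> u" "u \<le> t" "t \<le> T"
  shows "- (x s + (y u - y s)) \<le> l t - l s"
proof -
  have "x u = y u + l u" "x s = y s + l s" "0 \<le> x u"
    using sk st by (auto simp: skorohod_problem_def)
  moreover have "mono_on {0..T} l" using sk by (simp add: skorohod_problem_def)
  then have "l u \<le> l t" by (rule mono_onD) (use st in auto)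
  ultimately show ?thesis by linarith
qed

text \<open>One bound \<open>B\<close> pays for the increment of the driving path, the other for the reflection term, which by the
  explicit solution and \<open>x s \<ge> 0\<close> cannot exceed the oscillation of the driving path.\<close>

lemma skorohod_increment_bound:
  assumes sk: "skorohod_problem T y x l" and st: "0 \<le> s" "s \<le> t" "t \<le> T"
    and bd: "\<And>u. u \<in> {s..t} \<Longrightarrow> \<bar>y u - y s\<bar> \<le> B"
  shows "\<bar>x t - x s\<bar> \<le> 2 * B"
proof -
  have "mono_on {0..T} l" using sk by (simp add: skorohod_problem_def)
  then have mono: "l s \<le> l t" by (rule mono_onD) (use st in auto)
  have "x t = y t + l t" "x s = y s + l s" "0 \<le> x s"
    using sk st by (auto simp: skorohod_problem_def)
  moreover have "l t - l s \<le> B"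
  proof (cases "l s < l t")
    case True
    then obtain u where "u \<in> {s..t}" "l t - l s = - (x s + (y u - y s))"
      using skorohod_local_time_increment_attained[OF sk st] by auto
    with bd[of u] \<open>0 \<le> x s\<close> show ?thesis by auto
  next
    case False
    with bd[of s] mono st show ?thesis by auto
  qed
  moreover have "\<bar>y t - y s\<bar> \<le> B" using bd st by auto
  ultimately show ?thesis using mono by linarith
qed

section \<open>The time grid\<close>

lemma euler_grid_bounds:
  assumes "0 < h" "0 \<le> s"
  shows "0 \<le> euler_grid h s" "euler_grid h s \<le> s" "s < euler_grid h s + h"
proof -
  have "real_of_int \<lfloor>s / h\<rfloor> \<le> s / h" "s / h < real_of_int \<lfloor>s / h\<rfloor> + 1" by linarith+
  then have "real_of_int \<lfloor>s / h\<rfloor> * h \<le> s" "s < (real_of_int \<lfloor>s / h\<rfloor> + 1) * h"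
    using assms by (simp_all only: pos_le_divide_eq pos_divide_less_eq)
  then show "euler_grid h s \<le> s" "s < euler_grid h s + h"
    by (simp_all add: euler_grid_def algebra_simps)
  show "0 \<le> euler_grid h s" using assms by (auto simp: euler_grid_def)
qed

lemma euler_grid_tendsto:
  assumes "0 < c" "0 \<le> u"
  shows "(\<lambda>n. euler_grid (c / real (Suc n)) u) \<longlonglongrightarrow> u"
proof (rule real_tendsto_sandwich)
  have "(\<lambda>n. u - c * inverse (real (Suc n))) \<longlonglongrightarrow> u - c * 0"
    by (intro tendsto_intros LIMSEQ_inverse_real_of_nat)
  then show "(\<lambda>n. u - c / real (Suc n)) \<longlonglongrightarrow> u" by (simp add: divide_inverse)
  show "(\<lambda>n. u) \<longlonglongrightarrow> u" by simp
  have "euler_grid (c / real (Suc n)) u \<le> u" "u - c / real (Suc n) \<le> euler_grid (c / real (Suc n)) u" for n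
    using euler_grid_bounds[of "c / real (Suc n)" u] assms by auto
  then show "\<forall>\<^sub>F n in sequentially. u - c / real (Suc n) \<le> euler_grid (c / real (Suc n)) u"
    "\<forall>\<^sub>F n in sequentially. euler_grid (c / real (Suc n)) u \<le> u" by simp_all
qed

lemma euler_grid_eq:
  assumes "0 < h" "real k * h \<le> s" "s < real (Suc k) * h"
  shows "euler_grid h s = real k * h"
proof -
  have "\<lfloor>s / h\<rfloor> = int k"
    using assms by (intro floor_unique) (auto simp: field_simps)
  then show ?thesis by (simp add: euler_grid_def)
qed

lemma borel_measurable_euler_grid [measurable]:
  "(\<lambda>s. g (euler_grid h s) :: real) \<in> borel_measurable borel"
proof -
  have "(\<lambda>s::real. \<lfloor>s / h\<rfloor>) \<in> measurable borel (count_space UNIV)" by measurable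
  then show ?thesis unfolding euler_grid_def
    by (rule measurable_compose) simp
qed

lemma set_integrable_euler_grid:
  assumes "0 < h" and bd: "\<And>s. s \<in> {0..T} \<Longrightarrow> \<bar>g s\<bar> \<le> B"
    and A: "A \<in> sets borel" "A \<subseteq> {0..T}"
  shows "set_integrable lborel A (\<lambda>s. g (euler_grid h s) :: real)"
proof -
  have "set_integrable lborel {0..T} (\<lambda>s. g (euler_grid h s))"
    unfolding set_integrable_def
  proof (rule Bochner_Integration.integrable_bound[of _ "\<lambda>s. indicator {0..T} s *\<^sub>R B"])
    show "integrable lborel (\<lambda>s. indicator {0..T} s *\<^sub>R B)"
      by (intro integrable_scaleR_left) (simp add: integrable_indicator_iff emeasure_lborel_Icc_eq)
    have "\<bar>g (euler_grid h s)\<bar> \<le> \<bar>B\<bar>" if "s \<in> {0..T}" for s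
      using bd[of "euler_grid h s"] euler_grid_bounds[OF \<open>0 < h\<close>, of s] that by auto
    then show "AE x in lborel. norm (indicat_real {0..T} x *\<^sub>R g (euler_grid h x))
        \<le> norm (indicat_real {0..T} x *\<^sub>R B)"
      by (intro AE_I2) (auto simp: indicator_def)
    show "(\<lambda>s. indicat_real {0..T} s *\<^sub>R g (euler_grid h s)) \<in> borel_measurable lborel"
      using borel_measurable_euler_grid[of g h] by measurable
  qed
  then show ?thesis by (rule set_integrable_subset) (use A in auto)
qed

text \<open>At the right end point \<open>(k + 1) h\<close> the grid function already jumps; this single point is a null set.\<close>

lemma integral_euler_grid_step:
  assumes h: "0 < h" and bd: "\<And>s. s \<in> {0..T} \<Longrightarrow> \<bar>g s\<bar> \<le> B"
    and u: "real k * h \<le> u" "u \<le> real (Suc k) * h" "u \<le> T"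
  shows "(LBINT s:{0..u}. g (euler_grid h s)) =
    (LBINT s:{0..real k * h}. g (euler_grid h s)) + g (real k * h) * (u - real k * h)"
proof -
  have 0: "0 \<le> real k * h" using h by simp
  have un: "{0..u} = {0..real k * h} \<union> {real k * h<..u}" using u 0 by auto
  have "(LBINT s:{0..u}. g (euler_grid h s)) =
     (LBINT s:{0..real k * h}. g (euler_grid h s)) + (LBINT s:{real k * h<..u}. g (euler_grid h s))"
    unfolding un
    by (intro set_integral_Un set_integrable_euler_grid[OF h bd]) (use u 0 in auto)
  also have "(LBINT s:{real k * h<..u}. g (euler_grid h s)) = (LBINT s:{real k * h<..u}. g (real k * h))"
  proof (rule set_lebesgue_integral_cong_AE)
    have "AE s in lborel. s \<noteq> real (Suc k) * h" by (rule AE_lborel_singleton)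
    then show "AE s\<in>{real k * h<..u} in lborel. g (euler_grid h s) = g (real k * h)"
      proof eventually_elim
      case (elim s)
      then show ?case
        using u euler_grid_eq[OF h, of k s] by (auto simp del: of_nat_Suc)
    qed
  qed (auto simp: borel_measurable_euler_grid)
  also have "\<dots> = g (real k * h) * (u - real k * h)"
    using u by (simp add: set_integral_const mult.commute)
  finally show ?thesis .
qed

lemma lebesgue_integral_singleton_zero: "(LBINT s:{a}. f s :: real) = 0"
proof -
  have "AE s in lborel. s \<noteq> a" by (rule AE_lborel_singleton)
  then have "AE s in lborel. indicat_real {a} s *\<^sub>R f s = 0" by eventually_elim simp
  then show ?thesis unfolding set_lebesgue_integral_def by (rule integral_eq_zero_AE)
qed

text \<open>This identity is used with the step \<open>h\<close> of the scheme and also with the step of an auxiliary partition that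
  tends to zero.\<close>

lemma integral_euler_grid_eq_riemann_sum:
  assumes h: "0 < h" and bd: "\<And>s. s \<in> {0..T} \<Longrightarrow> \<bar>g s\<bar> \<le> B"
    and "real j * h \<le> T"
  shows "(LBINT s:{0..real j * h}. g (euler_grid h s)) = (\<Sum>i<j. h * g (real i * h))"
  using \<open>real j * h \<le> T\<close>
proof (induction j)
  case 0
  then show ?case by (simp add: lebesgue_integral_singleton_zero)
next
  case (Suc j)
  have "real j * h \<le> real (Suc j) * h" using h by (simp add: algebra_simps)
  with Suc show ?case
    by (subst integral_euler_grid_step[OF h bd, where k=j]) (auto simp: algebra_simps)
qed

lemma continuous_euler_grid_off_grid:
  assumes h: "0 < h" and s: "0 \<le> s" "s \<notin> range (\<lambda>k::nat. real k * h)"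
  shows "continuous (at s within S) (\<lambda>s. g (euler_grid h s) :: real)"
proof -
  define k where "k = nat \<lfloor>s / h\<rfloor>"
  have "real k * h = euler_grid h s" using s h by (simp add: k_def euler_grid_def)
  then have "real k * h \<le> s" "s < real (Suc k) * h"
    using euler_grid_bounds[OF h s(1)] by (auto simp: algebra_simps)
  moreover have "real k * h \<noteq> s" using s by auto
  ultimately have "s \<in> {real k * h<..<real (Suc k) * h}" by auto
  then have "\<forall>\<^sub>F r in at s within S. r \<in> {real k * h<..<real (Suc k) * h}"
    by (intro eventually_at_topological[THEN iffD2] exI[of _ "{real k * h<..<real (Suc k) * h}"]) auto
  then have "\<forall>\<^sub>F r in at s within S. g (euler_grid h r) = g (euler_grid h s)"
    by eventually_elim (use euler_grid_eq[OF h, of k] \<open>s \<in> _\<close> in \<open>auto simp del: of_nat_Suc\<close>)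
  then show ?thesis unfolding continuous_within by (rule tendsto_eventually)
qed

section \<open>The Euler scheme as a functional of the driving path\<close>

context
  fixes b :: "real \<Rightarrow> real" and \<sigma> h T :: real and d :: "nat \<Rightarrow> real"
begin

definition time_index :: "real \<Rightarrow> nat" where
  "time_index u = (SOME n. d n = u)"

text \<open>The value at time \<open>t\<close> of the scheme restarted at time \<open>s\<close> from the point \<open>x\<close>, as a function of the values \<open>v n\<close> of
  the driving path at the times \<open>d n\<close>. The supremum is taken in the extended non-negative reals: the embedding
  truncates negative values to zero, which is the outer maximum in the solution of the Skorohod problem, and the
  expression stays measurable without any boundedness assumption on \<open>v\<close>. Only \<open>b\<close> on the half-line may enter,
  whence the truncation of its argument.\<close>

definition reflected_step :: "real \<Rightarrow> real \<Rightarrow> real \<Rightarrow> (nat \<Rightarrow> real) \<Rightarrow> real" where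
  "reflected_step x s t v =
    (let free = (\<lambda>n. x + b (max 0 x) * (d n - s) + \<sigma> * (v n - v (time_index s)))
     in free (time_index t) + enn2real (SUP n\<in>{n. d n \<in> {s..t}}. ennreal (- free n)))"

primrec grid_value :: "real \<Rightarrow> nat \<Rightarrow> (nat \<Rightarrow> real) \<Rightarrow> real" where
  "grid_value x0 0 v = x0"
| "grid_value x0 (Suc k) v = reflected_step (grid_value x0 k v) (real k * h) (real (Suc k) * h) v"

text \<open>At an arbitrary time the scheme is restarted from the last grid point.\<close>

definition euler_functional :: "real \<Rightarrow> (nat \<Rightarrow> real) \<Rightarrow> nat \<Rightarrow> real" where
  "euler_functional x0 v n =
    (let k = nat \<lfloor>d n / h\<rfloor> in reflected_step (grid_value x0 k v) (real k * h) (d n) v)"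

lemma time_index_eq: "s \<in> range d \<Longrightarrow> d (time_index s) = s"
  unfolding time_index_def by (rule someI_ex) auto

lemma borel_measurable_reflected_step:
  assumes b: "(\<lambda>x. b (max 0 x)) \<in> borel_measurable borel"
    and x: "x \<in> borel_measurable (borel :: (nat \<Rightarrow> real) measure)"
  shows "(\<lambda>v. reflected_step (x v) s t v) \<in> borel_measurable (borel :: (nat \<Rightarrow> real) measure)"
proof -
  have [measurable]: "(\<lambda>v. v n) \<in> borel_measurable (borel :: (nat \<Rightarrow> real) measure)" for n
    by (rule borel_measurable_continuous_onI) (rule continuous_on_product_coordinates)
  have [measurable]: "(\<lambda>v. b (max 0 (x v))) \<in> borel_measurable (borel :: (nat \<Rightarrow> real) measure)"
    using measurable_compose[OF x b] .
  note x [measurable]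
  show ?thesis unfolding reflected_step_def Let_def by measurable
qed

lemma borel_measurable_euler_functional:
  assumes b: "(\<lambda>x. b (max 0 x)) \<in> borel_measurable borel"
  shows "euler_functional x0 \<in> borel_measurable (borel :: (nat \<Rightarrow> real) measure)"
proof -
  have "grid_value x0 k \<in> borel_measurable (borel :: (nat \<Rightarrow> real) measure)" for k
    by (induction k) (auto intro!: borel_measurable_reflected_step[OF b])
  then show ?thesis
    by (intro measurable_coordinatewise_then_product)
       (auto simp: euler_functional_def Let_def intro!: borel_measurable_reflected_step[OF b])
qed

text \<open>On \<open>[k h, t]\<close> the driving path of the scheme has constant drift \<open>b (x (k h))\<close>, so the reflection term is the
  supremum of an explicit continuous function, and this supremum can be taken over the dense times.\<close>

lemma reflected_step_correct:
  assumes h: "0 < h" and d: "range d \<subseteq> {0..T}" and dense: "{0..T} \<subseteq> closure (range d)"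
    and b: "continuous_on {0..} b"
    and sk: "skorohod_problem T (\<lambda>t. x0 + (LBINT s:{0..t}. b (x (euler_grid h s))) + \<sigma> * w t) x l"
    and t: "real k * h \<le> t" "t \<le> real (Suc k) * h"
    and D: "real k * h \<in> range d" "t \<in> range d"
  shows "x t = reflected_step (x (real k * h)) (real k * h) t (\<lambda>n. w (d n))"
proof -
  define s where "s = real k * h"
  define y where "y t = x0 + (LBINT s:{0..t}. b (x (euler_grid h s))) + \<sigma> * w t" for t
  define z where "z u = x s + b (max 0 (x s)) * (u - s) + \<sigma> * (w u - w s)" for u
  have st: "0 \<le> s" "s \<le> t" "t \<le> T" using t D d h by (auto simp: s_def)
  note sk = sk[folded y_def]
  have x0: "0 \<le> x u" if "u \<in> {0..T}" for u using that sk by (auto simp: skorohod_problem_def)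
  have cx: "continuous_on {0..T} x" using sk by (simp add: skorohod_problem_def)
  have "continuous_on {0..T} (\<lambda>s. b (x s))"
    by (rule continuous_on_compose2[OF b cx]) (use x0 in auto)
  then have "bounded ((\<lambda>s. b (x s)) ` {0..T})"
    by (intro compact_imp_bounded compact_continuous_image) auto
  then obtain B where "\<forall>r\<in>(\<lambda>s. b (x s)) ` {0..T}. norm r \<le> B"
    by (auto simp only: bounded_iff)
  then have B: "\<And>s. s \<in> {0..T} \<Longrightarrow> \<bar>b (x s)\<bar> \<le> B" by auto
  have yz: "x s + (y u - y s) = z u" if "u \<in> {s..t}" for u
  proof -
    have "(LBINT r:{0..u}. b (x (euler_grid h r))) =
        (LBINT r:{0..s}. b (x (euler_grid h r))) + b (x s) * (u - s)"
      unfolding s_def by (rule integral_euler_grid_step[OF h B]) (use that t st s_def in auto)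
    then show ?thesis using x0[of s] st by (simp add: y_def z_def algebra_simps)
  qed
  have mono: "mono_on {0..T} l" and xyl: "\<And>u. u \<in> {0..T} \<Longrightarrow> x u = y u + l u"
    using sk by (auto simp: skorohod_problem_def)
  have lst: "l s \<le> l t" by (rule mono_onD[OF mono]) (use st in auto)
  have cl: "continuous_on {0..T} l" using sk by (simp add: skorohod_problem_def)
  have "continuous_on {s..t} (\<lambda>u. ennreal (- (x s + ((x u - l u) - y s))))"
    using st by (auto intro!: continuous_intros continuous_on_ennreal
        continuous_on_subset[OF cx] continuous_on_subset[OF cl])
  also have "?this \<longleftrightarrow> continuous_on {s..t} (\<lambda>u. ennreal (- z u))"
  proof (rule continuous_on_cong[OF refl])
    fix u assume u: "u \<in> {s..t}"
    then have "x u - l u = y u" using xyl[of u] st by auto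
    then show "ennreal (- (x s + ((x u - l u) - y s))) = ennreal (- z u)" using yz[OF u] by simp
  qed
  finally have z: "continuous_on {s..t} (\<lambda>u. ennreal (- z u))" .
  have "(SUP n\<in>{n. d n \<in> {s..t}}. ennreal (- z (d n))) = ennreal (l t - l s)"
  proof (rule antisym)
    show "(SUP n\<in>{n. d n \<in> {s..t}}. ennreal (- z (d n))) \<le> ennreal (l t - l s)"
    proof (rule SUP_least)
      fix n assume "n \<in> {n. d n \<in> {s..t}}"
      then show "ennreal (- z (d n)) \<le> ennreal (l t - l s)"
        using skorohod_local_time_increment_ge[OF sk st(1), of "d n" t] st yz[of "d n"]
        by (intro ennreal_leI) auto
    qed
    \<comment> \<open>the increment is attained at some \<open>u\<close>, which need not be one of the dense times\<close>
    show "ennreal (l t - l s) \<le> (SUP n\<in>{n. d n \<in> {s..t}}. ennreal (- z (d n)))" (is "_ \<le> ?S")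
    proof (cases "l s < l t")
      case True
      then have "s < t" using st by (cases "s = t") auto
      obtain u where u: "u \<in> {s..t}" "l t - l s = - z u"
        using skorohod_local_time_increment_attained[OF sk st True] yz by metis
      have cl: "closure {s<..<t} = {s..t}" using \<open>s < t\<close> by (rule closure_greaterThanLessThan)
      have "{s<..<t} \<subseteq> closure ({s<..<t} \<inter> range d)"
      proof -
        have "{s<..<t} \<subseteq> {0..T}" using st by auto
        with dense have "{s<..<t} \<subseteq> {s<..<t} \<inter> closure (range d)" by blast
        then show ?thesis using open_Int_closure_subset[of "{s<..<t}" "range d"] by auto
      qed
      then have cl': "{s..t} \<subseteq> closure ({s<..<t} \<inter> range d)"
        using closure_minimal[of "{s<..<t}" "closure ({s<..<t} \<inter> range d)"] cl by auto
      moreover have "closure ({s<..<t} \<inter> range d) \<subseteq> {s..t}"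
        by (rule closure_minimal) auto
      ultimately have cl2: "closure ({s<..<t} \<inter> range d) = {s..t}" by auto
      have "(\<lambda>u. ennreal (- z u)) ` closure ({s<..<t} \<inter> range d) \<subseteq> {..?S}"
      proof (rule image_closure_subset)
        show "continuous_on (closure ({s<..<t} \<inter> range d)) (\<lambda>u. ennreal (- z u))"
          using z unfolding cl2 by simp
        show "(\<lambda>u. ennreal (- z u)) ` ({s<..<t} \<inter> range d) \<subseteq> {..?S}"
          by (auto intro!: SUP_upper)
      qed simp
      then have "ennreal (- z u) \<le> ?S" using u cl2 by blast
      then show ?thesis using u by simp
    qed (simp add: ennreal_neg)
  qed
  then have "enn2real (SUP n\<in>{n. d n \<in> {s..t}}. ennreal (- z (d n))) = l t - l s"
    using lst by simp
  moreover have "x t = z t + (l t - l s)"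
    using yz[of t] st xyl[of t] xyl[of s] by auto
  ultimately show ?thesis
    using time_index_eq[OF D(1)] time_index_eq[OF D(2)]
    by (simp add: reflected_step_def Let_def z_def s_def[symmetric])
qed

lemma euler_functional_correct:
  assumes h: "0 < h" and d: "range d \<subseteq> {0..T}" and dense: "{0..T} \<subseteq> closure (range d)"
    and grid: "\<And>k. real k * h \<le> T \<Longrightarrow> real k * h \<in> range d"
    and b: "continuous_on {0..} b" and w: "w 0 = 0" and "0 \<le> T"
    and sk: "skorohod_problem T (\<lambda>t. x0 + (LBINT s:{0..t}. b (x (euler_grid h s))) + \<sigma> * w t) x l"
  shows "(\<lambda>n. x (d n)) = euler_functional x0 (\<lambda>n. w (d n))"
proof
  fix n
  note step = reflected_step_correct[OF h d dense b sk]
  have "(LBINT s:{0..0}. b (x (euler_grid h s))) = 0"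
    by (simp add: lebesgue_integral_singleton_zero)
  then have "x 0 = x0" using sk w \<open>0 \<le> T\<close> by (auto simp: skorohod_problem_def)
  have gv: "real k * h \<le> T \<Longrightarrow> x (real k * h) = grid_value x0 k (\<lambda>n. w (d n))" for k
  proof (induction k)
    case (Suc k)
    have "real k * h \<le> real (Suc k) * h" using h by (simp add: algebra_simps)
    with Suc show ?case
      using step[of k "real (Suc k) * h"] grid[of k] grid[of "Suc k"] by (simp del: of_nat_Suc)
  qed (simp add: \<open>x 0 = x0\<close>)
  define k where "k = nat \<lfloor>d n / h\<rfloor>"
  have dn: "d n \<in> {0..T}" using d by blast
  then have k: "real k * h = euler_grid h (d n)" using h by (simp add: k_def euler_grid_def)
  have "real k * h \<le> d n" "d n \<le> real (Suc k) * h"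
    using euler_grid_bounds[OF h, of "d n"] dn k by (auto simp: algebra_simps)
  with dn step[of k "d n"] grid[of k] gv[of k]
  show "x (d n) = euler_functional x0 (\<lambda>n. w (d n)) n"
    by (simp add: euler_functional_def k_def[symmetric])
qed

end

section \<open>Change of measure for Gaussian increments\<close>

text \<open>The preimages under a random variable form an intersection stable generator, so independence of the two
  families of sets is independence of the variables.\<close>

lemma (in prob_space) indep_set_imp_indep_var:
  assumes sub: "subalgebra M G" and ind: "indep_set (sets G) {\<xi> -` A \<inter> space M | A. A \<in> sets borel}"
    and R: "R \<in> borel_measurable G" and \<xi>: "\<xi> \<in> borel_measurable M"
  shows "indep_var borel R borel (\<xi> :: 'a \<Rightarrow> real)"
proof -
  have RM: "R \<in> borel_measurable M" by (rule measurable_from_subalg[OF sub R])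
  have sp: "space G = space M" using sub by (simp add: subalgebra_def)
  have stable: "Int_stable {f -` A \<inter> space M | A. A \<in> sets K}" for f and K :: "'z measure"
  proof (rule Int_stableI)
    fix a b assume "a \<in> {f -` A \<inter> space M | A. A \<in> sets K}" "b \<in> {f -` A \<inter> space M | A. A \<in> sets K}"
    then obtain A B where "a = f -` A \<inter> space M" "b = f -` B \<inter> space M" "A \<in> sets K" "B \<in> sets K" by auto
    then show "a \<inter> b \<in> {f -` A \<inter> space M | A. A \<in> sets K}"
      by (intro CollectI exI[of _ "A \<inter> B"]) auto
  qed
  have "{R -` A \<inter> space M | A. A \<in> sets borel} \<subseteq> sets G"
    using measurable_sets[OF R] sp by auto
  then have sub: "case_bool {R -` A \<inter> space M | A. A \<in> sets borel} {\<xi> -` A \<inter> space M | A. A \<in> sets borel} i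
      \<subseteq> case_bool (sets G) {\<xi> -` A \<inter> space M | A. A \<in> sets borel} i" for i
    by (cases i) simp_all
  have "indep_set {R -` A \<inter> space M | A. A \<in> sets borel} {\<xi> -` A \<inter> space M | A. A \<in> sets borel}"
    using indep_sets_mono_sets[OF ind[unfolded indep_set_def] sub] by (simp add: indep_set_def)
  from indep_set_sigma_sets[OF this stable stable] show ?thesis
    unfolding indep_var_eq using RM \<xi> by auto
qed

text \<open>A pointwise form of Pinsker's inequality. With \<open>r = sqrt z\<close>, the bound \<open>ln r \<le> r - 1\<close> gives
  \<open>(1 - r)\<^sup>2 \<le> z - 1 - ln z\<close>, while \<open>1 - z \<le> 2 (1 - r)\<close>. The free parameter \<open>\<epsilon>\<close> replaces the
  Cauchy-Schwarz inequality, as it is optimised only at the very end.\<close>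

lemma one_minus_le_relative_entropy:
  fixes z \<epsilon> :: real
  assumes z: "0 < z" and \<epsilon>: "0 < \<epsilon>"
  shows "1 - z \<le> \<epsilon> + (z - 1 - ln z) / \<epsilon>"
proof -
  define r where "r = sqrt z"
  have r: "0 < r" "z = r\<^sup>2" using z by (auto simp: r_def)
  have "ln z = 2 * ln r" using r by (simp add: ln_realpow)
  also have "\<dots> \<le> 2 * (r - 1)" using ln_le_minus_one[OF r(1)] by simp
  finally have ent: "(1 - r)\<^sup>2 \<le> z - 1 - ln z" using r by (simp add: power2_eq_square algebra_simps)
  have "1 - z = 2 * (1 - r) - (1 - r)\<^sup>2" using r by (simp add: power2_eq_square algebra_simps)
  also have "\<dots> \<le> 2 * (1 - r)" by simp
  also have "\<dots> \<le> \<epsilon> + (1 - r)\<^sup>2 / \<epsilon>"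
  proof -
    have "0 \<le> (\<epsilon> - (1 - r))\<^sup>2 / \<epsilon>" using \<epsilon> by simp
    also have "\<dots> = \<epsilon> + (1 - r)\<^sup>2 / \<epsilon> - 2 * (1 - r)"
      using \<epsilon> by (simp add: power2_eq_square field_simps)
    finally show ?thesis by simp
  qed
  also have "\<dots> \<le> \<epsilon> + (z - 1 - ln z) / \<epsilon>"
    using ent \<epsilon> by (simp add: divide_right_mono)
  finally show ?thesis .
qed

text \<open>A Brownian motion and its filtration, seen along an equidistant partition with step \<open>\<tau>\<close>.\<close>

locale gaussian_increments = prob_space M
  for M :: "'a measure" and G :: "nat \<Rightarrow> 'a measure" and \<xi> :: "nat \<Rightarrow> 'a \<Rightarrow> real" and \<tau> :: real and n :: nat +
  assumes tau_pos: "0 < \<tau>"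
    and subalg: "\<And>i. i \<le> n \<Longrightarrow> subalgebra M (G i)"
    and G_mono: "\<And>i j. i \<le> j \<Longrightarrow> j \<le> n \<Longrightarrow> sets (G i) \<subseteq> sets (G j)"
    and xi_meas: "\<And>i. i < n \<Longrightarrow> \<xi> i \<in> borel_measurable (G (Suc i))"
    and xi_distr: "\<And>i. i < n \<Longrightarrow> distributed M lborel (\<xi> i) (normal_density 0 (sqrt \<tau>))"
    and xi_indep: "\<And>i. i < n \<Longrightarrow> indep_set (sets (G i)) {\<xi> i -` A \<inter> space M | A. A \<in> sets borel}"
begin

abbreviation (input) "gauss \<equiv> density lborel (\<lambda>x. ennreal (normal_density 0 (sqrt \<tau>) x))"

lemma gauss_prob: "prob_space gauss"
  using tau_pos by (intro prob_space_normal_density) auto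

lemma measurable_G_mono:
  assumes "f \<in> measurable (G i) N" "i \<le> j" "j \<le> n" shows "f \<in> measurable (G j) N"
proof (rule measurable_from_subalg[OF _ assms(1)])
  have "space (G i) = space (G j)" using subalg[of i] subalg[of j] assms by (simp add: subalgebra_def)
  then show "subalgebra (G j) (G i)" using G_mono[of i j] assms by (simp add: subalgebra_def)
qed

lemma measurable_G_M: "f \<in> measurable (G i) N \<Longrightarrow> i \<le> n \<Longrightarrow> f \<in> measurable M N"
  using subalg by (rule measurable_from_subalg)

lemma xi_M [measurable (raw)]: "i < n \<Longrightarrow> \<xi> i \<in> borel_measurable M"
  using xi_meas by (rule measurable_G_M) auto

lemma xi_law: "i < n \<Longrightarrow> distr M borel (\<xi> i) = gauss"
  using xi_distr[of i] distr_cong[of M M borel lborel "\<xi> i" "\<xi> i"] by (simp add: distributed_def)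

text \<open>Given the past, the next increment may be integrated out against the Gaussian law, because the two are
  independent.\<close>

lemma nn_integral_increment:
  assumes i: "i < n" and R: "R \<in> measurable (G i) N"
    and f: "f \<in> borel_measurable (N \<Otimes>\<^sub>M borel)"
  shows "(\<integral>\<^sup>+\<omega>. f (R \<omega>, \<xi> i \<omega>) \<partial>M) = (\<integral>\<^sup>+\<omega>. (\<integral>\<^sup>+x. f (R \<omega>, x) \<partial>gauss) \<partial>M)"
proof -
  interpret g: prob_space gauss by (rule gauss_prob)
  have RM: "R \<in> measurable M N" using R i by (intro measurable_G_M) auto
  interpret r: prob_space "distr M N R" by (rule prob_space_distr[OF RM])
  interpret pair_sigma_finite "distr M N R" gauss ..
  have eq: "distr M N R \<Otimes>\<^sub>M gauss = distr M (N \<Otimes>\<^sub>M borel) (\<lambda>\<omega>. (R \<omega>, \<xi> i \<omega>))"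
  proof (rule pair_measure_eqI)
    fix X Y assume X: "X \<in> sets (distr M N R)" and Y: "Y \<in> sets gauss"
    let ?X = "R -` X \<inter> space M" and ?Y = "\<xi> i -` Y \<inter> space M"
    have "space (G i) = space M" using subalg[of i] i by (simp add: subalgebra_def)
    then have XG: "?X \<in> sets (G i)" using measurable_sets[OF R, of X] X by simp
    have XM: "?X \<in> sets M" "?Y \<in> sets M"
      using measurable_sets[OF RM, of X] measurable_sets[OF xi_M[OF i], of Y] X Y by auto
    have "prob (?X \<inter> ?Y) = prob ?X * prob ?Y"
      by (rule indep_setD[OF xi_indep[OF i] XG]) (use Y in auto)
    then have "emeasure M (?X \<inter> ?Y) = emeasure M ?X * emeasure M ?Y"
      by (simp add: emeasure_eq_measure ennreal_mult)
    moreover have "emeasure gauss Y = emeasure M ?Y"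
      using Y i by (subst xi_law[OF i, symmetric]) (auto simp: emeasure_distr)
    moreover have "(\<lambda>\<omega>. (R \<omega>, \<xi> i \<omega>)) -` (X \<times> Y) \<inter> space M = ?X \<inter> ?Y" by auto
    ultimately show "emeasure (distr M N R) X * emeasure gauss Y =
        emeasure (distr M (N \<Otimes>\<^sub>M borel) (\<lambda>\<omega>. (R \<omega>, \<xi> i \<omega>))) (X \<times> Y)"
      using X Y i by (simp add: emeasure_distr RM measurable_Pair xi_M)
  qed (auto intro: r.sigma_finite_measure_axioms g.sigma_finite_measure_axioms cong: sets_pair_measure_cong)
  have f': "f \<in> borel_measurable (distr M N R \<Otimes>\<^sub>M gauss)"
    using f by (simp cong: measurable_cong_sets)
  have "(\<integral>\<^sup>+\<omega>. f (R \<omega>, \<xi> i \<omega>) \<partial>M) = integral\<^sup>N (distr M (N \<Otimes>\<^sub>M borel) (\<lambda>\<omega>. (R \<omega>, \<xi> i \<omega>))) f"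
    using i by (subst nn_integral_distr) (auto intro!: measurable_Pair RM f)
  also have "\<dots> = integral\<^sup>N (distr M N R \<Otimes>\<^sub>M gauss) f" unfolding eq ..
  also have "\<dots> = (\<integral>\<^sup>+r. (\<integral>\<^sup>+x. f (r, x) \<partial>gauss) \<partial>distr M N R)"
    using g.nn_integral_fst[OF f'] by simp
  also have "\<dots> = (\<integral>\<^sup>+\<omega>. (\<integral>\<^sup>+x. f (R \<omega>, x) \<partial>gauss) \<partial>M)"
    by (rule nn_integral_distr[OF RM g.borel_measurable_nn_integral_fst]) (use f in \<open>simp cong: measurable_cong_sets\<close>)
  finally show ?thesis .
qed

text \<open>Completing the square.\<close>

lemma normal_density_shift:
  "normal_density 0 (sqrt \<tau>) x * exp (- (a * x / \<tau>) - a\<^sup>2 / (2 * \<tau>)) = normal_density 0 (sqrt \<tau>) (x + a)"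
proof -
  have "- (x\<^sup>2 / (2 * \<tau>)) + (- (a * x / \<tau>) - a\<^sup>2 / (2 * \<tau>)) = - ((x + a)\<^sup>2 / (2 * \<tau>))"
    using tau_pos by (simp add: field_simps power2_eq_square)
  then show ?thesis
    using tau_pos by (simp add: normal_density_def exp_add[symmetric])
qed

lemma gauss_cameron_martin:
  assumes B: "B \<in> sets borel"
  shows "(\<integral>\<^sup>+x. ennreal (exp (- (a * x / \<tau>) - a\<^sup>2 / (2 * \<tau>))) * indicator B (x + a) \<partial>gauss) = emeasure gauss B"
proof -
  have [measurable]: "(\<lambda>x. indicator B (x + a) :: ennreal) \<in> borel_measurable borel" for a :: real
    using B by measurable
  have "(\<integral>\<^sup>+x. ennreal (exp (- (a * x / \<tau>) - a\<^sup>2 / (2 * \<tau>))) * indicator B (x + a) \<partial>gauss)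
    = (\<integral>\<^sup>+x. ennreal (normal_density 0 (sqrt \<tau>) (x + a)) * indicator B (x + a) \<partial>lborel)"
    by (subst nn_integral_density)
       (auto simp: normal_density_shift[symmetric] ennreal_mult mult.assoc intro!: nn_integral_cong)
  also have "\<dots> = (\<integral>\<^sup>+x. ennreal (normal_density 0 (sqrt \<tau>) x) * indicator B x \<partial>lborel)"
    using B by (subst nn_integral_real_affine[where c = 1 and t = a, of "\<lambda>x. ennreal (normal_density 0 (sqrt \<tau>) x) * indicator B x"])
       (auto simp: add.commute)
  also have "\<dots> = emeasure gauss B"
    using B by (simp add: emeasure_density)
  finally show ?thesis .
qed

context
  fixes A :: "nat \<Rightarrow> 'a \<Rightarrow> real"
  assumes A_meas: "\<And>i. i < n \<Longrightarrow> A i \<in> borel_measurable (G i)"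
begin

text \<open>The discrete stochastic exponential: the density that turns the increments \<open>\<xi> i + A i\<close>, shifted by a
  predictable amount, into independent centred Gaussians.\<close>

definition girsanov_weight :: "nat \<Rightarrow> 'a \<Rightarrow> real" where
  "girsanov_weight k \<omega> = (\<Prod>i<k. exp (- (A i \<omega> * \<xi> i \<omega> / \<tau>) - (A i \<omega>)\<^sup>2 / (2 * \<tau>)))"

lemma girsanov_weight_pos: "0 < girsanov_weight k \<omega>"
  by (simp add: girsanov_weight_def prod_pos)

lemma ln_girsanov_weight:
  "ln (girsanov_weight k \<omega>) = (\<Sum>i<k. - (A i \<omega> * \<xi> i \<omega> / \<tau>) - (A i \<omega>)\<^sup>2 / (2 * \<tau>))"
  by (simp add: girsanov_weight_def exp_sum[symmetric])

lemma measurable_G_history: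
  assumes "i < k" "k \<le> n"
  shows "A i \<in> borel_measurable (G k)" "\<xi> i \<in> borel_measurable (G k)"
  using assms measurable_G_mono[OF A_meas, of i k] measurable_G_mono[OF xi_meas, of i k] by auto

lemma girsanov_weight_measurable: "k \<le> n \<Longrightarrow> girsanov_weight k \<in> borel_measurable (G k)"
  unfolding girsanov_weight_def
proof (rule borel_measurable_prod)
  fix i assume "k \<le> n" "i \<in> {..<k}"
  then have [measurable]: "A i \<in> borel_measurable (G k)" "\<xi> i \<in> borel_measurable (G k)"
    by (auto intro: measurable_G_history)
  show "(\<lambda>\<omega>. exp (- (A i \<omega> * \<xi> i \<omega> / \<tau>) - (A i \<omega>)\<^sup>2 / (2 * \<tau>))) \<in> borel_measurable (G k)"
    by measurable
qed

text \<open>Integrating out the last increment, for which \<open>A k\<close> and the earlier factors are constants, removes one factor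
  by the one-dimensional Cameron-Martin formula.\<close>

lemma girsanov_finite_dimensional:
  assumes "k \<le> n" and B: "\<And>i. i < k \<Longrightarrow> B i \<in> sets borel"
  shows "(\<integral>\<^sup>+\<omega>. ennreal (girsanov_weight k \<omega>) * (\<Prod>i<k. indicator (B i) (\<xi> i \<omega> + A i \<omega>)) \<partial>M)
    = (\<Prod>i<k. emeasure gauss (B i))"
  using assms
proof (induction k)
  case 0
  then show ?case by (simp add: girsanov_weight_def emeasure_space_1)
next
  case (Suc k)
  then have k: "k < n" "k \<le> n" by auto
  define H :: "'a \<Rightarrow> ennreal" where
    "H \<omega> = ennreal (girsanov_weight k \<omega>) * (\<Prod>i<k. indicator (B i) (\<xi> i \<omega> + A i \<omega>))" for \<omega>
  have H: "H \<in> borel_measurable (G k)"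
  proof -
    have "(\<lambda>\<omega>. indicator (B i) (\<xi> i \<omega> + A i \<omega>) :: ennreal) \<in> borel_measurable (G k)" if "i \<in> {..<k}" for i
    proof -
      have [measurable]: "A i \<in> borel_measurable (G k)" "\<xi> i \<in> borel_measurable (G k)" "B i \<in> sets borel"
        using that k Suc.prems by (auto intro: measurable_G_history)
      show ?thesis by measurable
    qed
    then have "(\<lambda>\<omega>. \<Prod>i<k. indicator (B i) (\<xi> i \<omega> + A i \<omega>) :: ennreal) \<in> borel_measurable (G k)"
      by (rule borel_measurable_prod_ennreal)
    moreover note girsanov_weight_measurable[OF k(2), measurable]
    ultimately show ?thesis unfolding H_def by measurable
  qed
  \<comment> \<open>the integrand as a function of the past \<open>(H, A k)\<close> and of the new increment \<open>\<xi> k\<close>\<close>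
  let ?f = "\<lambda>((g, a), x). g * (ennreal (exp (- (a * x / \<tau>) - a\<^sup>2 / (2 * \<tau>))) * indicator (B k) (x + a)) :: ennreal"
  have [measurable]: "B k \<in> sets borel" using Suc.prems by simp
  have "(\<integral>\<^sup>+\<omega>. ennreal (girsanov_weight (Suc k) \<omega>) * (\<Prod>i<Suc k. indicator (B i) (\<xi> i \<omega> + A i \<omega>)) \<partial>M)
    = (\<integral>\<^sup>+\<omega>. ?f ((H \<omega>, A k \<omega>), \<xi> k \<omega>) \<partial>M)"
    by (intro nn_integral_cong)
       (simp add: H_def girsanov_weight_def ennreal_mult prod_nonneg ac_simps)
  also have "\<dots> = (\<integral>\<^sup>+\<omega>. (\<integral>\<^sup>+x. ?f ((H \<omega>, A k \<omega>), x) \<partial>gauss) \<partial>M)"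
    by (rule nn_integral_increment[OF k(1), of "\<lambda>\<omega>. (H \<omega>, A k \<omega>)" "borel \<Otimes>\<^sub>M borel" ?f])
       (use H A_meas[OF k(1)] in \<open>simp_all add: measurable_Pair split_beta'\<close>)
  also have "\<dots> = (\<integral>\<^sup>+\<omega>. H \<omega> * emeasure gauss (B k) \<partial>M)"
    by (intro nn_integral_cong, simp, subst nn_integral_cmult) (simp_all add: gauss_cameron_martin)
  also have "\<dots> = (\<integral>\<^sup>+\<omega>. H \<omega> \<partial>M) * emeasure gauss (B k)"
    by (rule nn_integral_multc) (rule measurable_G_M[OF H k(2)])
  also have "(\<integral>\<^sup>+\<omega>. H \<omega> \<partial>M) = (\<Prod>i<k. emeasure gauss (B i))"
    unfolding H_def using Suc.prems by (intro Suc.IH) auto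
  finally show ?case by (simp add: mult.commute)
qed

lemma shifted_increments_law:
  "distr (density M (\<lambda>\<omega>. ennreal (girsanov_weight n \<omega>))) (PiM {..<n} (\<lambda>_. borel))
     (\<lambda>\<omega>. \<lambda>i\<in>{..<n}. \<xi> i \<omega> + A i \<omega>) = PiM {..<n} (\<lambda>_. gauss)"
proof -
  interpret g: prob_space gauss by (rule gauss_prob)
  interpret product_sigma_finite "\<lambda>_::nat. gauss" ..
  note girsanov_weight_measurable[OF order_refl, THEN measurable_G_M, OF order_refl, measurable]
  have [measurable]: "A i \<in> borel_measurable M" if "i < n" for i
    using measurable_G_M[OF A_meas[OF that]] that by simp
  have V[measurable]: "(\<lambda>\<omega>. \<lambda>i\<in>{..<n}. \<xi> i \<omega> + A i \<omega>) \<in> measurable M (PiM {..<n} (\<lambda>_. borel))"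
    by (rule measurable_restrict) (auto intro!: borel_measurable_add xi_M)
  show ?thesis
  proof (rule PiM_eqI)
    fix B assume B: "\<And>i. i \<in> {..<n} \<Longrightarrow> B i \<in> sets gauss"
    let ?W = "density M (\<lambda>\<omega>. ennreal (girsanov_weight n \<omega>))"
    let ?V = "\<lambda>\<omega>. \<lambda>i\<in>{..<n}. \<xi> i \<omega> + A i \<omega>"
    have B': "Pi\<^sub>E {..<n} B \<in> sets (PiM {..<n} (\<lambda>_. borel))"
      using B by (intro sets_PiM_I_finite) auto
    have "emeasure (distr ?W (PiM {..<n} (\<lambda>_. borel)) ?V) (Pi\<^sub>E {..<n} B) =
        (\<integral>\<^sup>+\<omega>. ennreal (girsanov_weight n \<omega>) * indicator (?V -` Pi\<^sub>E {..<n} B \<inter> space M) \<omega> \<partial>M)"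
      using B' measurable_sets[OF V B'] by (simp add: emeasure_distr emeasure_density)
    also have "\<dots> = (\<integral>\<^sup>+\<omega>. ennreal (girsanov_weight n \<omega>) * (\<Prod>i<n. indicator (B i) (\<xi> i \<omega> + A i \<omega>)) \<partial>M)"
    proof (intro nn_integral_cong arg_cong2[where f="(*)"] refl)
      fix \<omega> assume "\<omega> \<in> space M"
      show "indicator (?V -` Pi\<^sub>E {..<n} B \<inter> space M) \<omega> = (\<Prod>i<n. indicator (B i) (\<xi> i \<omega> + A i \<omega>) :: ennreal)"
      proof (cases "\<forall>i<n. \<xi> i \<omega> + A i \<omega> \<in> B i")
        case True
        then show ?thesis using \<open>\<omega> \<in> space M\<close> by (auto simp: indicator_def PiE_iff)
      next
        case False
        then obtain i where "i < n" "\<xi> i \<omega> + A i \<omega> \<notin> B i" by auto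
        then have "(\<Prod>i<n. indicator (B i) (\<xi> i \<omega> + A i \<omega>) :: ennreal) = 0"
          by (intro prod_zero bexI[of _ i]) auto
        moreover have "?V \<omega> \<notin> Pi\<^sub>E {..<n} B" using \<open>i < n\<close> \<open>\<xi> i \<omega> + A i \<omega> \<notin> B i\<close>
          by (auto simp: PiE_iff)
        ultimately show ?thesis by simp
      qed
    qed
    also have "\<dots> = (\<Prod>i<n. emeasure gauss (B i))"
      using B by (intro girsanov_finite_dimensional) auto
    finally show "emeasure (distr ?W (PiM {..<n} (\<lambda>_. borel)) ?V) (Pi\<^sub>E {..<n} B)
        = (\<Prod>i\<in>{..<n}. emeasure gauss (B i))" .
  qed (auto intro!: sets_PiM_cong)
qed

lemma girsanov_nn_integral:
  assumes \<Phi>: "\<Phi> \<in> borel_measurable (PiM {..<n} (\<lambda>_. borel))"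
  shows "(\<integral>\<^sup>+\<omega>. ennreal (girsanov_weight n \<omega>) * \<Phi> (\<lambda>i\<in>{..<n}. \<xi> i \<omega> + A i \<omega>) \<partial>M)
    = integral\<^sup>N (PiM {..<n} (\<lambda>_. gauss)) \<Phi>"
proof -
  note girsanov_weight_measurable[OF order_refl, THEN measurable_G_M, OF order_refl, measurable]
  have [measurable]: "A i \<in> borel_measurable M" if "i < n" for i
    using measurable_G_M[OF A_meas[OF that]] that by simp
  have V[measurable]: "(\<lambda>\<omega>. \<lambda>i\<in>{..<n}. \<xi> i \<omega> + A i \<omega>) \<in> measurable M (PiM {..<n} (\<lambda>_. borel))"
    by (rule measurable_restrict) (auto intro!: borel_measurable_add xi_M)
  show ?thesis
    unfolding shifted_increments_law[symmetric]
    using \<Phi> by (subst nn_integral_distr) (auto simp: nn_integral_density)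
qed

end

text \<open>The case of zero shift, where the weight is identically one.\<close>

lemma unshifted_nn_integral:
  assumes \<Phi>: "\<Phi> \<in> borel_measurable (PiM {..<n} (\<lambda>_. borel))"
  shows "(\<integral>\<^sup>+\<omega>. \<Phi> (\<lambda>i\<in>{..<n}. \<xi> i \<omega>) \<partial>M) = integral\<^sup>N (PiM {..<n} (\<lambda>_. gauss)) \<Phi>"
  using girsanov_nn_integral[of "\<lambda>_ _. 0" \<Phi>] \<Phi> by (simp add: girsanov_weight_def)

text \<open>The martingale property of the discrete stochastic integrals with square integrable integrands.\<close>

lemma increment_moments:
  assumes i: "i < n" and Y: "Y \<in> borel_measurable (G i)" "integrable M Y"
  shows "integrable M (\<lambda>\<omega>. Y \<omega> * \<xi> i \<omega>)" "expectation (\<lambda>\<omega>. Y \<omega> * \<xi> i \<omega>) = 0"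
    "integrable M (\<lambda>\<omega>. (\<xi> i \<omega>)\<^sup>2)" "expectation (\<lambda>\<omega>. (\<xi> i \<omega>)\<^sup>2) = \<tau>"
proof -
  have s: "0 < sqrt \<tau>" using tau_pos by simp
  have iv: "indep_var borel Y borel (\<xi> i)"
    using i by (intro indep_set_imp_indep_var[OF subalg xi_indep Y(1)] xi_M) auto
  have m: "expectation (\<xi> i) = 0"
    using normal_distributed_expectation[OF s xi_distr[OF i]] .
  have v: "variance (\<xi> i) = \<tau>"
    using normal_distributed_variance[OF s xi_distr[OF i]] tau_pos by simp
  have int: "integrable M (\<xi> i)"
    using integrable_normal_moment_nz_1[OF s, of 0]
    by (subst distributed_integrable[OF xi_distr[OF i], of "\<lambda>x. x", symmetric]) auto
  show "integrable M (\<lambda>\<omega>. Y \<omega> * \<xi> i \<omega>)" by (rule indep_var_integrable[OF iv Y(2) int])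
  show "expectation (\<lambda>\<omega>. Y \<omega> * \<xi> i \<omega>) = 0"
    using indep_var_lebesgue_integral[OF iv Y(2) int] m by simp
  show "integrable M (\<lambda>\<omega>. (\<xi> i \<omega>)\<^sup>2)"
    using integrable_normal_moment[OF s, of 0 2]
    by (subst distributed_integrable[OF xi_distr[OF i], of "\<lambda>x. x\<^sup>2", symmetric]) auto
  show "expectation (\<lambda>\<omega>. (\<xi> i \<omega>)\<^sup>2) = \<tau>" using v m by simp
qed

text \<open>The weight \<open>Z\<close> is a probability density under which the shifted increments have the law of the unshifted ones,
  so the difference of the two expectations is \<open>E ((1 - Z) \<Phi>)\<close>. Pinsker's inequality bounds it by the relative
  entropy \<open>E (- ln Z)\<close>; there the martingale part has mean zero and the quadratic part remains.\<close>

lemma shifted_expectation_le: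
  assumes A_meas: "\<And>i. i < n \<Longrightarrow> A i \<in> borel_measurable (G i)"
    and A_int: "\<And>i. i < n \<Longrightarrow> integrable M (\<lambda>\<omega>. (A i \<omega>)\<^sup>2)"
    and \<Phi>: "\<Phi> \<in> borel_measurable (PiM {..<n} (\<lambda>_. borel))"
    and \<Phi>01: "\<And>y. \<Phi> y \<in> {0..1::real}" and \<epsilon>: "0 < \<epsilon>"
  shows "expectation (\<lambda>\<omega>. \<Phi> (\<lambda>i\<in>{..<n}. \<xi> i \<omega> + A i \<omega>)) \<le>
    expectation (\<lambda>\<omega>. \<Phi> (\<lambda>i\<in>{..<n}. \<xi> i \<omega>)) + \<epsilon> + (\<Sum>i<n. expectation (\<lambda>\<omega>. (A i \<omega>)\<^sup>2)) / (2 * \<tau> * \<epsilon>)"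
proof -
  let ?V = "\<lambda>\<omega>. \<lambda>i\<in>{..<n}. \<xi> i \<omega> + A i \<omega>" and ?U = "\<lambda>\<omega>. \<lambda>i\<in>{..<n}. \<xi> i \<omega>"
  define Z where "Z = girsanov_weight A n"
  have Z_meas [measurable]: "Z \<in> borel_measurable M"
    unfolding Z_def using girsanov_weight_measurable[OF A_meas, of n] by (intro measurable_G_M[of _ n]) auto
  have Z_pos: "0 < Z \<omega>" for \<omega> unfolding Z_def by (rule girsanov_weight_pos[OF A_meas])
  have A_M [measurable]: "A i \<in> borel_measurable M" if "i < n" for i
    using measurable_G_M[OF A_meas[OF that]] that by simp
  have V [measurable]: "?V \<in> measurable M (PiM {..<n} (\<lambda>_. borel))"
    by (rule measurable_restrict) (auto intro!: borel_measurable_add xi_M)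
  have U [measurable]: "?U \<in> measurable M (PiM {..<n} (\<lambda>_. borel))"
    by (rule measurable_restrict) (auto intro!: xi_M)
  note \<Phi> [measurable]
  have \<Phi>_bd: "0 \<le> \<Phi> y" "\<Phi> y \<le> 1" for y using \<Phi>01[of y] by auto
  have nn: "(\<integral>\<^sup>+\<omega>. ennreal (Z \<omega>) * ennreal (\<Psi> (?V \<omega>)) \<partial>M) = (\<integral>\<^sup>+\<omega>. ennreal (\<Psi> (?U \<omega>)) \<partial>M)"
    if [measurable]: "\<Psi> \<in> borel_measurable (PiM {..<n} (\<lambda>_. borel))" for \<Psi> :: "(nat \<Rightarrow> real) \<Rightarrow> real"
    using girsanov_nn_integral[OF A_meas, of "\<lambda>y. ennreal (\<Psi> y)"]
      unshifted_nn_integral[of "\<lambda>y. ennreal (\<Psi> y)"] by (simp add: Z_def)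
  have nnZ: "(\<integral>\<^sup>+\<omega>. ennreal (Z \<omega>) \<partial>M) = 1"
    using nn[of "\<lambda>_. 1"] by (simp add: emeasure_space_1)
  have Z_int: "integrable M Z"
    using nnZ Z_pos by (intro integrableI_nonneg) (auto intro: less_imp_le)
  have EZ: "expectation Z = 1"
    using nnZ Z_pos by (subst integral_eq_nn_integral) (auto intro: less_imp_le)
  have U_int: "integrable M (\<lambda>\<omega>. \<Phi> (?U \<omega>))" and V_int: "integrable M (\<lambda>\<omega>. \<Phi> (?V \<omega>))"
    by (rule integrable_const_bound[of _ 1]; use \<Phi>_bd in \<open>auto\<close>)+
  have ZV_int: "integrable M (\<lambda>\<omega>. Z \<omega> * \<Phi> (?V \<omega>))"
    by (rule Bochner_Integration.integrable_bound[OF Z_int])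
       (use \<Phi>_bd Z_pos in \<open>auto simp: abs_mult intro!: mult_left_le\<close>)
  have "expectation (\<lambda>\<omega>. Z \<omega> * \<Phi> (?V \<omega>)) = enn2real (\<integral>\<^sup>+\<omega>. ennreal (Z \<omega> * \<Phi> (?V \<omega>)) \<partial>M)"
    using \<Phi>_bd Z_pos by (intro integral_eq_nn_integral) (simp_all add: less_imp_le)
  also have "(\<integral>\<^sup>+\<omega>. ennreal (Z \<omega> * \<Phi> (?V \<omega>)) \<partial>M) = (\<integral>\<^sup>+\<omega>. ennreal (\<Phi> (?U \<omega>)) \<partial>M)"
    using nn[OF \<Phi>] \<Phi>_bd Z_pos by (simp add: ennreal_mult less_imp_le)
  also have "enn2real \<dots> = expectation (\<lambda>\<omega>. \<Phi> (?U \<omega>))"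
    using \<Phi>_bd by (intro integral_eq_nn_integral[symmetric]) auto
  finally have EZV: "expectation (\<lambda>\<omega>. Z \<omega> * \<Phi> (?V \<omega>)) = expectation (\<lambda>\<omega>. \<Phi> (?U \<omega>))" .
  have A_int1: "integrable M (A i)" if "i < n" for i
    using A_int[OF that] A_M[OF that] by (rule square_integrable_imp_integrable[rotated])
  have mom: "integrable M (\<lambda>\<omega>. A i \<omega> * \<xi> i \<omega>)" "expectation (\<lambda>\<omega>. A i \<omega> * \<xi> i \<omega>) = 0" if "i < n" for i
    using increment_moments(1,2)[OF that A_meas[OF that] A_int1[OF that]] by auto
  define \<Lambda> where "\<Lambda> \<omega> = (\<Sum>i<n. A i \<omega> * \<xi> i \<omega> / \<tau> + (A i \<omega>)\<^sup>2 / (2 * \<tau>))" for \<omega>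
  have ln_Z: "ln (Z \<omega>) = - \<Lambda> \<omega>" for \<omega>
    unfolding Z_def \<Lambda>_def by (simp add: ln_girsanov_weight[OF A_meas] sum_negf[symmetric])
  have \<Lambda>_int: "integrable M \<Lambda>"
    unfolding \<Lambda>_def using mom A_int by (intro Bochner_Integration.integrable_sum) auto
  have E\<Lambda>: "expectation \<Lambda> = (\<Sum>i<n. expectation (\<lambda>\<omega>. (A i \<omega>)\<^sup>2)) / (2 * \<tau>)"
    unfolding \<Lambda>_def using mom A_int by (subst Bochner_Integration.integral_sum) (auto simp: sum_divide_distrib)
  have "expectation (\<lambda>\<omega>. \<Phi> (?V \<omega>) - Z \<omega> * \<Phi> (?V \<omega>)) \<le> expectation (\<lambda>\<omega>. \<epsilon> + (Z \<omega> - 1 + \<Lambda> \<omega>) / \<epsilon>)"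
  proof (rule integral_mono)
    fix \<omega>
    have le: "1 - Z \<omega> \<le> \<epsilon> + (Z \<omega> - 1 + \<Lambda> \<omega>) / \<epsilon>"
      using one_minus_le_relative_entropy[OF Z_pos \<epsilon>, of \<omega>] ln_Z by simp
    have "0 \<le> Z \<omega> - 1 + \<Lambda> \<omega>" using ln_le_minus_one[OF Z_pos, of \<omega>] ln_Z by simp
    then have nonneg: "0 \<le> \<epsilon> + (Z \<omega> - 1 + \<Lambda> \<omega>) / \<epsilon>" using \<epsilon> by simp
    have "\<Phi> (?V \<omega>) - Z \<omega> * \<Phi> (?V \<omega>) = (1 - Z \<omega>) * \<Phi> (?V \<omega>)" by (simp add: algebra_simps)
    also have "\<dots> \<le> (\<epsilon> + (Z \<omega> - 1 + \<Lambda> \<omega>) / \<epsilon>) * \<Phi> (?V \<omega>)" by (rule mult_right_mono[OF le \<Phi>_bd(1)])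
    also have "\<dots> \<le> \<epsilon> + (Z \<omega> - 1 + \<Lambda> \<omega>) / \<epsilon>" using nonneg \<Phi>_bd by (intro mult_left_le)
    finally show "\<Phi> (?V \<omega>) - Z \<omega> * \<Phi> (?V \<omega>) \<le> \<epsilon> + (Z \<omega> - 1 + \<Lambda> \<omega>) / \<epsilon>" .
  qed (use V_int ZV_int Z_int \<Lambda>_int in auto)
  then show ?thesis
    using V_int ZV_int Z_int \<Lambda>_int EZ EZV E\<Lambda> by (simp add: prob_space)
qed

end

section \<open>A maximal inequality for Brownian motion\<close>

primrec running_max :: "(nat \<Rightarrow> real) \<Rightarrow> nat \<Rightarrow> real" where
  "running_max S 0 = S 0"
| "running_max S (Suc k) = max (running_max S k) (S (Suc k))"

lemma le_running_max: "k \<le> n \<Longrightarrow> S k \<le> running_max S n"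
  by (induction n) (auto simp: le_Suc_eq le_max_iff_disj)

text \<open>A deterministic inequality behind Doob's maximal inequality in \<open>L\<^sup>2\<close>. Summation by parts moves the differences
  onto the running maximum, which increases only when it equals the walk; the sum on the right is a martingale
  transform and vanishes in the mean.\<close>

lemma pathwise_doob_inequality:
  assumes "S 0 = 0"
  shows "(running_max S n)\<^sup>2 \<le> 4 * (S n)\<^sup>2 - 4 * (\<Sum>k<n. running_max S k * (S (Suc k) - S k))"
proof -
  let ?m = "running_max S"
  have "(?m n)\<^sup>2 / 2 \<le> ?m n * S n - (\<Sum>k<n. ?m k * (S (Suc k) - S k))"
  proof (induction n)
    case 0
    then show ?case using assms by simp
  next
    case (Suc n)
    have "((?m (Suc n))\<^sup>2 - (?m n)\<^sup>2) / 2 \<le> (?m (Suc n) - ?m n) * S (Suc n)"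
    proof (cases "S (Suc n) \<le> ?m n")
      case False
      then have "?m (Suc n) = S (Suc n)" by simp
      moreover have "0 \<le> (S (Suc n) - ?m n)\<^sup>2" by simp
      ultimately show ?thesis by (simp add: power2_eq_square field_simps)
    qed simp
    with Suc show ?case by (simp add: algebra_simps diff_divide_distrib)
  qed
  moreover have "?m n * S n \<le> (?m n)\<^sup>2 / 4 + (S n)\<^sup>2"
    using zero_le_power2[of "?m n / 2 - S n"] by (simp add: power2_eq_square algebra_simps)
  ultimately show ?thesis by simp
qed

context gaussian_increments
begin

text \<open>The factor \<open>c\<close> will be \<open>1\<close> or \<open>-1\<close>, so that bounds on running maxima give bounds on absolute values.\<close>

definition scaled_walk :: "real \<Rightarrow> nat \<Rightarrow> 'a \<Rightarrow> real" where
  "scaled_walk c k \<omega> = c * (\<Sum>i<k. \<xi> i \<omega>)"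

lemma scaled_walk_measurable: "k \<le> n \<Longrightarrow> scaled_walk c k \<in> borel_measurable (G k)"
  unfolding scaled_walk_def
  using measurable_G_mono[OF xi_meas, of _ k]
  by (intro borel_measurable_times borel_measurable_const borel_measurable_sum) auto

lemma running_max_measurable:
  "k \<le> n \<Longrightarrow> (\<lambda>\<omega>. running_max (\<lambda>j. scaled_walk c j \<omega>) k) \<in> borel_measurable (G k)"
proof (induction k)
  case 0
  then show ?case using scaled_walk_measurable[of 0] by simp
next
  case (Suc k)
  have "(\<lambda>\<omega>. running_max (\<lambda>j. scaled_walk c j \<omega>) k) \<in> borel_measurable (G (Suc k))"
    by (rule measurable_G_mono[OF Suc.IH]) (use Suc.prems in auto)
  then show ?case
    using scaled_walk_measurable[OF Suc.prems] by (simp add: borel_measurable_max)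
qed

lemma scaled_walk_moments:
  assumes "k \<le> n"
  shows "integrable M (\<lambda>\<omega>. (scaled_walk c k \<omega>)\<^sup>2) \<and> expectation (\<lambda>\<omega>. (scaled_walk c k \<omega>)\<^sup>2) = c\<^sup>2 * real k * \<tau>"
  using assms
proof (induction k)
  case 0
  then show ?case by (simp add: scaled_walk_def)
next
  case (Suc k)
  let ?S = "scaled_walk c k"
  have k: "k < n" using Suc.prems by simp
  have S: "?S \<in> borel_measurable (G k)" using k by (intro scaled_walk_measurable) simp
  have "?S \<in> borel_measurable M" using k by (intro measurable_G_M[OF S]) simp
  then have "integrable M ?S"
    by (rule square_integrable_imp_integrable) (use Suc.IH k in simp)
  note mom = increment_moments[OF k S this]
  have "(scaled_walk c (Suc k) \<omega>)\<^sup>2 = (?S \<omega>)\<^sup>2 + 2 * c * (?S \<omega> * \<xi> k \<omega>) + c\<^sup>2 * (\<xi> k \<omega>)\<^sup>2" for \<omega>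
    by (simp add: scaled_walk_def power2_eq_square algebra_simps)
  then show ?case using Suc.IH k mom by (simp add: algebra_simps)
qed

lemma scaled_walk_increment: "scaled_walk c (Suc k) \<omega> - scaled_walk c k \<omega> = c * \<xi> k \<omega>"
  by (simp add: scaled_walk_def algebra_simps)

lemma doob_maximal_inequality:
  defines "m \<equiv> \<lambda>c k \<omega>. running_max (\<lambda>j. scaled_walk c j \<omega>) k"
  shows "integrable M (\<lambda>\<omega>. (m c n \<omega>)\<^sup>2)" "expectation (\<lambda>\<omega>. (m c n \<omega>)\<^sup>2) \<le> 4 * c\<^sup>2 * real n * \<tau>"
proof -
  have m_meas: "m c k \<in> borel_measurable (G k)" "m c k \<in> borel_measurable M" if "k \<le> n" for k
    using running_max_measurable[OF that, of c] measurable_G_M[OF running_max_measurable[OF that, of c] that]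
    unfolding m_def by simp_all
  have S0: "scaled_walk c 0 \<omega> = 0" for \<omega> by (simp add: scaled_walk_def)
  have sq: "integrable M (\<lambda>\<omega>. (m c k \<omega>)\<^sup>2)" if "k \<le> n" for k
    using that
  proof (induction k)
    case 0
    then show ?case by (simp add: m_def S0)
  next
    case (Suc k)
    have "integrable M (\<lambda>\<omega>. (m c k \<omega>)\<^sup>2 + (scaled_walk c (Suc k) \<omega>)\<^sup>2)"
      using Suc scaled_walk_moments[OF Suc.prems] by auto
    moreover have "(\<lambda>\<omega>. (m c (Suc k) \<omega>)\<^sup>2) \<in> borel_measurable M" using m_meas[OF Suc.prems] by simp
    ultimately show ?case
      by (rule Bochner_Integration.integrable_bound) (auto simp: m_def max_def)
  qed
  have prod: "integrable M (\<lambda>\<omega>. m c k \<omega> * \<xi> k \<omega>)" "expectation (\<lambda>\<omega>. m c k \<omega> * \<xi> k \<omega>) = 0" if "k < n" for k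
    using increment_moments[OF that m_meas(1) square_integrable_imp_integrable[OF m_meas(2) sq]] that by auto
  show "integrable M (\<lambda>\<omega>. (m c n \<omega>)\<^sup>2)" by (rule sq) simp
  have walk: "integrable M (\<lambda>\<omega>. (scaled_walk c n \<omega>)\<^sup>2)" "expectation (\<lambda>\<omega>. (scaled_walk c n \<omega>)\<^sup>2) = c\<^sup>2 * real n * \<tau>"
    using scaled_walk_moments[of n c] by auto
  define P where "P \<omega> = (\<Sum>k<n. c * (m c k \<omega> * \<xi> k \<omega>))" for \<omega>
  have P: "integrable M P" "expectation P = 0"
    unfolding P_def using prod
    by (auto simp: Bochner_Integration.integral_sum intro!: Bochner_Integration.integrable_sum)
  have "expectation (\<lambda>\<omega>. (m c n \<omega>)\<^sup>2) \<le> expectation (\<lambda>\<omega>. 4 * (scaled_walk c n \<omega>)\<^sup>2 - 4 * P \<omega>)"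
  proof (rule integral_mono)
    fix \<omega>
    have "P \<omega> = (\<Sum>k<n. m c k \<omega> * (scaled_walk c (Suc k) \<omega> - scaled_walk c k \<omega>))"
      unfolding P_def scaled_walk_increment by (intro sum.cong refl) (rule mult.left_commute)
    then show "(m c n \<omega>)\<^sup>2 \<le> 4 * (scaled_walk c n \<omega>)\<^sup>2 - 4 * P \<omega>"
      using pathwise_doob_inequality[of "\<lambda>j. scaled_walk c j \<omega>" n, OF S0] by (simp only: m_def)
  next
    show "integrable M (\<lambda>\<omega>. (m c n \<omega>)\<^sup>2)" by (rule sq) simp
    show "integrable M (\<lambda>\<omega>. 4 * (scaled_walk c n \<omega>)\<^sup>2 - 4 * P \<omega>)" using walk(1) P(1) by simp
  qed
  also have "\<dots> = 4 * c\<^sup>2 * real n * \<tau>"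
    using walk P by simp
  finally show "expectation (\<lambda>\<omega>. (m c n \<omega>)\<^sup>2) \<le> 4 * c\<^sup>2 * real n * \<tau>" .
qed

text \<open>The walk and its negative each have a running maximum with second moment at most \<open>4 n \<tau>\<close>.\<close>

lemma nn_integral_max_walk_squared:
  "(\<integral>\<^sup>+\<omega>. (SUP k\<in>{..n}. ennreal ((\<Sum>i<k. \<xi> i \<omega>)\<^sup>2)) \<partial>M) \<le> ennreal (8 * real n * \<tau>)"
proof -
  let ?m = "\<lambda>c \<omega>. running_max (\<lambda>j. scaled_walk c j \<omega>) n"
  have le: "(\<Sum>i<k. \<xi> i \<omega>)\<^sup>2 \<le> (?m 1 \<omega>)\<^sup>2 + (?m (-1) \<omega>)\<^sup>2" if "k \<le> n" for k \<omega>
  proof -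
    have "\<bar>\<Sum>i<k. \<xi> i \<omega>\<bar> \<le> \<bar>?m 1 \<omega>\<bar> \<or> \<bar>\<Sum>i<k. \<xi> i \<omega>\<bar> \<le> \<bar>?m (-1) \<omega>\<bar>"
      using le_running_max[OF that, of "\<lambda>j. scaled_walk 1 j \<omega>"] le_running_max[OF that, of "\<lambda>j. scaled_walk (-1) j \<omega>"]
      by (auto simp: scaled_walk_def)
    then have "(\<Sum>i<k. \<xi> i \<omega>)\<^sup>2 \<le> (?m 1 \<omega>)\<^sup>2 \<or> (\<Sum>i<k. \<xi> i \<omega>)\<^sup>2 \<le> (?m (-1) \<omega>)\<^sup>2"
      by (simp add: abs_le_square_iff)
    then show ?thesis by (auto intro: order_trans)
  qed
  have "(\<integral>\<^sup>+\<omega>. (SUP k\<in>{..n}. ennreal ((\<Sum>i<k. \<xi> i \<omega>)\<^sup>2)) \<partial>M) \<le> (\<integral>\<^sup>+\<omega>. ennreal ((?m 1 \<omega>)\<^sup>2 + (?m (-1) \<omega>)\<^sup>2) \<partial>M)"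
    by (intro nn_integral_mono SUP_least ennreal_leI) (use le in auto)
  also have "\<dots> = ennreal (expectation (\<lambda>\<omega>. (?m 1 \<omega>)\<^sup>2 + (?m (-1) \<omega>)\<^sup>2))"
    by (intro nn_integral_eq_integral) (use doob_maximal_inequality(1) in auto)
  also have "\<dots> \<le> ennreal (8 * real n * \<tau>)"
    using doob_maximal_inequality[of 1] doob_maximal_inequality[of "-1"] by (intro ennreal_leI) simp
  finally show ?thesis .
qed

end

lemma brownian_motion_increment:
  assumes "brownian_motion M F T W" "0 \<le> s" "s < t" "t \<le> T"
  shows "distributed M lborel (\<lambda>\<omega>. W t \<omega> - W s \<omega>) (normal_density 0 (sqrt (t - s)))"
    and "prob_space.indep_set M (sets (F s)) {(\<lambda>\<omega>. W t \<omega> - W s \<omega>) -` A \<inter> space M | A. A \<in> sets borel}"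
  using assms by (simp_all only: brownian_motion_def)

lemma brownian_motion_gaussian_increments:
  assumes fps: "filtered_prob_space M F" and bm: "brownian_motion M F T W"
    and s: "0 \<le> s" and \<tau>: "0 < \<tau>" and n: "s + real n * \<tau> \<le> T"
  shows "gaussian_increments M (\<lambda>i. F (s + real i * \<tau>)) (\<lambda>i \<omega>. W (s + real (Suc i) * \<tau>) \<omega> - W (s + real i * \<tau>) \<omega>) \<tau> n"
proof -
  interpret filtered_prob_space M F by fact
  have mono: "real i * \<tau> \<le> real j * \<tau>" if "i \<le> j" for i j
    using that \<tau> by (simp add: mult_right_mono)
  have W: "W u \<in> borel_measurable (F v)" if "0 \<le> u" "u \<le> T" "u \<le> v" for u v
  proof (rule measurable_from_subalg)
    show "subalgebra (F v) (F u)" using sets_F_mono[OF that(3)] space_F by (simp add: subalgebra_def)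
    show "W u \<in> borel_measurable (F u)" using bm that by (auto simp: brownian_motion_def adapted_def)
  qed
  show ?thesis
  proof
    fix i j :: nat assume "i \<le> j" "j \<le> n"
    then show "sets (F (s + real i * \<tau>)) \<subseteq> sets (F (s + real j * \<tau>))"
      using mono by (intro sets_F_mono) simp
  next
    fix i assume i: "i < n"
    have 1: "0 \<le> s + real i * \<tau>" "s + real i * \<tau> < s + real (Suc i) * \<tau>" "s + real (Suc i) * \<tau> \<le> T"
      using s \<tau> mono[of "Suc i" n] n i by (simp_all add: algebra_simps)
    show "(\<lambda>\<omega>. W (s + real (Suc i) * \<tau>) \<omega> - W (s + real i * \<tau>) \<omega>) \<in> borel_measurable (F (s + real (Suc i) * \<tau>))"
      using 1 by (intro borel_measurable_diff W) auto
    have "s + real (Suc i) * \<tau> - (s + real i * \<tau>) = \<tau>" by (simp add: algebra_simps)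
    then show "distributed M lborel (\<lambda>\<omega>. W (s + real (Suc i) * \<tau>) \<omega> - W (s + real i * \<tau>) \<omega>) (\<lambda>x. ennreal (normal_density 0 (sqrt \<tau>) x))"
      "indep_set (sets (F (s + real i * \<tau>))) {(\<lambda>\<omega>. W (s + real (Suc i) * \<tau>) \<omega> - W (s + real i * \<tau>) \<omega>) -` A \<inter> space M |A. A \<in> sets borel}"
      using brownian_motion_increment[OF bm 1] by simp_all
  qed (use \<tau> subalgebra_F in auto)
qed

text \<open>A measurable majorant \<open>R\<close> stands in for the supremum over an uncountable set of times. It is the lower limit of
  the maxima over finer and finer grids, so that Fatou's lemma carries over the discrete inequality, and by continuity of
  the paths it dominates the increment at every time.\<close>

lemma brownian_motion_maximal_inequality:
  assumes fps: "filtered_prob_space M F" and bm: "brownian_motion M F T W"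
    and st: "0 \<le> s" "s \<le> t" "t \<le> T"
  shows "\<exists>R\<in>borel_measurable M. (\<integral>\<^sup>+\<omega>. R \<omega> \<partial>M) \<le> ennreal (8 * (t - s)) \<and>
    (\<forall>\<omega>\<in>space M. \<forall>u\<in>{s..t}. ennreal ((W u \<omega> - W s \<omega>)\<^sup>2) \<le> R \<omega>)"
proof (cases "s = t")
  case True
  then show ?thesis by (intro bexI[of _ "\<lambda>_. 0"]) auto
next
  case False
  interpret filtered_prob_space M F by fact
  define \<tau> where "\<tau> n = (t - s) / real (Suc n)" for n
  have \<tau>: "0 < \<tau> n" "real (Suc n) * \<tau> n = t - s" for n using False st by (auto simp: \<tau>_def)
  have grid: "s + real k * \<tau> n \<in> {0..T}" if "k \<le> Suc n" for k n
  proof -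
    have "real k * \<tau> n \<le> real (Suc n) * \<tau> n" using that \<tau>(1)[of n] by (intro mult_right_mono) auto
    moreover have "0 \<le> real k * \<tau> n" using \<tau>(1)[of n] by simp
    ultimately show ?thesis using \<tau>(2)[of n] st by auto
  qed
  have W_meas: "W u \<in> borel_measurable M" if "u \<in> {0..T}" for u
    using bm that by (intro measurable_from_subalg[OF subalgebra_F]) (auto simp: brownian_motion_def adapted_def)
  define R where "R n \<omega> = (SUP k\<in>{..Suc n}. ennreal ((W (s + real k * \<tau> n) \<omega> - W s \<omega>)\<^sup>2))" for n \<omega>
  have R_meas: "R n \<in> borel_measurable M" for n
    unfolding R_def
  proof (rule borel_measurable_SUP)
    fix k assume "k \<in> {..Suc n}"
    then have [measurable]: "W (s + real k * \<tau> n) \<in> borel_measurable M" "W s \<in> borel_measurable M"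
      using grid[of k n] st by (auto intro!: W_meas)
    show "(\<lambda>\<omega>. ennreal ((W (s + real k * \<tau> n) \<omega> - W s \<omega>)\<^sup>2)) \<in> borel_measurable M" by measurable
  qed simp
  have R_int: "(\<integral>\<^sup>+\<omega>. R n \<omega> \<partial>M) \<le> ennreal (8 * (t - s))" for n
  proof -
    interpret gi: gaussian_increments M "\<lambda>i. F (s + real i * \<tau> n)"
      "\<lambda>i \<omega>. W (s + real (Suc i) * \<tau> n) \<omega> - W (s + real i * \<tau> n) \<omega>" "\<tau> n" "Suc n"
      by (rule brownian_motion_gaussian_increments[OF fps bm st(1) \<tau>(1)]) (use \<tau>(2)[of n] st in auto)
    have "(\<Sum>i<k. W (s + real (Suc i) * \<tau> n) \<omega> - W (s + real i * \<tau> n) \<omega>) = W (s + real k * \<tau> n) \<omega> - W s \<omega>" for k \<omega>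
      using sum_lessThan_telescope[of "\<lambda>i. W (s + real i * \<tau> n) \<omega>" k] by simp
    then show ?thesis using gi.nn_integral_max_walk_squared \<tau>(2)[of n]
      unfolding R_def by (simp only: mult.assoc)
  qed
  show ?thesis
  proof (intro bexI[of _ "\<lambda>\<omega>. liminf (\<lambda>n. R n \<omega>)"] conjI ballI)
    show "(\<lambda>\<omega>. liminf (\<lambda>n. R n \<omega>)) \<in> borel_measurable M" using R_meas by measurable
    have "(\<integral>\<^sup>+\<omega>. liminf (\<lambda>n. R n \<omega>) \<partial>M) \<le> liminf (\<lambda>n. \<integral>\<^sup>+\<omega>. R n \<omega> \<partial>M)"
      by (rule nn_integral_liminf[OF R_meas])
    also have "\<dots> \<le> ennreal (8 * (t - s))"
      using R_int by (intro Liminf_le) auto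
    finally show "(\<integral>\<^sup>+\<omega>. liminf (\<lambda>n. R n \<omega>) \<partial>M) \<le> ennreal (8 * (t - s))" .
  next
    fix \<omega> u assume \<omega>: "\<omega> \<in> space M" and u: "u \<in> {s..t}"
    define g where "g n = s + euler_grid (\<tau> n) (u - s)" for n
    have "g \<longlonglongrightarrow> s + (u - s)"
      unfolding g_def \<tau>_def using u False st by (intro tendsto_add tendsto_const euler_grid_tendsto) auto
    then have g: "g \<longlonglongrightarrow> u" by simp
    have g_grid: "\<exists>k\<in>{..Suc n}. g n = s + real k * \<tau> n" for n
    proof
      let ?k = "nat \<lfloor>(u - s) / \<tau> n\<rfloor>"
      have "0 \<le> (u - s) / \<tau> n" using u \<tau>(1)[of n] by (intro divide_nonneg_pos) auto
      then show "g n = s + real ?k * \<tau> n" by (simp add: g_def euler_grid_def)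
      have "(u - s) / \<tau> n \<le> real (Suc n)"
        using u \<tau>(1)[of n] \<tau>(2)[of n] by (subst pos_divide_le_eq) auto
      then show "?k \<in> {..Suc n}" by (simp add: nat_le_iff floor_le_iff)
    qed
    have gT: "g n \<in> {0..T}" for n
    proof -
      obtain k where "k \<in> {..Suc n}" "g n = s + real k * \<tau> n" using g_grid by blast
      then show ?thesis using grid[of k n] by simp
    qed
    have "continuous_on {0..T} (\<lambda>t. W t \<omega>)" using bm \<omega> by (auto simp: brownian_motion_def)
    then have "(\<lambda>n. W (g n) \<omega>) \<longlonglongrightarrow> W u \<omega>"
      by (rule continuous_on_tendsto_compose[OF _ g])
         (use u st gT in auto)
    then have "(\<lambda>n. ennreal ((W (g n) \<omega> - W s \<omega>)\<^sup>2)) \<longlonglongrightarrow> ennreal ((W u \<omega> - W s \<omega>)\<^sup>2)"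
      by (intro tendsto_intros tendsto_ennrealI)
    from lim_imp_Liminf[OF _ this]
    have "ennreal ((W u \<omega> - W s \<omega>)\<^sup>2) = liminf (\<lambda>n. ennreal ((W (g n) \<omega> - W s \<omega>)\<^sup>2))" by simp
    also have "\<dots> \<le> liminf (\<lambda>n. R n \<omega>)"
    proof (intro Liminf_mono always_eventually allI)
      fix n
      obtain k where "k \<in> {..Suc n}" "g n = s + real k * \<tau> n" using g_grid by blast
      then show "ennreal ((W (g n) \<omega> - W s \<omega>)\<^sup>2) \<le> R n \<omega>" unfolding R_def by (auto intro!: SUP_upper2)
    qed
    finally show "ennreal ((W u \<omega> - W s \<omega>)\<^sup>2) \<le> liminf (\<lambda>n. R n \<omega>)" .
  qed
qed

section \<open>Comparison of probability laws\<close>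

text \<open>The indicator of a closed set is a decreasing limit of continuous functions with values in \<open>[0,1]\<close>; inner
  regularity passes from closed to Borel sets.\<close>

lemma measure_le_if_continuous_integral_le:
  fixes \<mu> \<nu> :: "'a :: {second_countable_topology, complete_space} measure"
  assumes "prob_space \<mu>" "prob_space \<nu>" and sets: "sets \<mu> = sets borel" "sets \<nu> = sets borel"
    and le: "\<And>f :: 'a \<Rightarrow> real. continuous_on UNIV f \<Longrightarrow> (\<And>x. f x \<in> {0..1}) \<Longrightarrow> (\<integral>x. f x \<partial>\<mu>) \<le> (\<integral>x. f x \<partial>\<nu>) + K"
    and A: "A \<in> sets borel"
  shows "measure \<mu> A \<le> measure \<nu> A + K"
proof -
  interpret \<mu>: prob_space \<mu> by fact
  interpret \<nu>: prob_space \<nu> by fact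
  have sp: "space \<mu> = UNIV" "space \<nu> = UNIV"
    using sets_eq_imp_space_eq[OF sets(1)] sets_eq_imp_space_eq[OF sets(2)] by auto
  have K: "0 \<le> K" using le[of "\<lambda>_. 0"] by simp
  have closed: "measure \<mu> C \<le> measure \<nu> C + K" if C: "closed C" for C
  proof (cases "C = {}")
    case True
    then show ?thesis using K by simp
  next
    case False
    define f where "f n x = max 0 (1 - real n * infdist x C)" for n x
    have cont: "continuous_on UNIV (f n)" for n
      unfolding f_def by (intro continuous_intros)
    have f01: "f n x \<in> {0..1}" for n x using infdist_nonneg[of x C] by (auto simp: f_def)
    have lim: "(\<lambda>n. f n x) \<longlonglongrightarrow> indicator C x" for x
    proof (cases "x \<in> C")
      case True
      then show ?thesis by (simp add: f_def infdist_zero)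
    next
      case x: False
      then have pos: "0 < infdist x C"
        using infdist_pos_not_in_closed[OF C False] by simp
      then obtain n0 where n0: "1 < real n0 * infdist x C" using reals_Archimedean3 by blast
      have "f n x = 0" if "n \<ge> n0" for n
      proof -
        have "real n0 * infdist x C \<le> real n * infdist x C" using that pos by (intro mult_right_mono) auto
        then show ?thesis using n0 by (simp add: f_def)
      qed
      then have "\<forall>\<^sub>F n in sequentially. f n x = indicator C x"
        using x by (auto simp: eventually_sequentially)
      then show ?thesis by (rule tendsto_eventually)
    qed
    have [measurable]: "f n \<in> borel_measurable borel" for n by (rule borel_measurable_continuous_onI[OF cont])
    have CB: "C \<in> sets borel" using C by simp
    have conv: "(\<lambda>n. \<integral>x. f n x \<partial>\<rho>) \<longlonglongrightarrow> measure \<rho> C"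
      if "prob_space \<rho>" and [measurable_cong]: "sets \<rho> = sets borel" for \<rho>
    proof -
      interpret \<rho>: prob_space \<rho> by fact
      have "(\<lambda>n. \<integral>x. f n x \<partial>\<rho>) \<longlonglongrightarrow> (\<integral>x. indicator C x \<partial>\<rho>)"
      proof (rule integral_dominated_convergence[where w="\<lambda>_. 1"])
        show "AE x in \<rho>. norm (f n x) \<le> 1" for n using f01[of n] by (intro AE_I2) auto
      qed (use lim CB in \<open>auto\<close>)
      then show ?thesis using CB that(2) by simp
    qed
    show ?thesis
      by (rule LIMSEQ_le[OF conv[OF \<open>prob_space \<mu>\<close> sets(1)] tendsto_add[OF conv[OF \<open>prob_space \<nu>\<close> sets(2)] tendsto_const]])
         (use le[OF cont f01] in auto)
  qed
  have "emeasure \<mu> A = (SUP C\<in>{C. C \<subseteq> A \<and> compact C}. emeasure \<mu> C)"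
    by (rule inner_regular[OF sets(1) _ A]) simp
  also have "\<dots> \<le> ennreal (measure \<nu> A + K)"
  proof (rule SUP_least)
    fix C assume C: "C \<in> {C. C \<subseteq> A \<and> compact C}"
    then have "measure \<mu> C \<le> measure \<nu> C + K" by (intro closed compact_imp_closed) auto
    also have "measure \<nu> C \<le> measure \<nu> A" using C A sets by (intro \<nu>.finite_measure_mono) auto
    finally show "emeasure \<mu> C \<le> ennreal (measure \<nu> A + K)"
      by (simp add: \<mu>.emeasure_eq_measure ennreal_leI)
  qed
  finally show ?thesis using K by (simp add: \<mu>.emeasure_eq_measure del: ennreal_plus)
qed

text \<open>The sum is the integer part of \<open>y\<close>.\<close>

lemma sum_threshold_indicators:
  fixes y :: real
  assumes "0 \<le> y" "y \<le> real m"
  shows "(\<Sum>j=1..m. indicator {real j..} y) \<le> y" "y \<le> (\<Sum>j=1..m. indicator {real j..} y) + 1"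
proof -
  define k where "k = nat \<lfloor>y\<rfloor>"
  have k: "real k \<le> y" "y < real k + 1" "k \<le> m" using assms by (auto simp: k_def nat_le_iff floor_le_iff) 
  have "(\<Sum>j=1..m. indicator {real j..} y) = (\<Sum>j=1..k. 1 :: real)"
    using k by (intro sum.mono_neutral_cong_right) (auto simp: indicator_def)
  then have "(\<Sum>j=1..m. indicator {real j..} y) = real k" by simp
  with k show "(\<Sum>j=1..m. indicator {real j..} y) \<le> y" "y \<le> (\<Sum>j=1..m. indicator {real j..} y) + 1" by auto
qed

text \<open>A layer cake argument with \<open>m\<close> levels: up to an error of \<open>1/m\<close>, the function is the average of the indicators of
  its superlevel sets, and the measures of each of these differ by at most \<open>K\<close>.\<close>

lemma integral_le_if_measure_le:
  assumes "prob_space \<mu>" "prob_space \<nu>" and sets: "sets \<nu> = sets \<mu>"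
    and le: "\<And>A. A \<in> sets \<mu> \<Longrightarrow> measure \<mu> A \<le> measure \<nu> A + K"
    and g: "g \<in> borel_measurable \<mu>" and g01: "\<And>x. x \<in> space \<mu> \<Longrightarrow> g x \<in> {0..1::real}"
  shows "(\<integral>x. g x \<partial>\<mu>) \<le> (\<integral>x. g x \<partial>\<nu>) + K"
proof (rule field_le_epsilon)
  fix e :: real assume "0 < e"
  then obtain m :: nat where m: "0 < m" "1 / real m < e" using nat_approx_posE by (metis zero_less_Suc)
  interpret \<mu>: prob_space \<mu> by fact
  interpret \<nu>: prob_space \<nu> by fact
  have sp: "space \<nu> = space \<mu>" by (rule sets_eq_imp_space_eq[OF sets])
  define S where "S x = (\<Sum>j=1..m. indicator {real j..} (real m * g x) :: real)" for x
  define B where "B j = {x \<in> space \<mu>. real j \<le> real m * g x}" for j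
  have B: "B j \<in> sets \<mu>" "B j \<in> sets \<nu>" for j using g unfolding B_def sets by measurable
  have S: "S x \<le> real m * g x" "real m * g x \<le> S x + 1" if "x \<in> space \<mu>" for x
    using sum_threshold_indicators[of "real m * g x" m] g01[OF that] m
    by (auto simp: S_def intro!: mult_left_le)
  have S_eq: "S x = (\<Sum>j=1..m. indicator (B j) x)" if "x \<in> space \<mu>" for x
    using that by (auto simp: S_def B_def indicator_def intro!: sum.cong)
  have gint: "integrable \<mu> g" "integrable \<nu> g"
    by (rule \<mu>.integrable_const_bound[of _ 1] \<nu>.integrable_const_bound[of _ 1];
        use g g01 sp sets in \<open>auto cong: measurable_cong_sets\<close>)+
  have S\<mu>: "integrable \<mu> S" "(\<integral>x. S x \<partial>\<mu>) = (\<Sum>j=1..m. measure \<mu> (B j))"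
    using B by (simp_all add: Bochner_Integration.integrable_cong[OF refl S_eq] Bochner_Integration.integral_cong[OF refl S_eq]
        Bochner_Integration.integral_sum \<mu>.emeasure_eq_measure)
  have S\<nu>: "integrable \<nu> S" "(\<integral>x. S x \<partial>\<nu>) = (\<Sum>j=1..m. measure \<nu> (B j))"
    using B by (simp_all add: Bochner_Integration.integrable_cong[OF refl S_eq[folded sp]] Bochner_Integration.integral_cong[OF refl S_eq[folded sp]]
        Bochner_Integration.integral_sum \<nu>.emeasure_eq_measure)
  have "real m * (\<integral>x. g x \<partial>\<mu>) = (\<integral>x. real m * g x \<partial>\<mu>)" by simp
  also have "\<dots> \<le> (\<integral>x. S x + 1 \<partial>\<mu>)" by (rule integral_mono) (use gint S\<mu> S in auto)
  also have "\<dots> = (\<Sum>j=1..m. measure \<mu> (B j)) + 1" using S\<mu> by (simp add: \<mu>.prob_space)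
  also have "(\<Sum>j=1..m. measure \<mu> (B j)) \<le> (\<Sum>j=1..m. measure \<nu> (B j) + K)"
    by (intro sum_mono le B)
  also have "\<dots> = (\<integral>x. S x \<partial>\<nu>) + real m * K" using S\<nu> by (simp add: sum.distrib)
  also have "(\<integral>x. S x \<partial>\<nu>) \<le> (\<integral>x. real m * g x \<partial>\<nu>)" by (rule integral_mono) (use gint S\<nu> S sp in auto)
  finally have "real m * (\<integral>x. g x \<partial>\<mu>) \<le> real m * ((\<integral>x. g x \<partial>\<nu>) + K + 1 / real m)"
    using m by (simp add: algebra_simps)
  then have "(\<integral>x. g x \<partial>\<mu>) \<le> (\<integral>x. g x \<partial>\<nu>) + K + 1 / real m" using m by simp
  then show "(\<integral>x. g x \<partial>\<mu>) \<le> (\<integral>x. g x \<partial>\<nu>) + K + e" using m by simp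
qed

lemma abs_integral_diff_le_total_variation:
  assumes \<mu>: "prob_space \<mu>" and \<nu>: "prob_space \<nu>" and sets: "sets \<nu> = sets \<mu>"
    and le: "\<And>A. A \<in> sets \<mu> \<Longrightarrow> measure \<mu> A \<le> measure \<nu> A + K"
    and f: "f \<in> borel_measurable \<mu>" and B: "\<And>x. x \<in> space \<mu> \<Longrightarrow> \<bar>f x\<bar> \<le> B" "0 < (B :: real)"
  shows "\<bar>(\<integral>x. f x \<partial>\<mu>) - (\<integral>x. f x \<partial>\<nu>)\<bar> \<le> 2 * B * K"
proof -
  interpret \<mu>: prob_space \<mu> by fact
  interpret \<nu>: prob_space \<nu> by fact
  have sp: "space \<nu> = space \<mu>" by (rule sets_eq_imp_space_eq[OF sets])
  have f': "f \<in> borel_measurable \<nu>" using f sets by (simp cong: measurable_cong_sets)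
  have int: "integrable \<mu> f" "integrable \<nu> f"
    using \<mu>.integrable_const_bound[of f B] \<nu>.integrable_const_bound[of f B] B f f' sp by auto
  have one_sided: "s * (\<integral>x. f x \<partial>\<mu>) \<le> s * (\<integral>x. f x \<partial>\<nu>) + 2 * B * K" if s: "\<bar>s\<bar> = 1" for s
  proof -
    have "(\<integral>x. (s * f x + B) / (2 * B) \<partial>\<mu>) \<le> (\<integral>x. (s * f x + B) / (2 * B) \<partial>\<nu>) + K"
    proof (rule integral_le_if_measure_le[OF \<mu> \<nu> sets le])
      show "(\<lambda>x. (s * f x + B) / (2 * B)) \<in> borel_measurable \<mu>" using f by simp
      fix x assume "x \<in> space \<mu>"
      then have "\<bar>s * f x\<bar> \<le> B" using B s by (simp add: abs_mult)
      then show "(s * f x + B) / (2 * B) \<in> {0..1}" using B by (auto simp: field_simps abs_le_iff)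
    qed
    then have "(s * (\<integral>x. f x \<partial>\<mu>) + B) / (2 * B) \<le> (s * (\<integral>x. f x \<partial>\<nu>) + B) / (2 * B) + K"
      using int by (simp add: \<mu>.prob_space \<nu>.prob_space)
    also have "\<dots> = (s * (\<integral>x. f x \<partial>\<nu>) + B + 2 * B * K) / (2 * B)"
      using B by (simp add: add_divide_distrib)
    finally show ?thesis using B by (simp add: divide_le_cancel)
  qed
  show ?thesis using one_sided[of 1] one_sided[of "-1"] by (simp add: abs_le_iff)
qed

section \<open>Brownian motion with a drift\<close>

text \<open>Convergence of left Riemann sums for a bounded function with countably many discontinuities, by dominated
  convergence.\<close>

lemma euler_grid_integral_tendsto:
  fixes \<beta> :: "real \<Rightarrow> real"
  assumes T: "0 < T" and u: "u \<in> {0..T}"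
    and bd: "\<And>s. s \<in> {0..T} \<Longrightarrow> \<bar>\<beta> s\<bar> \<le> B"
    and meas: "(\<lambda>s. indicator {0..T} s * \<beta> s) \<in> borel_measurable borel"
    and N: "countable N" and cont: "\<And>s. s \<in> {0..T} - N \<Longrightarrow> continuous (at s within {0..T}) \<beta>"
  shows "(\<lambda>n. LBINT s:{0..euler_grid (T / real (Suc n)) u}. \<beta> (euler_grid (T / real (Suc n)) s))
    \<longlonglongrightarrow> (LBINT s:{0..u}. \<beta> s)"
  unfolding set_lebesgue_integral_def
proof (rule integral_dominated_convergence[where w="\<lambda>s. indicator {0..T} s * B"])
  let ?g = "\<lambda>n. euler_grid (T / real (Suc n))"
  have pos: "0 < T / real (Suc n)" for n using T by simp
  have g: "?g n s \<in> {0..T}" "?g n s \<le> s" if "s \<in> {0..T}" for n s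
    using euler_grid_bounds[OF pos[of n], of s] that by auto
  have B: "0 \<le> B" using bd[OF u] by simp
  have "(\<lambda>s. indicator {0..u} s *\<^sub>R \<beta> s) = (\<lambda>s. indicator {0..u} s *\<^sub>R (indicator {0..T} s * \<beta> s))"
    using u by (auto simp: indicator_def)
  then show "(\<lambda>s. indicat_real {0..u} s *\<^sub>R \<beta> s) \<in> borel_measurable lborel"
    using meas by simp
  show "(\<lambda>s. indicat_real {0..?g n u} s *\<^sub>R \<beta> (?g n s)) \<in> borel_measurable lborel" for n
    using borel_measurable_euler_grid[of \<beta>] by simp
  show "integrable lborel (\<lambda>s. indicat_real {0..T} s * B)"
    by (intro integrable_mult_left) (simp add: integrable_indicator_iff emeasure_lborel_Icc_eq)
  show "AE s in lborel. norm (indicat_real {0..?g n u} s *\<^sub>R \<beta> (?g n s)) \<le> indicat_real {0..T} s * B" for n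
    using g[OF u, of n] bd g B by (intro AE_I2) (auto simp: indicator_def)
  have "AE s in lborel. s \<notin> N \<union> {u}"
    using N by (intro AE_not_in countable_imp_null_set_lborel) auto
  then show "AE s in lborel. (\<lambda>n. indicat_real {0..?g n u} s *\<^sub>R \<beta> (?g n s)) \<longlonglongrightarrow> indicat_real {0..u} s *\<^sub>R \<beta> s"
  proof eventually_elim
    case (elim s)
    show ?case
    proof (cases "s \<in> {0..<u}")
      case True
      then have s: "s \<in> {0..T} - N" using u elim by auto
      have "(\<lambda>n. ?g n u) \<longlonglongrightarrow> u" by (rule euler_grid_tendsto) (use T u in auto)
      then have "\<forall>\<^sub>F n in sequentially. s < ?g n u" by (rule order_tendstoD) (use True in auto)
      then have ev: "\<forall>\<^sub>F n in sequentially. indicat_real {0..?g n u} s *\<^sub>R \<beta> (?g n s) = \<beta> (?g n s)"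
        by eventually_elim (use True in auto)
      have lim: "(\<lambda>n. ?g n s) \<longlonglongrightarrow> s" by (rule euler_grid_tendsto) (use T s in auto)
      have "(\<lambda>n. \<beta> (?g n s)) \<longlonglongrightarrow> \<beta> s"
        using cont[OF s] lim g s unfolding continuous_within_sequentially by (auto simp: o_def)
      then have "(\<lambda>n. indicat_real {0..?g n u} s *\<^sub>R \<beta> (?g n s)) \<longlonglongrightarrow> \<beta> s"
        using tendsto_cong[OF ev] by simp
      then show ?thesis using True by simp
    next
      case False
      then have "s < 0 \<or> u < s" using elim by auto
      then have "indicat_real {0..?g n u} s = 0" "indicat_real {0..u} s = 0" for n
        using g(2)[OF u, of n] by (auto simp: indicator_def)
      then show ?thesis by simp
    qed
  qed
qed

text \<open>Adding a drift \<open>\<beta>\<close> with \<open>E \<beta>\<^sup>2 \<le> \<kappa>\<close> changes the law by at most \<open>\<epsilon> + T \<kappa> / (2 \<epsilon>)\<close> in total variation, for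
  every \<open>\<epsilon>\<close>. Along the partition with step \<open>\<tau>\<close> the shift of the \<open>i\<close>-th increment is \<open>\<tau> \<beta>\<^bsub>i \<tau>\<^esub>\<close>, which is known at the
  beginning of that increment, and the entropy bound sums up to \<open>T \<kappa> / 2\<close> for each \<open>\<tau>\<close>. Then \<open>\<tau>\<close> tends to zero. The value
  at time zero is subtracted since \<open>W\<close> starts at zero only almost surely.\<close>

lemma drifted_brownian_motion_law_le:
  fixes d :: "nat \<Rightarrow> real" and \<beta> :: "real \<Rightarrow> 'a \<Rightarrow> real"
  assumes fps: "filtered_prob_space M F" and bm: "brownian_motion M F T W" and T: "0 < T"
    and \<beta>_adapted: "\<And>t. t \<in> {0..T} \<Longrightarrow> \<beta> t \<in> borel_measurable (F t)"
    and \<beta>_int: "\<And>t. t \<in> {0..T} \<Longrightarrow> integrable M (\<lambda>\<omega>. (\<beta> t \<omega>)\<^sup>2)"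
    and \<beta>_le: "\<And>t. t \<in> {0..T} \<Longrightarrow> (\<integral>\<omega>. (\<beta> t \<omega>)\<^sup>2 \<partial>M) \<le> \<kappa>"
    and \<beta>_bd: "\<And>\<omega>. \<omega> \<in> space M \<Longrightarrow> \<exists>B. \<forall>s\<in>{0..T}. \<bar>\<beta> s \<omega>\<bar> \<le> B"
    and \<beta>_meas: "\<And>\<omega>. \<omega> \<in> space M \<Longrightarrow> (\<lambda>s. indicator {0..T} s * \<beta> s \<omega>) \<in> borel_measurable borel"
    and N: "countable N"
    and \<beta>_cont: "\<And>\<omega> s. \<omega> \<in> space M \<Longrightarrow> s \<in> {0..T} - N \<Longrightarrow> continuous (at s within {0..T}) (\<lambda>s. \<beta> s \<omega>)"
    and d: "range d \<subseteq> {0..T}" and \<epsilon>: "0 < \<epsilon>" and A: "A \<in> sets borel"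
  defines "V \<equiv> \<lambda>\<omega> m. W (d m) \<omega> - W 0 \<omega> + (LBINT s:{0..d m}. \<beta> s \<omega>)"
    and "U \<equiv> \<lambda>\<omega> m. W (d m) \<omega> - W 0 \<omega>"
  shows "V \<in> borel_measurable M" "U \<in> borel_measurable M"
    "measure (distr M borel V) A \<le> measure (distr M borel U) A + (\<epsilon> + T * \<kappa> / (2 * \<epsilon>))"
proof -
  interpret filtered_prob_space M F by fact
  define \<tau> where "\<tau> n = T / real (Suc n)" for n
  have \<tau>: "0 < \<tau> n" "real (Suc n) * \<tau> n = T" for n using T by (auto simp: \<tau>_def)
  define g where "g n = euler_grid (\<tau> n)" for n
  define j where "j n m = nat \<lfloor>d m / \<tau> n\<rfloor>" for n m
  have dm: "d m \<in> {0..T}" for m using d by blast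
  have g_eq: "g n (d m) = real (j n m) * \<tau> n" for n m
    using dm[of m] \<tau>(1)[of n] by (simp add: g_def j_def euler_grid_def)
  have gT: "g n (d m) \<in> {0..T}" for n m
    using euler_grid_bounds[OF \<tau>(1)[of n], of "d m"] dm[of m] by (auto simp: g_def)
  have j_le: "j n m \<le> Suc n" for n m
  proof -
    have "d m / \<tau> n \<le> real (Suc n)" using dm[of m] \<tau>[of n] by (subst pos_divide_le_eq) auto
    then show ?thesis by (simp add: j_def nat_le_iff floor_le_iff)
  qed
  have grid: "real i * \<tau> n \<in> {0..T}" if "i \<le> Suc n" for i n
  proof -
    have "real i * \<tau> n \<le> real (Suc n) * \<tau> n" using that \<tau>(1)[of n] by (intro mult_right_mono) auto
    then show ?thesis using \<tau>[of n] by (auto intro!: mult_nonneg_nonneg less_imp_le[OF \<tau>(1)])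
  qed
  have W_meas: "W u \<in> borel_measurable M" if "u \<in> {0..T}" for u
    using bm that by (intro measurable_from_subalg[OF subalgebra_F]) (auto simp: brownian_motion_def adapted_def)
  have \<beta>_M: "\<beta> u \<in> borel_measurable M" if "u \<in> {0..T}" for u
    by (rule measurable_from_subalg[OF subalgebra_F \<beta>_adapted[OF that]])
  have W_cont: "continuous_on {0..T} (\<lambda>t. W t \<omega>)" if "\<omega> \<in> space M" for \<omega>
    using bm that by (auto simp: brownian_motion_def)
  define \<xi> where "\<xi> n i \<omega> = W (0 + real (Suc i) * \<tau> n) \<omega> - W (0 + real i * \<tau> n) \<omega>" for n i \<omega>
  define a where "a n i \<omega> = \<tau> n * \<beta> (0 + real i * \<tau> n) \<omega>" for n i \<omega>
  have gi: "gaussian_increments M (\<lambda>i. F (0 + real i * \<tau> n)) (\<xi> n) (\<tau> n) (Suc n)" for n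
    unfolding \<xi>_def using brownian_motion_gaussian_increments[OF fps bm order_refl \<tau>(1), of "Suc n" n] \<tau>(2)[of n] by simp
  define Ud where "Ud n \<omega> m = (\<Sum>i<j n m. \<xi> n i \<omega>)" for n \<omega> m
  define Vd where "Vd n \<omega> m = (\<Sum>i<j n m. \<xi> n i \<omega> + a n i \<omega>)" for n \<omega> m
  have Ud_eq: "Ud n \<omega> m = W (g n (d m)) \<omega> - W 0 \<omega>" for n \<omega> m
    unfolding Ud_def \<xi>_def g_eq using sum_lessThan_telescope[of "\<lambda>i. W (real i * \<tau> n) \<omega>" "j n m"] by simp
  have Vd_eq: "Vd n \<omega> m = W (g n (d m)) \<omega> - W 0 \<omega> + (LBINT s:{0..g n (d m)}. \<beta> (g n s) \<omega>)" if \<omega>: "\<omega> \<in> space M" for n \<omega> m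
  proof -
    obtain B where B: "\<And>s. s \<in> {0..T} \<Longrightarrow> \<bar>\<beta> s \<omega>\<bar> \<le> B" using \<beta>_bd[OF \<omega>] by blast
    have "(LBINT s:{0..g n (d m)}. \<beta> (g n s) \<omega>) = (\<Sum>i<j n m. a n i \<omega>)"
      using integral_euler_grid_eq_riemann_sum[where g="\<lambda>s. \<beta> s \<omega>" and j="j n m", OF \<tau>(1)[of n] B, of T] gT[of n m]
      unfolding g_eq a_def by (simp add: g_def)
    then show ?thesis using Ud_eq[of n \<omega> m] by (simp add: Vd_def Ud_def sum.distrib)
  qed
  have g_lim: "(\<lambda>n. g n (d m)) \<longlonglongrightarrow> d m" for m
    unfolding g_def \<tau>_def using T dm[of m] by (intro euler_grid_tendsto) auto
  have W_lim: "(\<lambda>n. W (g n (d m)) \<omega>) \<longlonglongrightarrow> W (d m) \<omega>" if "\<omega> \<in> space M" for m \<omega>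
    by (rule continuous_on_tendsto_compose[OF W_cont[OF that] g_lim dm]) (use gT in auto)
  have Ud_lim: "(\<lambda>n. Ud n \<omega> m) \<longlonglongrightarrow> U \<omega> m" if "\<omega> \<in> space M" for m \<omega>
    unfolding Ud_eq U_def by (intro tendsto_intros W_lim that)
  have Vd_lim: "(\<lambda>n. Vd n \<omega> m) \<longlonglongrightarrow> V \<omega> m" if \<omega>: "\<omega> \<in> space M" for m \<omega>
  proof -
    obtain B where B: "\<And>s. s \<in> {0..T} \<Longrightarrow> \<bar>\<beta> s \<omega>\<bar> \<le> B" using \<beta>_bd[OF \<omega>] by blast
    have "(\<lambda>n. LBINT s:{0..g n (d m)}. \<beta> (g n s) \<omega>) \<longlonglongrightarrow> (LBINT s:{0..d m}. \<beta> s \<omega>)"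
      unfolding g_def \<tau>_def
      by (rule euler_grid_integral_tendsto[where \<beta>="\<lambda>s. \<beta> s \<omega>", OF T dm B \<beta>_meas[OF \<omega>] N \<beta>_cont[OF \<omega>]])
    then show ?thesis unfolding Vd_eq[OF \<omega>] V_def by (intro tendsto_intros W_lim \<omega>)
  qed
  have Ud_meas: "(\<lambda>\<omega>. Ud n \<omega>) \<in> borel_measurable M" for n
  proof (rule measurable_coordinatewise_then_product)
    show "(\<lambda>\<omega>. Ud n \<omega> m) \<in> borel_measurable M" for m
      unfolding Ud_eq by (rule borel_measurable_diff[OF W_meas W_meas]) (use gT[of n m] T in auto)
  qed
  have Vd_meas: "(\<lambda>\<omega>. Vd n \<omega>) \<in> borel_measurable M" for n
  proof (rule measurable_coordinatewise_then_product)
    fix m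
    have "\<xi> n i \<in> borel_measurable M" "a n i \<in> borel_measurable M" if "i < j n m" for i
    proof -
      have "0 + real i * \<tau> n \<in> {0..T}" "0 + real (Suc i) * \<tau> n \<in> {0..T}"
        using grid[of i n] grid[of "Suc i" n] that j_le[of n m] by (simp_all del: of_nat_Suc)
      note [measurable] = W_meas[OF this(1)] W_meas[OF this(2)] \<beta>_M[OF this(1)]
      show "\<xi> n i \<in> borel_measurable M" "a n i \<in> borel_measurable M"
        unfolding \<xi>_def a_def by measurable
    qed
    then show "(\<lambda>\<omega>. Vd n \<omega> m) \<in> borel_measurable M" unfolding Vd_def
      by (intro borel_measurable_sum borel_measurable_add) auto
  qed
  show U_meas: "U \<in> borel_measurable M"
  proof (rule measurable_coordinatewise_then_product)
    show "(\<lambda>\<omega>. U \<omega> m) \<in> borel_measurable M" for m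
      unfolding U_def by (rule borel_measurable_diff[OF W_meas W_meas]) (use dm[of m] T in auto)
  qed
  show V_meas: "V \<in> borel_measurable M"
  proof (rule measurable_coordinatewise_then_product)
    show "(\<lambda>\<omega>. V \<omega> m) \<in> borel_measurable M" for m
      by (rule borel_measurable_LIMSEQ_real[OF Vd_lim])
         (auto intro!: measurable_product_then_coordinatewise[OF Vd_meas])
  qed
  have step: "(\<integral>\<omega>. f (Vd n \<omega>) \<partial>M) \<le> (\<integral>\<omega>. f (Ud n \<omega>) \<partial>M) + (\<epsilon> + T * \<kappa> / (2 * \<epsilon>))"
    if f: "continuous_on UNIV f" and f01: "\<And>x. f x \<in> {0..1}" for f :: "(nat \<Rightarrow> real) \<Rightarrow> real" and n
  proof -
    interpret gi: gaussian_increments M "\<lambda>i. F (0 + real i * \<tau> n)" "\<xi> n" "\<tau> n" "Suc n" by (rule gi)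
    define \<Phi> where "\<Phi> y = f (\<lambda>m. \<Sum>i<j n m. y i)" for y
    have \<Phi>_eq: "\<Phi> (\<lambda>i\<in>{..<Suc n}. y i) = f (\<lambda>m. \<Sum>i<j n m. y i)" for y
    proof -
      have "(\<Sum>i<j n m. (\<lambda>i\<in>{..<Suc n}. y i) i) = (\<Sum>i<j n m. y i)" for m
        using j_le[of n m] by (intro sum.cong) auto
      then show ?thesis by (simp add: \<Phi>_def)
    qed
    have "(\<lambda>y m. \<Sum>i<j n m. y i) \<in> measurable (PiM {..<Suc n} (\<lambda>_. borel :: real measure)) (borel :: (nat \<Rightarrow> real) measure)"
    proof (rule measurable_coordinatewise_then_product)
      show "(\<lambda>y. \<Sum>i<j n m. y i) \<in> borel_measurable (PiM {..<Suc n} (\<lambda>_. borel :: real measure))" for m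
        using j_le[of n m] by (intro borel_measurable_sum measurable_component_singleton) auto
    qed
    then have \<Phi>_meas: "\<Phi> \<in> borel_measurable (PiM {..<Suc n} (\<lambda>_. borel))"
      unfolding \<Phi>_def by (rule measurable_compose) (rule borel_measurable_continuous_onI[OF f])
    have t: "0 + real i * \<tau> n \<in> {0..T}" if "i < Suc n" for i using grid[of i n] that by simp
    have "(\<integral>\<omega>. \<Phi> (\<lambda>i\<in>{..<Suc n}. \<xi> n i \<omega> + a n i \<omega>) \<partial>M) \<le>
      (\<integral>\<omega>. \<Phi> (\<lambda>i\<in>{..<Suc n}. \<xi> n i \<omega>) \<partial>M) + \<epsilon> + (\<Sum>i<Suc n. \<integral>\<omega>. (a n i \<omega>)\<^sup>2 \<partial>M) / (2 * \<tau> n * \<epsilon>)"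
    proof (rule gi.shifted_expectation_le[OF _ _ \<Phi>_meas _ \<epsilon>])
      fix i assume i: "i < Suc n"
      show "a n i \<in> borel_measurable (F (0 + real i * \<tau> n))"
        unfolding a_def by (intro borel_measurable_times borel_measurable_const \<beta>_adapted t i)
      show "integrable M (\<lambda>\<omega>. (a n i \<omega>)\<^sup>2)"
        unfolding a_def power_mult_distrib by (intro integrable_mult_right \<beta>_int t i)
    next
      show "\<Phi> y \<in> {0..1}" for y unfolding \<Phi>_def by (rule f01)
    qed
    also have "(\<Sum>i<Suc n. \<integral>\<omega>. (a n i \<omega>)\<^sup>2 \<partial>M) \<le> (\<Sum>i<Suc n. (\<tau> n)\<^sup>2 * \<kappa>)"
      unfolding a_def power_mult_distrib using \<beta>_le t by (intro sum_mono) (simp add: mult_left_mono)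
    also have "\<dots> = \<tau> n * T * \<kappa>" using \<tau>(2)[of n] by (simp add: power2_eq_square algebra_simps flip: \<tau>(2)[of n])
    finally show ?thesis
      using \<epsilon> \<tau>(1)[of n] unfolding \<Phi>_eq by (simp add: Vd_def[abs_def] Ud_def[abs_def] divide_right_mono)
  qed
  have "(\<integral>x. f x \<partial>distr M borel V) \<le> (\<integral>x. f x \<partial>distr M borel U) + (\<epsilon> + T * \<kappa> / (2 * \<epsilon>))"
    if f: "continuous_on UNIV f" and f01: "\<And>x. f x \<in> {0..1}" for f :: "(nat \<Rightarrow> real) \<Rightarrow> real"
  proof -
    have [measurable]: "f \<in> borel_measurable borel" by (rule borel_measurable_continuous_onI[OF f])
    have conv: "(\<lambda>n. \<integral>\<omega>. f (Xn n \<omega>) \<partial>M) \<longlonglongrightarrow> (\<integral>\<omega>. f (X \<omega>) \<partial>M)"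
      if [measurable]: "\<And>n. Xn n \<in> borel_measurable M" "X \<in> borel_measurable M"
        and lim: "\<And>\<omega> m. \<omega> \<in> space M \<Longrightarrow> (\<lambda>n. Xn n \<omega> m) \<longlonglongrightarrow> X \<omega> m" for Xn and X :: "'a \<Rightarrow> nat \<Rightarrow> real"
    proof (rule integral_dominated_convergence[where w="\<lambda>_. 1"])
      show "AE \<omega> in M. (\<lambda>n. f (Xn n \<omega>)) \<longlonglongrightarrow> f (X \<omega>)"
      proof (rule AE_I2)
        fix \<omega> assume "\<omega> \<in> space M"
        then have "(\<lambda>n. Xn n \<omega>) \<longlonglongrightarrow> X \<omega>"
          using lim limitin_componentwise[of "\<lambda>_::nat. euclidean :: real topology" UNIV "\<lambda>n. Xn n \<omega>" "X \<omega>" sequentially]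
          by (simp add: euclidean_product_topology)
        then show "(\<lambda>n. f (Xn n \<omega>)) \<longlonglongrightarrow> f (X \<omega>)"
          by (rule continuous_on_tendsto_compose[OF f]) auto
      qed
      show "AE \<omega> in M. norm (f (Xn n \<omega>)) \<le> 1" for n using f01 by (intro AE_I2) auto
    qed (auto)
    have "(\<integral>\<omega>. f (V \<omega>) \<partial>M) \<le> (\<integral>\<omega>. f (U \<omega>) \<partial>M) + (\<epsilon> + T * \<kappa> / (2 * \<epsilon>))"
      by (rule LIMSEQ_le[OF conv[OF Vd_meas V_meas Vd_lim] tendsto_add[OF conv[OF Ud_meas U_meas Ud_lim] tendsto_const]])
         (use step[OF f f01] in auto)
    then show ?thesis using U_meas V_meas by (simp add: integral_distr)
  qed
  then show "measure (distr M borel V) A \<le> measure (distr M borel U) A + (\<epsilon> + T * \<kappa> / (2 * \<epsilon>))"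
    by (intro measure_le_if_continuous_integral_le prob_space_distr U_meas V_meas A) auto
qed

section \<open>Hoelder continuous drifts\<close>

lemma powr_le_one_plus:
  fixes v :: real
  assumes "0 \<le> v" "0 < \<alpha>" "\<alpha> \<le> 1" shows "v powr \<alpha> \<le> 1 + v"
proof (cases "v \<le> 1")
  case True
  then have "v powr \<alpha> \<le> 1" using assms by (intro powr_le1) auto
  then show ?thesis using assms by simp
next
  case False
  then have "v powr \<alpha> \<le> v powr 1" using assms by (intro powr_mono) auto
  then show ?thesis using False by simp
qed

lemma hoelder_continuous_imp_continuous_on:
  assumes "hoelder_continuous \<alpha> b" "0 < \<alpha>"
  shows "continuous_on {0..} b"
proof -
  obtain C where C: "C > 0" "\<And>x y. x \<in> {0..} \<Longrightarrow> y \<in> {0..} \<Longrightarrow> \<bar>b x - b y\<bar> \<le> C * \<bar>x - y\<bar> powr \<alpha>"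
    using assms(1) by (auto simp: hoelder_continuous_def)
  show ?thesis
    unfolding continuous_on_def
  proof
    fix x :: real assume x: "x \<in> {0..}"
    have "((\<lambda>y. C * \<bar>y - x\<bar> powr \<alpha>) \<longlongrightarrow> C * \<bar>x - x\<bar> powr \<alpha>) (at x within {0..})"
      using \<open>0 < \<alpha>\<close> by (intro tendsto_intros tendsto_powr2) (auto intro!: tendsto_eq_intros always_eventually)
    then have "((\<lambda>y. C * \<bar>y - x\<bar> powr \<alpha>) \<longlongrightarrow> 0) (at x within {0..})" by simp
    then have "((\<lambda>y. b y - b x) \<longlongrightarrow> 0) (at x within {0..})"
      by (rule Lim_null_comparison[rotated]) (use C(2)[OF _ x] in \<open>auto simp: eventually_at_filter\<close>)
    then show "(b \<longlongrightarrow> b x) (at x within {0..})" by (simp add: LIM_zero_iff)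
  qed
qed

lemma hoelder_continuous_linear_growth:
  assumes "hoelder_continuous \<alpha> b" "0 < \<alpha>" "\<alpha> \<le> 1"
  shows "\<exists>K>0. \<forall>x\<ge>0. \<bar>b x\<bar> \<le> K * (1 + x)"
proof -
  obtain C where C: "C > 0" "\<And>x y. x \<in> {0..} \<Longrightarrow> y \<in> {0..} \<Longrightarrow> \<bar>b x - b y\<bar> \<le> C * \<bar>x - y\<bar> powr \<alpha>"
    using assms(1) by (auto simp: hoelder_continuous_def)
  have "\<bar>b x\<bar> \<le> (\<bar>b 0\<bar> + C) * (1 + x)" if "0 \<le> x" for x
  proof -
    have "\<bar>b x - b 0\<bar> \<le> C * \<bar>x - 0\<bar> powr \<alpha>" using C(2)[of x 0] that by auto
    also have "\<dots> \<le> C * (1 + x)" using powr_le_one_plus[of x \<alpha>] assms that C by (intro mult_left_mono) auto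
    finally have "\<bar>b x\<bar> \<le> \<bar>b 0\<bar> * 1 + C * (1 + x)" by simp
    also have "\<bar>b 0\<bar> * 1 \<le> \<bar>b 0\<bar> * (1 + x)" using that by (intro mult_left_mono) auto
    finally show ?thesis by (simp add: algebra_simps)
  qed
  then show ?thesis using C by (intro exI[of _ "\<bar>b 0\<bar> + C"]) auto
qed

text \<open>A substitute for Jensen's inequality: the rate \<open>h\<^sup>\<alpha>\<close> for the moment of order \<open>2 \<alpha>\<close> follows from the rate \<open>h\<close> for the
  second moment.\<close>

lemma hoelder_squared_le:
  fixes x h :: real
  assumes "0 < \<alpha>" "\<alpha> \<le> 1" "0 < h"
  shows "(\<bar>x\<bar> powr \<alpha>)\<^sup>2 \<le> h powr \<alpha> * (1 + x\<^sup>2 / h)"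
proof -
  have "(\<bar>x\<bar> powr \<alpha>)\<^sup>2 = (\<bar>x\<bar> * \<bar>x\<bar>) powr \<alpha>" by (simp only: power2_eq_square powr_mult)
  also have "\<dots> = (h * (x\<^sup>2 / h)) powr \<alpha>" using assms by (simp add: power2_eq_square)
  also have "\<dots> = h powr \<alpha> * (x\<^sup>2 / h) powr \<alpha>" by (rule powr_mult)
  also have "\<dots> \<le> h powr \<alpha> * (1 + x\<^sup>2 / h)" using assms by (intro mult_left_mono powr_le_one_plus) auto
  finally show ?thesis .
qed

section \<open>Second moments of the increments of the reflected diffusion\<close>

lemma integral_increment_bound:
  fixes f g :: "real \<Rightarrow> real"
  assumes g: "continuous_on {0..T} g" and st: "0 \<le> s" "s \<le> u" "u \<le> T"
    and f: "continuous_on {0..T} f" and le: "\<And>r. r \<in> {0..u} \<Longrightarrow> \<bar>g r\<bar> \<le> f r"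
  shows "\<bar>(LBINT r:{0..u}. g r) - (LBINT r:{0..s}. g r)\<bar> \<le> (LBINT r:{s<..u}. f r)"
proof -
  have int: "set_integrable lborel {0..u} k" if "continuous_on {0..T} k" for k :: "real \<Rightarrow> real"
    by (rule borel_integrable_atLeastAtMost', rule continuous_on_subset[OF that]) (use st in auto)
  have sub: "set_integrable lborel A k" if "continuous_on {0..T} k" "A \<in> sets borel" "A \<subseteq> {0..u}" for k :: "real \<Rightarrow> real" and A
    by (rule set_integrable_subset[OF int[OF that(1)]]) (use that in auto)
  have un: "{0..u} = {0..s} \<union> {s<..u}" using st by auto
  have "(LBINT r:{0..u}. g r) = (LBINT r:{0..s}. g r) + (LBINT r:{s<..u}. g r)"
    unfolding un by (intro set_integral_Un sub[OF g]) (use st in auto)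
  moreover have "\<bar>LBINT r:{s<..u}. g r\<bar> \<le> (LBINT r:{s<..u}. \<bar>g r\<bar>)"
    using set_integral_norm_bound[OF sub[OF g, of "{s<..u}"]] st by (simp add: subset_eq)
  moreover have "(LBINT r:{s<..u}. \<bar>g r\<bar>) \<le> (LBINT r:{s<..u}. f r)"
    by (intro set_integral_mono sub continuous_intros g f) (use st le in auto)
  ultimately show ?thesis by linarith
qed

text \<open>Gronwall's lemma with a non-optimal constant. If \<open>N\<close> is the maximum of \<open>x s / exp (2 c s)\<close>, then inserting
  \<open>x r \<le> N exp (2 c r)\<close> into the integral inequality at the point of the maximum gives \<open>N \<le> a + N / 2\<close>.\<close>

lemma gronwall_weighted_sup:
  fixes x :: "real \<Rightarrow> real"
  assumes cx: "continuous_on {0..T} x" and x0: "\<And>t. t \<in> {0..T} \<Longrightarrow> 0 \<le> x t" and c: "0 < c"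
    and le: "\<And>t. t \<in> {0..T} \<Longrightarrow> x t \<le> a + c * (LBINT r:{0..t}. x r)"
    and t: "t \<in> {0..T}"
  shows "x t \<le> 2 * a * exp (2 * c * T)"
proof -
  let ?e = "\<lambda>r. exp (2 * c * r)"
  have "continuous_on {0..T} (\<lambda>r. x r / ?e r)" by (intro continuous_intros cx) simp
  then obtain s where s: "s \<in> {0..T}" and max: "\<And>r. r \<in> {0..T} \<Longrightarrow> x r / ?e r \<le> x s / ?e s"
    using continuous_attains_sup[of "{0..T}" "\<lambda>r. x r / ?e r"] t by (metis compact_Icc empty_iff)
  define N where "N = x s / ?e s"
  have N: "0 \<le> N" "x s = N * ?e s" using x0[OF s] by (auto simp: N_def)
  have xN: "x r \<le> N * ?e r" if "r \<in> {0..T}" for r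
    using max[OF that] by (simp add: N_def[symmetric] divide_le_eq)
  have int_exp: "(LBINT r:{0..s}. N * ?e r) = N * (?e s - 1) / (2 * c)"
  proof -
    have "(\<integral>r. ?e r * indicator {0..s} r \<partial>lborel) = ?e s / (2 * c) - ?e 0 / (2 * c)"
      by (rule integral_FTC_Icc_real) (use s c in \<open>auto intro!: derivative_eq_intros continuous_intros\<close>)
    then have "(LBINT r:{0..s}. ?e r) = (?e s - 1) / (2 * c)"
      by (simp add: set_lebesgue_integral_def mult.commute diff_divide_distrib)
    then show ?thesis by (simp only: set_integral_mult_right times_divide_eq_right)
  qed
  have "N * ?e s \<le> a + c * (LBINT r:{0..s}. x r)" using le[OF s] N by simp
  also have "(LBINT r:{0..s}. x r) \<le> (LBINT r:{0..s}. N * ?e r)"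
    by (intro set_integral_mono borel_integrable_atLeastAtMost' continuous_intros continuous_on_subset[OF cx])
       (use s xN in auto)
  also have "a + c * (LBINT r:{0..s}. N * ?e r) = a + N * (?e s - 1) / 2" unfolding int_exp using c by simp
  also have "\<dots> \<le> a + N * ?e s / 2" using N by (simp add: right_diff_distrib)
  finally have "N * ?e s \<le> 2 * a" using c by (simp add: mult_left_mono)
  moreover have "N * 1 \<le> N * ?e s" using s c N by (intro mult_left_mono) auto
  ultimately have N2: "N \<le> 2 * a" by simp
  have "x t \<le> N * ?e t" by (rule xN[OF t])
  also have "\<dots> \<le> 2 * a * exp (2 * c * T)"
    using N N2 t c by (intro mult_mono) auto
  finally show ?thesis .
qed

text \<open>Reflection at most doubles the oscillation of the driving path, so the linear growth of the drift gives
  an integral inequality for the path itself, to which Gronwall's lemma applies.\<close>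

lemma reflected_path_bound:
  assumes sk: "skorohod_problem T (\<lambda>t. x0 + (LBINT s:{0..t}. b (x s)) + \<sigma> * w t) x l"
    and b: "continuous_on {0..} b" and K: "0 < K" "\<And>z. 0 \<le> z \<Longrightarrow> \<bar>b z\<bar> \<le> K * (1 + z)"
    and m: "\<And>u. u \<in> {0..T} \<Longrightarrow> \<bar>w u - w 0\<bar> \<le> m"
    and t: "t \<in> {0..T}"
  shows "x t \<le> 2 * (x 0 + 2 * K * T + 2 * \<bar>\<sigma>\<bar> * m) * exp (4 * K * T)"
proof -
  have cx: "continuous_on {0..T} x" and xpos: "\<And>t. t \<in> {0..T} \<Longrightarrow> 0 \<le> x t"
    using sk by (auto simp: skorohod_problem_def)
  have cb: "continuous_on {0..T} (\<lambda>s. b (x s))"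
    by (rule continuous_on_compose2[OF b cx]) (use xpos in auto)
  have "x t \<le> 2 * (x 0 + 2 * K * T + 2 * \<bar>\<sigma>\<bar> * m) * exp (2 * (2 * K) * T)"
  proof (rule gronwall_weighted_sup[OF cx xpos _ _ t])
    fix t assume t: "t \<in> {0..T}"
    have t0: "0 \<le> t" "t \<le> T" using t by auto
    define I where "I = (LBINT r:{0..t}. x r)"
    have inc: "\<bar>(x0 + (LBINT s:{0..u}. b (x s)) + \<sigma> * w u) - (x0 + (LBINT s:{0..0}. b (x s)) + \<sigma> * w 0)\<bar> \<le> K * (T + I) + \<bar>\<sigma>\<bar> * m"
      if u: "u \<in> {0..t}" for u
    proof -
      have "\<bar>(LBINT r:{0..u}. b (x r)) - (LBINT r:{0..0}. b (x r))\<bar> \<le> (LBINT r:{0<..u}. K * (1 + x r))"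
        by (rule integral_increment_bound[OF cb]) (use u t K xpos in \<open>auto intro!: continuous_intros cx\<close>)
      also have "\<dots> \<le> (LBINT r:{0..t}. K * (1 + x r))"
      proof -
        have int: "set_integrable lborel {0..t} (\<lambda>r. K * (1 + x r))"
          by (intro borel_integrable_atLeastAtMost' continuous_intros continuous_on_subset[OF cx]) (use t in auto)
        moreover have "set_integrable lborel {0<..u} (\<lambda>r. K * (1 + x r))"
          by (rule set_integrable_subset[OF int]) (use u in auto)
        ultimately show ?thesis
          unfolding set_lebesgue_integral_def set_integrable_def
          by (intro integral_mono) (use u t K xpos in \<open>auto simp: indicator_def\<close>)
      qed
      also have "\<dots> = K * (LBINT r:{0..t}. 1 + x r)" by simp
      also have "(LBINT r:{0..t}. 1 + x r) = (LBINT r:{0..t}. 1) + I"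
        unfolding I_def
        by (intro set_integral_add borel_integrable_atLeastAtMost' continuous_intros continuous_on_subset[OF cx]) (use t in auto)
      also have "(LBINT r:{0..t}. 1 :: real) = t" using t by (simp add: set_integral_const)
      also have "K * (t + I) \<le> K * (T + I)" using t K by (intro mult_left_mono) auto
      finally have 1: "\<bar>(LBINT r:{0..u}. b (x r)) - (LBINT r:{0..0}. b (x r))\<bar> \<le> K * (T + I)" .
      have 2: "\<bar>\<sigma> * (w u - w 0)\<bar> \<le> \<bar>\<sigma>\<bar> * m" using m[of u] u t by (auto simp: abs_mult intro!: mult_left_mono)
      from 1 2 show ?thesis by (simp add: right_diff_distrib abs_le_iff)
    qed
    have "\<bar>x t - x 0\<bar> \<le> 2 * (K * (T + I) + \<bar>\<sigma>\<bar> * m)"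
      by (rule skorohod_increment_bound[OF sk order_refl t0(1,2) inc])
    then show "x t \<le> (x 0 + 2 * K * T + 2 * \<bar>\<sigma>\<bar> * m) + 2 * K * (LBINT r:{0..t}. x r)"
      by (simp add: I_def algebra_simps abs_le_iff)
  qed (use K in auto)
  then show ?thesis by simp
qed

text \<open>Once the path is bounded by \<open>q\<close>, so is its drift, and the driving path oscillates by at most the drift bound
  times the elapsed time plus the oscillation of the noise.\<close>

lemma reflected_path_increment_bound:
  assumes sk: "skorohod_problem T (\<lambda>t. x0 + (LBINT s:{0..t}. b (x s)) + \<sigma> * w t) x l"
    and b: "continuous_on {0..} b" and K: "0 < K" "\<And>z. 0 \<le> z \<Longrightarrow> \<bar>b z\<bar> \<le> K * (1 + z)"
    and q: "\<And>t. t \<in> {0..T} \<Longrightarrow> x t \<le> q"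
    and st: "0 \<le> s" "s \<le> t" "t \<le> T" and m: "\<And>u. u \<in> {s..t} \<Longrightarrow> \<bar>w u - w s\<bar> \<le> m"
  shows "\<bar>x t - x s\<bar> \<le> 2 * (K * (1 + q) * (t - s) + \<bar>\<sigma>\<bar> * m)"
proof (rule skorohod_increment_bound[OF sk st])
  fix u assume u: "u \<in> {s..t}"
  have cx: "continuous_on {0..T} x" and xpos: "\<And>t. t \<in> {0..T} \<Longrightarrow> 0 \<le> x t"
    using sk by (auto simp: skorohod_problem_def)
  have cb: "continuous_on {0..T} (\<lambda>s. b (x s))"
    by (rule continuous_on_compose2[OF b cx]) (use xpos in auto)
  have le: "\<bar>b (x r)\<bar> \<le> K * (1 + q)" if "r \<in> {0..T}" for r
    by (rule order_trans[OF K(2)[OF xpos[OF that]] mult_left_mono]) (use q[OF that] K(1) in auto)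
  have "0 \<le> K * (1 + q)" using le[of s] st by auto
  have "\<bar>(LBINT r:{0..u}. b (x r)) - (LBINT r:{0..s}. b (x r))\<bar> \<le> (LBINT r:{s<..u}. K * (1 + q))"
    by (rule integral_increment_bound[OF cb]) (use u st le in auto)
  also have "\<dots> = K * (1 + q) * (u - s)" using u by (simp add: set_integral_const)
  also have "\<dots> \<le> K * (1 + q) * (t - s)" using u \<open>0 \<le> K * (1 + q)\<close> by (intro mult_left_mono) auto
  finally have 1: "\<bar>(LBINT r:{0..u}. b (x r)) - (LBINT r:{0..s}. b (x r))\<bar> \<le> K * (1 + q) * (t - s)" .
  have 2: "\<bar>\<sigma> * (w u - w s)\<bar> \<le> \<bar>\<sigma>\<bar> * m" using m[OF u] by (auto simp: abs_mult intro!: mult_left_mono)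
  from 1 2 show "\<bar>(x0 + (LBINT s:{0..u}. b (x s)) + \<sigma> * w u) - (x0 + (LBINT r:{0..s}. b (x r)) + \<sigma> * w s)\<bar>
      \<le> K * (1 + q) * (t - s) + \<bar>\<sigma>\<bar> * m"
    by (simp add: right_diff_distrib abs_le_iff)
qed

lemma sum_squared_le: "(x + y)\<^sup>2 \<le> 2 * x\<^sup>2 + 2 * (y :: real)\<^sup>2"
  using zero_le_power2[of "x - y"] by (simp add: power2_eq_square algebra_simps)

text \<open>The constants \<open>p\<close> and \<open>r\<close> come from the Gronwall bound \<open>1 + x t \<le> p + r sqrt m0\<close>, where \<open>m0\<close> bounds the squared
  increments of the noise on the whole interval and \<open>m\<close> those on \<open>[s,t]\<close>.\<close>

lemma reflected_increment_squared_bound: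
  fixes x0 K T \<sigma> :: real
  defines "p \<equiv> 1 + 2 * (x0 + 2 * K * T) * exp (4 * K * T)" and "r \<equiv> 4 * \<bar>\<sigma>\<bar> * exp (4 * K * T)"
  assumes sk: "skorohod_problem T (\<lambda>t. x0 + (LBINT s:{0..t}. b (x s)) + \<sigma> * w t) x l"
    and "x 0 = x0"
    and b: "continuous_on {0..} b" and K: "0 < K" "\<And>z. 0 \<le> z \<Longrightarrow> \<bar>b z\<bar> \<le> K * (1 + z)"
    and st: "0 \<le> s" "s \<le> t" "t \<le> T"
    and m0: "\<And>u. u \<in> {0..T} \<Longrightarrow> (w u - w 0)\<^sup>2 \<le> m0" and m: "\<And>u. u \<in> {s..t} \<Longrightarrow> (w u - w s)\<^sup>2 \<le> m"
  shows "(x t - x s)\<^sup>2 \<le> 16 * K\<^sup>2 * (p\<^sup>2 + r\<^sup>2) * (t - s)\<^sup>2 * (1 + m0) + 8 * \<sigma>\<^sup>2 * m"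
proof -
  have T: "0 \<le> T" using st by simp
  have nn: "0 \<le> m0" "0 \<le> m" using m0[of 0] m[of s] T st by auto
  have m0': "\<bar>w u - w 0\<bar> \<le> sqrt m0" if "u \<in> {0..T}" for u using m0[OF that] by (rule real_le_rsqrt[of "\<bar>_\<bar>", simplified])
  have m': "\<bar>w u - w s\<bar> \<le> sqrt m" if "u \<in> {s..t}" for u using m[OF that] by (rule real_le_rsqrt[of "\<bar>_\<bar>", simplified])
  define q where "q = 2 * (x 0 + 2 * K * T + 2 * \<bar>\<sigma>\<bar> * sqrt m0) * exp (4 * K * T)"
  have q: "x t \<le> q" if "t \<in> {0..T}" for t
    unfolding q_def by (rule reflected_path_bound[OF sk b K m0' that])
  have q_eq: "1 + q = p + r * sqrt m0" using \<open>x 0 = x0\<close> by (simp add: q_def p_def r_def algebra_simps)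
  have "(1 + q)\<^sup>2 \<le> 2 * p\<^sup>2 + 2 * (r * sqrt m0)\<^sup>2" unfolding q_eq by (rule sum_squared_le)
  also have "\<dots> = 2 * p\<^sup>2 + 2 * r\<^sup>2 * m0" using nn by (simp add: power_mult_distrib)
  also have "\<dots> \<le> 2 * (p\<^sup>2 + r\<^sup>2) * (1 + m0)"
    using nn by (simp add: algebra_simps add_increasing)
  finally have q2: "(1 + q)\<^sup>2 \<le> 2 * (p\<^sup>2 + r\<^sup>2) * (1 + m0)" .
  have "\<bar>x t - x s\<bar> \<le> 2 * (K * (1 + q) * (t - s) + \<bar>\<sigma>\<bar> * sqrt m)"
    by (rule reflected_path_increment_bound[OF sk b K q st m'])
  then have "(x t - x s)\<^sup>2 \<le> (2 * (K * (1 + q) * (t - s) + \<bar>\<sigma>\<bar> * sqrt m))\<^sup>2"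
    by (intro abs_le_square_iff[THEN iffD1]) simp
  also have "\<dots> = 4 * (K * (1 + q) * (t - s) + \<bar>\<sigma>\<bar> * sqrt m)\<^sup>2" by (subst power_mult_distrib) simp
  also have "\<dots> \<le> 4 * (2 * (K * (1 + q) * (t - s))\<^sup>2 + 2 * (\<bar>\<sigma>\<bar> * sqrt m)\<^sup>2)"
    by (intro mult_left_mono sum_squared_le) auto
  also have "\<dots> = 8 * K\<^sup>2 * (t - s)\<^sup>2 * (1 + q)\<^sup>2 + 8 * \<sigma>\<^sup>2 * m" using nn by (simp add: power_mult_distrib)
  also have "8 * K\<^sup>2 * (t - s)\<^sup>2 * (1 + q)\<^sup>2 \<le> 16 * K\<^sup>2 * (p\<^sup>2 + r\<^sup>2) * (t - s)\<^sup>2 * (1 + m0)"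
  proof -
    have "8 * K\<^sup>2 * (t - s)\<^sup>2 * (1 + q)\<^sup>2 \<le> 8 * K\<^sup>2 * (t - s)\<^sup>2 * (2 * (p\<^sup>2 + r\<^sup>2) * (1 + m0))"
      by (intro mult_left_mono q2) auto
    then show ?thesis by (simp add: algebra_simps)
  qed
  finally show ?thesis by simp
qed

text \<open>The drift contributes the order \<open>(t - s)\<^sup>2\<close> and the noise the order \<open>t - s\<close> to the second moment.\<close>

lemma reflected_sde_increment_moment:
  assumes fps: "filtered_prob_space M F" and bm: "brownian_motion M F T W"
    and sde: "reflected_sde M F T x0 b \<sigma> W X L" and T: "0 < T" and \<sigma>: "\<sigma> \<noteq> 0"
    and b: "continuous_on {0..} b" and K: "0 < K" "\<And>z. 0 \<le> z \<Longrightarrow> \<bar>b z\<bar> \<le> K * (1 + z)"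
  shows "\<exists>C\<ge>0. \<forall>s t. 0 \<le> s \<longrightarrow> s \<le> t \<longrightarrow> t \<le> T \<longrightarrow> t - s \<le> 1 \<longrightarrow>
    integrable M (\<lambda>\<omega>. (X t \<omega> - X s \<omega>)\<^sup>2) \<and> (\<integral>\<omega>. (X t \<omega> - X s \<omega>)\<^sup>2 \<partial>M) \<le> C * (t - s)"
proof -
  interpret filtered_prob_space M F by fact
  define p r where "p = 1 + 2 * (x0 + 2 * K * T) * exp (4 * K * T)" and "r = 4 * \<bar>\<sigma>\<bar> * exp (4 * K * T)"
  define c1 c2 where "c1 = 16 * K\<^sup>2 * (p\<^sup>2 + r\<^sup>2)" and "c2 = 8 * \<sigma>\<^sup>2"
  define C where "C = c1 * (1 + 8 * T) + 8 * c2"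
  have r: "0 < r" using \<sigma> by (simp add: r_def)
  have c: "0 < c1" "0 < c2" using K \<sigma> r by (auto simp: c1_def c2_def intro!: mult_pos_pos add_nonneg_pos)
  have X_meas [measurable]: "X u \<in> borel_measurable M" if "u \<in> {0..T}" for u
    using sde that by (intro measurable_from_subalg[OF subalgebra_F]) (auto simp: reflected_sde_def adapted_def)
  have sk: "AE \<omega> in M. skorohod_problem T (\<lambda>t. x0 + (LBINT s:{0..t}. b (X s \<omega>)) + \<sigma> * W t \<omega>) (\<lambda>t. X t \<omega>) (\<lambda>t. L t \<omega>)"
    using sde by (auto simp: reflected_sde_def)
  have W0: "AE \<omega> in M. W 0 \<omega> = 0" using bm by (simp add: brownian_motion_def)
  obtain R0 where R0 [measurable]: "R0 \<in> borel_measurable M" and R0_int: "(\<integral>\<^sup>+\<omega>. R0 \<omega> \<partial>M) \<le> ennreal (8 * T)"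
    and R0_le: "\<And>\<omega> u. \<omega> \<in> space M \<Longrightarrow> u \<in> {0..T} \<Longrightarrow> ennreal ((W u \<omega> - W 0 \<omega>)\<^sup>2) \<le> R0 \<omega>"
    using brownian_motion_maximal_inequality[OF fps bm order_refl, of T] T by auto
  have main: "(\<integral>\<^sup>+\<omega>. ennreal ((X t \<omega> - X s \<omega>)\<^sup>2) \<partial>M) \<le> ennreal (C * (t - s))"
    if st: "0 \<le> s" "s \<le> t" "t \<le> T" "t - s \<le> 1" for s t
  proof (cases "s = t")
    case False
    obtain R where R [measurable]: "R \<in> borel_measurable M" and R_int: "(\<integral>\<^sup>+\<omega>. R \<omega> \<partial>M) \<le> ennreal (8 * (t - s))"
      and R_le: "\<And>\<omega> u. \<omega> \<in> space M \<Longrightarrow> u \<in> {s..t} \<Longrightarrow> ennreal ((W u \<omega> - W s \<omega>)\<^sup>2) \<le> R \<omega>"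
      using brownian_motion_maximal_inequality[OF fps bm st(1-3)] by auto
    define c where "c = c1 * (t - s)\<^sup>2"
    have cpos: "0 < c" using c False st by (simp add: c_def)
    have "AE \<omega> in M. ennreal ((X t \<omega> - X s \<omega>)\<^sup>2) \<le> ennreal c * (1 + R0 \<omega>) + ennreal c2 * R \<omega>"
      using sk W0 AE_space
    proof eventually_elim
      case (elim \<omega>)
      show ?case
      \<comment> \<open>where a majorant is infinite the bound is trivial, since both coefficients are positive\<close>
      proof (cases "R0 \<omega> = \<top> \<or> R \<omega> = \<top>")
        case True
        then show ?thesis using cpos c by (auto simp: ennreal_mult_eq_top_iff)
      next
        case fin: False
        define m0 m where "m0 = enn2real (R0 \<omega>)" and "m = enn2real (R \<omega>)"
        have m: "R0 \<omega> = ennreal m0" "R \<omega> = ennreal m" "0 \<le> m0" "0 \<le> m"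
          using fin by (auto simp: m0_def m_def less_top)
        have "X 0 \<omega> = x0"
          using skorohod_initial_value[OF elim(1)] T elim(2) lebesgue_integral_singleton_zero[of 0 "\<lambda>s. b (X s \<omega>)"] by simp
        then have "(X t \<omega> - X s \<omega>)\<^sup>2 \<le> 16 * K\<^sup>2 * (p\<^sup>2 + r\<^sup>2) * (t - s)\<^sup>2 * (1 + m0) + 8 * \<sigma>\<^sup>2 * m"
          unfolding p_def r_def
          by (intro reflected_increment_squared_bound[OF elim(1) _ b K st(1-3)])
             (use R0_le[OF elim(3)] R_le[OF elim(3)] m in auto)
        then have "(X t \<omega> - X s \<omega>)\<^sup>2 \<le> c * (1 + m0) + c2 * m" by (simp add: c_def c1_def c2_def)
        then have "ennreal ((X t \<omega> - X s \<omega>)\<^sup>2) \<le> ennreal (c * (1 + m0) + c2 * m)" by (rule ennreal_leI)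
        also have "\<dots> = ennreal c * (1 + R0 \<omega>) + ennreal c2 * R \<omega>"
          using m cpos c by (simp add: ennreal_mult)
        finally show ?thesis .
      qed
    qed
    then have "(\<integral>\<^sup>+\<omega>. ennreal ((X t \<omega> - X s \<omega>)\<^sup>2) \<partial>M) \<le> (\<integral>\<^sup>+\<omega>. ennreal c * (1 + R0 \<omega>) + ennreal c2 * R \<omega> \<partial>M)"
      by (rule nn_integral_mono_AE)
    also have "\<dots> = ennreal c * (1 + (\<integral>\<^sup>+\<omega>. R0 \<omega> \<partial>M)) + ennreal c2 * (\<integral>\<^sup>+\<omega>. R \<omega> \<partial>M)"
      by (simp add: nn_integral_add nn_integral_cmult emeasure_space_1)
    also have "\<dots> \<le> ennreal c * (1 + ennreal (8 * T)) + ennreal c2 * ennreal (8 * (t - s))"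
      by (intro add_mono mult_left_mono R0_int R_int) auto
    also have "\<dots> = ennreal (c * (1 + 8 * T) + c2 * (8 * (t - s)))"
      using cpos c T st by (simp add: ennreal_mult)
    also have "\<dots> \<le> ennreal (C * (t - s))"
    proof (rule ennreal_leI)
      \<comment> \<open>this is where \<open>t - s \<le> 1\<close> enters\<close>
      have "(t - s)\<^sup>2 \<le> t - s" using st by (simp add: power2_eq_square mult_left_le)
      then have "c * (1 + 8 * T) \<le> c1 * (t - s) * (1 + 8 * T)"
        using c T unfolding c_def by (intro mult_right_mono mult_left_mono) auto
      then show "c * (1 + 8 * T) + c2 * (8 * (t - s)) \<le> C * (t - s)" by (simp add: C_def algebra_simps)
    qed
    finally show ?thesis .
  qed simp
  have C: "0 \<le> C" using c T by (auto simp: C_def)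
  show ?thesis
  proof (intro exI[of _ C] conjI allI impI C)
    fix s t assume st: "0 \<le> s" "s \<le> t" "t \<le> T" "t - s \<le> 1"
    have [measurable]: "X s \<in> borel_measurable M" "X t \<in> borel_measurable M" using st by (auto intro!: X_meas)
    show int: "integrable M (\<lambda>\<omega>. (X t \<omega> - X s \<omega>)\<^sup>2)"
      by (rule integrableI_nonneg) (use main[OF st] in \<open>auto simp: top.not_eq_extremum[symmetric] top_unique\<close>)
    have "ennreal (\<integral>\<omega>. (X t \<omega> - X s \<omega>)\<^sup>2 \<partial>M) \<le> ennreal (C * (t - s))"
      using main[OF st] by (subst (asm) nn_integral_eq_integral[OF int]) auto
    then show "(\<integral>\<omega>. (X t \<omega> - X s \<omega>)\<^sup>2 \<partial>M) \<le> C * (t - s)"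
      using C st by (subst (asm) ennreal_le_iff) auto
  qed
qed

section \<open>The rate of convergence\<close>

text \<open>The path \<open>X\<close> is the Euler functional of \<open>V = W + \<integral>\<beta>\<close>, and \<open>X\<^sup>h\<close> is the Euler functional of \<open>W\<close>. Every event
  about the paths is therefore an event about the driving paths, whose laws have been compared.\<close>

lemma euler_scheme_law_le:
  assumes fps: "filtered_prob_space M F" and bm: "brownian_motion M F T W"
    and T: "0 < T" and \<sigma>: "\<sigma> \<noteq> 0" and h: "0 < h"
    and sde: "reflected_sde M F T x0 b \<sigma> W X L"
    and em: "euler_maruyama M F T x0 b \<sigma> W h Xh Lh"
    and b: "continuous_on {0..} b"
    and drift_int: "\<And>t. t \<in> {0..T} \<Longrightarrow> integrable M (\<lambda>\<omega>. (b (X t \<omega>) - b (X (euler_grid h t) \<omega>))\<^sup>2)"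
    and drift_le: "\<And>t. t \<in> {0..T} \<Longrightarrow> (\<integral>\<omega>. (b (X t \<omega>) - b (X (euler_grid h t) \<omega>))\<^sup>2 \<partial>M) \<le> \<sigma>\<^sup>2 * \<kappa>"
    and \<epsilon>: "0 < \<epsilon>" and A: "A \<in> sets (path_space T)"
  shows "measure (distr M (path_space T) (path_of T X)) A
    \<le> measure (distr M (path_space T) (path_of T Xh)) A + (\<epsilon> + T * \<kappa> / (2 * \<epsilon>))"
proof -
  interpret filtered_prob_space M F by fact
  obtain d :: "nat \<Rightarrow> real" where d: "range d \<subseteq> {0..T}" "{0..T} \<subseteq> closure (range d)"
    and grid: "\<And>k. real k * h \<le> T \<Longrightarrow> real k * h \<in> range d"
    using dense_times_with_grid[OF T h] by blast
  obtain B where B: "B \<in> sets (borel :: (nat \<Rightarrow> real) measure)"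
    and A_eq: "A = {p \<in> space (path_space T). (\<lambda>n. p (d n)) \<in> B}"
    using path_space_generated_by_dense_times[OF T d A] by blast
  have dn: "d n \<in> {0..T}" for n using d by blast
  have X_adapted: "X t \<in> borel_measurable (F t)" if "t \<in> {0..T}" for t
    using sde that by (auto simp: reflected_sde_def adapted_def)
  have X_cont: "continuous_on {0..T} (\<lambda>t. X t \<omega>)" and X_nonneg: "\<And>t. t \<in> {0..T} \<Longrightarrow> 0 \<le> X t \<omega>" if "\<omega> \<in> space M" for \<omega>
    using sde that by (auto simp: reflected_sde_def)
  have Xh_adapted: "Xh t \<in> borel_measurable (F t)" if "t \<in> {0..T}" for t
    using em that by (auto simp: euler_maruyama_def adapted_def)
  have Xh_cont: "continuous_on {0..T} (\<lambda>t. Xh t \<omega>)" if "\<omega> \<in> space M" for \<omega>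
    using em that by (auto simp: euler_maruyama_def)
  have X_meas: "X t \<in> borel_measurable M" and Xh_meas: "Xh t \<in> borel_measurable M" if "t \<in> {0..T}" for t
    using measurable_from_subalg[OF subalgebra_F] X_adapted[OF that] Xh_adapted[OF that] by auto
  have b': "(\<lambda>x. b (max 0 x)) \<in> borel_measurable borel"
    by (intro borel_measurable_continuous_onI continuous_on_compose2[OF b] continuous_intros) auto
  have eg: "euler_grid h t \<in> {0..T}" "euler_grid h t \<le> t" if "t \<in> {0..T}" for t
    using euler_grid_bounds[OF h, of t] that by auto
  define \<beta> where "\<beta> t \<omega> = (b (X t \<omega>) - b (X (euler_grid h t) \<omega>)) / \<sigma>" for t \<omega>
  have bX_cont: "continuous_on {0..T} (\<lambda>t. b (X t \<omega>))" if "\<omega> \<in> space M" for \<omega>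
    by (rule continuous_on_compose2[OF b X_cont[OF that]]) (use X_nonneg[OF that] in auto)
  have bX_bdd: "\<exists>B. \<forall>t\<in>{0..T}. \<bar>b (X t \<omega>)\<bar> \<le> B" if "\<omega> \<in> space M" for \<omega>
  proof -
    have "bounded ((\<lambda>t. b (X t \<omega>)) ` {0..T})"
      by (intro compact_imp_bounded compact_continuous_image bX_cont that) auto
    then show ?thesis unfolding bounded_iff by auto
  qed
  have \<beta>_adapted: "\<beta> t \<in> borel_measurable (F t)" if t: "t \<in> {0..T}" for t
  proof -
    have "X (euler_grid h t) \<in> borel_measurable (F t)"
    proof (rule measurable_from_subalg[OF _ X_adapted])
      show "subalgebra (F t) (F (euler_grid h t))"
        using sets_F_mono[OF eg(2)[OF t]] by (simp add: subalgebra_def space_F)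
    qed (rule eg[OF t])
    note [measurable] = measurable_compose[OF this b'] measurable_compose[OF X_adapted[OF t] b']
    have "(\<lambda>\<omega>. (b (max 0 (X t \<omega>)) - b (max 0 (X (euler_grid h t) \<omega>))) / \<sigma>) \<in> borel_measurable (F t)"
      by measurable
    then show ?thesis
      by (rule measurable_cong[THEN iffD1, rotated])
         (use X_nonneg t eg[OF t] in \<open>auto simp: \<beta>_def space_F\<close>)
  qed
  have \<beta>_sq: "(\<beta> t \<omega>)\<^sup>2 = (b (X t \<omega>) - b (X (euler_grid h t) \<omega>))\<^sup>2 / \<sigma>\<^sup>2" for t \<omega>
    by (simp add: \<beta>_def power_divide)
  have \<beta>_int: "integrable M (\<lambda>\<omega>. (\<beta> t \<omega>)\<^sup>2)" "(\<integral>\<omega>. (\<beta> t \<omega>)\<^sup>2 \<partial>M) \<le> \<kappa>" if "t \<in> {0..T}" for t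
    using drift_int[OF that] drift_le[OF that] \<sigma> by (simp_all add: \<beta>_sq pos_divide_le_eq mult.commute)
  have \<beta>_bdd: "\<exists>B. \<forall>s\<in>{0..T}. \<bar>\<beta> s \<omega>\<bar> \<le> B" if \<omega>: "\<omega> \<in> space M" for \<omega>
  proof -
    obtain B where B: "\<And>t. t \<in> {0..T} \<Longrightarrow> \<bar>b (X t \<omega>)\<bar> \<le> B" using bX_bdd[OF \<omega>] by blast
    have "\<bar>\<beta> s \<omega>\<bar> \<le> 2 * B / \<bar>\<sigma>\<bar>" if "s \<in> {0..T}" for s
      using B[OF that] B[OF eg(1)[OF that]] by (auto simp: \<beta>_def intro!: divide_right_mono)
    then show ?thesis by blast
  qed
  have \<beta>_meas: "(\<lambda>s. indicator {0..T} s * \<beta> s \<omega>) \<in> borel_measurable borel" if \<omega>: "\<omega> \<in> space M" for \<omega>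
  proof -
    have [measurable]: "(\<lambda>s. indicator {0..T} s * b (X s \<omega>)) \<in> borel_measurable borel"
      using borel_measurable_continuous_on_indicator[OF _ bX_cont[OF \<omega>]] by simp
    have [measurable]: "(\<lambda>s. b (X (euler_grid h s) \<omega>)) \<in> borel_measurable borel"
      by (rule borel_measurable_euler_grid[of "\<lambda>s. b (X s \<omega>)"])
    have eq: "(\<lambda>s. indicator {0..T} s * \<beta> s \<omega>) =
        (\<lambda>s. (indicator {0..T} s * b (X s \<omega>) - indicator {0..T} s * b (X (euler_grid h s) \<omega>)) / \<sigma>)"
      by (auto simp: \<beta>_def indicator_def)
    show ?thesis unfolding eq by measurable
  qed
  have \<beta>_cont: "continuous (at s within {0..T}) (\<lambda>s. \<beta> s \<omega>)"
    if "\<omega> \<in> space M" "s \<in> {0..T} - range (\<lambda>k::nat. real k * h)" for \<omega> s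
    unfolding \<beta>_def
  proof (intro continuous_divide continuous_diff continuous_const \<sigma>)
    show "continuous (at s within {0..T}) (\<lambda>s. b (X s \<omega>))"
      using bX_cont[OF that(1)] that(2) by (auto simp: continuous_on_eq_continuous_within)
    show "continuous (at s within {0..T}) (\<lambda>s. b (X (euler_grid h s) \<omega>))"
      using that(2) by (intro continuous_euler_grid_off_grid[where g="\<lambda>s. b (X s \<omega>)"] h) auto
  qed
  define V where "V \<omega> m = W (d m) \<omega> - W 0 \<omega> + (LBINT s:{0..d m}. \<beta> s \<omega>)" for \<omega> m
  define U where "U \<omega> m = W (d m) \<omega> - W 0 \<omega>" for \<omega> m
  let ?\<Psi> = "euler_functional b \<sigma> h d x0"
  have \<Psi>: "?\<Psi> \<in> borel_measurable borel" by (rule borel_measurable_euler_functional[OF b'])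
  then have \<Psi>B: "?\<Psi> -` B \<in> sets borel" using measurable_sets[OF \<Psi> B] by simp
  have grid_countable: "countable (range (\<lambda>k::nat. real k * h))" by simp
  note law_le = drifted_brownian_motion_law_le[OF fps bm T \<beta>_adapted \<beta>_int \<beta>_bdd \<beta>_meas grid_countable \<beta>_cont d(1) \<epsilon> \<Psi>B,
      folded V_def[abs_def] U_def[abs_def]]
  have tv: "V \<in> borel_measurable M" "U \<in> borel_measurable M"
      "measure (distr M borel V) (?\<Psi> -` B) \<le> measure (distr M borel U) (?\<Psi> -` B) + (\<epsilon> + T * \<kappa> / (2 * \<epsilon>))"
    by ((rule law_le; assumption)+)
  have W0: "AE \<omega> in M. W 0 \<omega> = 0" using bm by (simp add: brownian_motion_def)
  have X_eq: "AE \<omega> in M. (\<lambda>n. X (d n) \<omega>) = ?\<Psi> (V \<omega>)"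
  proof -
    have "AE \<omega> in M. skorohod_problem T (\<lambda>t. x0 + (LBINT s:{0..t}. b (X s \<omega>)) + \<sigma> * W t \<omega>) (\<lambda>t. X t \<omega>) (\<lambda>t. L t \<omega>)"
      using sde by (auto simp: reflected_sde_def)
    then show ?thesis using W0 AE_space
    proof eventually_elim
      case (elim \<omega>)
      obtain C where C: "\<And>t. t \<in> {0..T} \<Longrightarrow> \<bar>b (X t \<omega>)\<bar> \<le> C" using bX_bdd[OF elim(3)] by blast
      define w where "w t = W t \<omega> - W 0 \<omega> + (LBINT s:{0..t}. \<beta> s \<omega>)" for t
      \<comment> \<open>the equation for \<open>X\<close>, rewritten as the Euler scheme with driving path \<open>w\<close>\<close>
      have drive: "x0 + (LBINT s:{0..t}. b (X s \<omega>)) + \<sigma> * W t \<omega>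
          = x0 + (LBINT s:{0..t}. b (X (euler_grid h s) \<omega>)) + \<sigma> * w t" if t: "t \<in> {0..T}" for t
      proof -
        have 1: "set_integrable lborel {0..t} (\<lambda>s. b (X s \<omega>))"
          by (intro borel_integrable_atLeastAtMost' continuous_on_subset[OF bX_cont[OF elim(3)]]) (use t in auto)
        have 2: "set_integrable lborel {0..t} (\<lambda>s. b (X (euler_grid h s) \<omega>))"
          by (rule set_integrable_euler_grid[where g="\<lambda>s. b (X s \<omega>)", OF h C]) (use t in auto)
        have "(LBINT s:{0..t}. \<beta> s \<omega>) = ((LBINT s:{0..t}. b (X s \<omega>)) - (LBINT s:{0..t}. b (X (euler_grid h s) \<omega>))) / \<sigma>"
          unfolding \<beta>_def using 1 2 by simp
        then show ?thesis using \<sigma> elim(2) by (simp add: w_def field_simps)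
      qed
      have "w 0 = 0" using lebesgue_integral_singleton_zero[of 0 "\<lambda>s. \<beta> s \<omega>"] by (simp add: w_def)
      have "skorohod_problem T (\<lambda>t. x0 + (LBINT s:{0..t}. b (X (euler_grid h s) \<omega>)) + \<sigma> * w t) (\<lambda>t. X t \<omega>) (\<lambda>t. L t \<omega>)"
        using elim(1) skorohod_problem_cong[OF drive] by simp
      from euler_functional_correct[where x="\<lambda>t. X t \<omega>", OF h d grid b \<open>w 0 = 0\<close> less_imp_le[OF T] this]
      show ?case by (simp add: V_def[abs_def] w_def)
    qed
  qed
  have Xh_eq: "AE \<omega> in M. (\<lambda>n. Xh (d n) \<omega>) = ?\<Psi> (U \<omega>)"
  proof -
    have "AE \<omega> in M. skorohod_problem T (\<lambda>t. x0 + (LBINT s:{0..t}. b (Xh (euler_grid h s) \<omega>)) + \<sigma> * W t \<omega>) (\<lambda>t. Xh t \<omega>) (\<lambda>t. Lh t \<omega>)"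
      using em by (auto simp: euler_maruyama_def)
    then show ?thesis using W0
    proof eventually_elim
      case (elim \<omega>)
      from euler_functional_correct[where x="\<lambda>t. Xh t \<omega>" and w="\<lambda>t. W t \<omega>", OF h d grid b elim(2) less_imp_le[OF T] elim(1)]
      show ?case using elim(2) by (simp add: U_def[abs_def])
    qed
  qed
  have law: "measure (distr M (path_space T) (path_of T Y)) A = measure (distr M borel Z) (?\<Psi> -` B)"
    if Y: "\<And>t. t \<in> {0..T} \<Longrightarrow> Y t \<in> borel_measurable M" "\<And>\<omega>. \<omega> \<in> space M \<Longrightarrow> continuous_on {0..T} (\<lambda>t. Y t \<omega>)"
      and Z: "Z \<in> borel_measurable M" and eq: "AE \<omega> in M. (\<lambda>n. Y (d n) \<omega>) = ?\<Psi> (Z \<omega>)" for Y Z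
  proof -
    have P: "path_of T Y \<in> measurable M (path_space T)" by (rule measurable_path_of[OF T Y])
    have "measure (distr M (path_space T) (path_of T Y)) A = measure M (path_of T Y -` A \<inter> space M)"
      by (rule measure_distr[OF P A])
    also have "\<dots> = measure M (Z -` (?\<Psi> -` B) \<inter> space M)"
    proof (rule finite_measure_eq_AE)
      show "AE \<omega> in M. \<omega> \<in> path_of T Y -` A \<inter> space M \<longleftrightarrow> \<omega> \<in> Z -` (?\<Psi> -` B) \<inter> space M"
        using eq AE_space
      proof eventually_elim
        case (elim \<omega>)
        then show ?case using path_of_mem_iff[where X=Y, OF T d(1) Y(2)] by (auto simp: A_eq)
      qed
    qed (use measurable_sets[OF P A] measurable_sets[OF Z \<Psi>B] in auto)
    also have "\<dots> = measure (distr M borel Z) (?\<Psi> -` B)" by (rule measure_distr[OF Z \<Psi>B, symmetric])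
    finally show ?thesis .
  qed
  have "measure (distr M (path_space T) (path_of T X)) A = measure (distr M borel V) (?\<Psi> -` B)"
    by (rule law[OF _ _ tv(1) X_eq]) (fact X_meas X_cont)+
  moreover have "measure (distr M (path_space T) (path_of T Xh)) A = measure (distr M borel U) (?\<Psi> -` B)"
    by (rule law[OF _ _ tv(2) Xh_eq]) (fact Xh_meas Xh_cont)+
  ultimately show ?thesis using tv(3) by simp
qed

lemma euler_drift_error_moment:
  assumes fps: "filtered_prob_space M F" and bm: "brownian_motion M F T W"
    and sde: "reflected_sde M F T x0 b \<sigma> W X L" and T: "0 < T" and \<sigma>: "\<sigma> \<noteq> 0"
    and \<alpha>: "0 < \<alpha>" "\<alpha> \<le> 1" and hoelder: "hoelder_continuous \<alpha> b"
  shows "\<exists>C\<ge>0. \<forall>(h::real) t. 0 < h \<longrightarrow> h \<le> 1 \<longrightarrow> t \<in> {0..T} \<longrightarrow>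
    integrable M (\<lambda>\<omega>. (b (X t \<omega>) - b (X (euler_grid h t) \<omega>))\<^sup>2) \<and>
    (\<integral>\<omega>. (b (X t \<omega>) - b (X (euler_grid h t) \<omega>))\<^sup>2 \<partial>M) \<le> C * h powr \<alpha>"
proof -
  interpret filtered_prob_space M F by fact
  have b: "continuous_on {0..} b" by (rule hoelder_continuous_imp_continuous_on[OF hoelder \<alpha>(1)])
  obtain K where K: "0 < K" "\<And>z. 0 \<le> z \<Longrightarrow> \<bar>b z\<bar> \<le> K * (1 + z)"
    using hoelder_continuous_linear_growth[OF hoelder \<alpha>] by blast
  obtain C where C: "0 \<le> C" and mom: "\<And>s t. 0 \<le> s \<Longrightarrow> s \<le> t \<Longrightarrow> t \<le> T \<Longrightarrow> t - s \<le> 1 \<Longrightarrow>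
      integrable M (\<lambda>\<omega>. (X t \<omega> - X s \<omega>)\<^sup>2) \<and> (\<integral>\<omega>. (X t \<omega> - X s \<omega>)\<^sup>2 \<partial>M) \<le> C * (t - s)"
    using reflected_sde_increment_moment[OF fps bm sde T \<sigma> b K] by blast
  obtain H where H: "0 < H" "\<And>x y. 0 \<le> x \<Longrightarrow> 0 \<le> y \<Longrightarrow> \<bar>b x - b y\<bar> \<le> H * \<bar>x - y\<bar> powr \<alpha>"
    using hoelder by (auto simp: hoelder_continuous_def)
  have X_nonneg: "0 \<le> X t \<omega>" if "\<omega> \<in> space M" "t \<in> {0..T}" for \<omega> t
    using sde that by (auto simp: reflected_sde_def)
  have X_meas: "X t \<in> borel_measurable M" if "t \<in> {0..T}" for t
    using sde that by (intro measurable_from_subalg[OF subalgebra_F]) (auto simp: reflected_sde_def adapted_def)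
  have b': "(\<lambda>x. b (max 0 x)) \<in> borel_measurable borel"
    by (intro borel_measurable_continuous_onI continuous_on_compose2[OF b] continuous_intros) auto
  show ?thesis
  proof (intro exI[of _ "H\<^sup>2 * (1 + C)"] conjI allI impI)
    show "0 \<le> H\<^sup>2 * (1 + C)" using C by simp
    fix h t :: real assume h: "0 < h" "h \<le> 1" and t: "t \<in> {0..T}"
    let ?s = "euler_grid h t"
    have s: "0 \<le> ?s" "?s \<le> t" "t \<le> T" "t - ?s \<le> h" "t - ?s \<le> 1" "?s \<in> {0..T}"
      using euler_grid_bounds[OF h(1), of t] t h by auto
    define D where "D \<omega> = H\<^sup>2 * (h powr \<alpha> * (1 + (X t \<omega> - X ?s \<omega>)\<^sup>2 / h))" for \<omega>
    have le: "(b (X t \<omega>) - b (X ?s \<omega>))\<^sup>2 \<le> D \<omega>" if "\<omega> \<in> space M" for \<omega>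
    proof -
      have "\<bar>b (X t \<omega>) - b (X ?s \<omega>)\<bar> \<le> \<bar>H * \<bar>X t \<omega> - X ?s \<omega>\<bar> powr \<alpha>\<bar>"
        using H(2)[OF X_nonneg[OF that t] X_nonneg[OF that s(6)]] by (rule order_trans) simp
      then have "(b (X t \<omega>) - b (X ?s \<omega>))\<^sup>2 \<le> (H * \<bar>X t \<omega> - X ?s \<omega>\<bar> powr \<alpha>)\<^sup>2"
        by (simp only: abs_le_square_iff)
      also have "\<dots> \<le> D \<omega>"
        unfolding D_def power_mult_distrib by (intro mult_left_mono hoelder_squared_le \<alpha> h) simp
      finally show ?thesis .
    qed
    have D: "integrable M D" "expectation D = H\<^sup>2 * (h powr \<alpha> * (1 + expectation (\<lambda>\<omega>. (X t \<omega> - X ?s \<omega>)\<^sup>2) / h))"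
      unfolding D_def using mom[OF s(1-3,5)] by (simp_all add: prob_space)
    have "(\<lambda>\<omega>. (b (max 0 (X t \<omega>)) - b (max 0 (X ?s \<omega>)))\<^sup>2) \<in> borel_measurable M"
      using measurable_compose[OF X_meas[OF t] b'] measurable_compose[OF X_meas[OF s(6)] b'] by simp
    then have meas: "(\<lambda>\<omega>. (b (X t \<omega>) - b (X ?s \<omega>))\<^sup>2) \<in> borel_measurable M"
      by (rule measurable_cong[THEN iffD1, rotated]) (use X_nonneg t s in auto)
    show int: "integrable M (\<lambda>\<omega>. (b (X t \<omega>) - b (X ?s \<omega>))\<^sup>2)"
      by (rule Bochner_Integration.integrable_bound[OF D(1) meas])
         (use le in \<open>auto intro!: AE_I2 intro: order_trans[OF _ abs_ge_self]\<close>)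
    have "expectation (\<lambda>\<omega>. (b (X t \<omega>) - b (X ?s \<omega>))\<^sup>2) \<le> expectation D"
      by (rule integral_mono[OF int D(1) le])
    also have "\<dots> \<le> H\<^sup>2 * (h powr \<alpha> * (1 + C))"
    proof -
      have "expectation (\<lambda>\<omega>. (X t \<omega> - X ?s \<omega>)\<^sup>2) \<le> C * h"
        using mom[OF s(1-3,5)] mult_left_mono[OF s(4) C] by linarith
      then have "expectation (\<lambda>\<omega>. (X t \<omega> - X ?s \<omega>)\<^sup>2) / h \<le> C" using h by (simp add: pos_divide_le_eq)
      then show ?thesis unfolding D(2) by (intro mult_left_mono) auto
    qed
    finally show "expectation (\<lambda>\<omega>. (b (X t \<omega>) - b (X ?s \<omega>))\<^sup>2) \<le> H\<^sup>2 * (1 + C) * h powr \<alpha>"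
      by (simp add: ac_simps)
  qed
qed

theorem theorem2p16:
  fixes M :: "'a measure" and F :: "real \<Rightarrow> 'a measure"
    and T x0 \<sigma> \<alpha> :: real and b :: "real \<Rightarrow> real"
    and W X L :: "real \<Rightarrow> 'a \<Rightarrow> real"
    and Xh Lh :: "real \<Rightarrow> real \<Rightarrow> 'a \<Rightarrow> real"
    and f :: "(real \<Rightarrow> real) \<Rightarrow> real"
  assumes "T > 0" and "x0 \<ge> 0" and "\<sigma> \<noteq> 0" and "\<alpha> \<in> {0<..1}"
    and "weakly_well_posed T x0 b \<sigma>"
    and "filtered_prob_space M F" and "brownian_motion M F T W"
    and "reflected_sde M F T x0 b \<sigma> W X L"
    and "\<And>h. h > 0 \<Longrightarrow> euler_maruyama M F T x0 b \<sigma> W h (Xh h) (Lh h)"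
    and "sublinear_growth b" and "hoelder_continuous \<alpha> b"
    and "f \<in> borel_measurable (path_space T)" and "bounded (f ` space (path_space T))"
  shows "\<exists>C. \<forall>h>0.
    \<bar>(\<integral>\<omega>. f (path_of T X \<omega>) \<partial>M) - (\<integral>\<omega>. f (path_of T (Xh h) \<omega>) \<partial>M)\<bar> \<le> C * h powr (\<alpha> / 2)"
proof -
  interpret filtered_prob_space M F by fact
  note T = \<open>T > 0\<close> and sde = \<open>reflected_sde M F T x0 b \<sigma> W X L\<close> and em = assms(9)
  have \<alpha>: "0 < \<alpha>" "\<alpha> \<le> 1" using \<open>\<alpha> \<in> {0<..1}\<close> by auto
  have X: "path_of T X \<in> measurable M (path_space T)"
    using sde by (intro measurable_path_of[OF T] measurable_from_subalg[OF subalgebra_F])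
      (auto simp: reflected_sde_def adapted_def)
  have Xh: "path_of T (Xh h) \<in> measurable M (path_space T)" if "0 < h" for h
    using em[OF that] by (intro measurable_path_of[OF T] measurable_from_subalg[OF subalgebra_F])
      (auto simp: euler_maruyama_def adapted_def)
  obtain B0 where "\<forall>p\<in>space (path_space T). \<bar>f p\<bar> \<le> B0"
    using assms(13) unfolding bounded_iff by auto
  then have B: "\<And>p. p \<in> space (path_space T) \<Longrightarrow> \<bar>f p\<bar> \<le> max 1 B0" "0 < max 1 B0" by force+
  define B where "B = max 1 B0"
  obtain C where C: "0 \<le> C" and drift: "\<And>h t. 0 < h \<Longrightarrow> h \<le> 1 \<Longrightarrow> t \<in> {0..T} \<Longrightarrow>
      integrable M (\<lambda>\<omega>. (b (X t \<omega>) - b (X (euler_grid h t) \<omega>))\<^sup>2) \<and>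
      (\<integral>\<omega>. (b (X t \<omega>) - b (X (euler_grid h t) \<omega>))\<^sup>2 \<partial>M) \<le> C * h powr \<alpha>"
    using euler_drift_error_moment[OF assms(6,7,8) T \<open>\<sigma> \<noteq> 0\<close> \<alpha> assms(11)] by blast
  define c where "c = 1 + T * (C / \<sigma>\<^sup>2) / 2"
  have c: "1 \<le> c" using C T by (simp add: c_def)
  show ?thesis
  proof (intro exI[of _ "2 * B * c"] allI impI)
    fix h :: real assume h: "h > 0"
    let ?\<mu> = "distr M (path_space T) (path_of T X)" and ?\<nu> = "distr M (path_space T) (path_of T (Xh h))"
    have "\<bar>(\<integral>p. f p \<partial>?\<mu>) - (\<integral>p. f p \<partial>?\<nu>)\<bar> \<le> 2 * B * (c * h powr (\<alpha> / 2))"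
    proof (rule abs_integral_diff_le_total_variation[OF prob_space_distr[OF X] prob_space_distr[OF Xh[OF h]]])
      fix A assume A: "A \<in> sets ?\<mu>"
      show "measure ?\<mu> A \<le> measure ?\<nu> A + c * h powr (\<alpha> / 2)"
      proof (cases "h \<le> 1")
        case True
        \<comment> \<open>this \<open>\<epsilon>\<close> balances the two terms of the total variation bound\<close>
        let ?\<epsilon> = "h powr (\<alpha> / 2)" and ?\<kappa> = "C / \<sigma>\<^sup>2 * h powr \<alpha>"
        have "h powr \<alpha> = ?\<epsilon> * ?\<epsilon>" by (simp add: powr_add[symmetric])
        then have rate: "?\<epsilon> + T * ?\<kappa> / (2 * ?\<epsilon>) = c * ?\<epsilon>" using h by (simp add: c_def field_simps)
        have "measure ?\<mu> A \<le> measure ?\<nu> A + (?\<epsilon> + T * ?\<kappa> / (2 * ?\<epsilon>))"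
        proof (rule euler_scheme_law_le[OF assms(6,7) T assms(3) h sde em[OF h]])
          show "continuous_on {0..} b" by (rule hoelder_continuous_imp_continuous_on[OF assms(11) \<alpha>(1)])
        qed (use drift[OF h True] A h \<open>\<sigma> \<noteq> 0\<close> in auto)
        then show ?thesis unfolding rate .
      next
        case False
        \<comment> \<open>for \<open>h > 1\<close> the right-hand side exceeds one\<close>
        have "1 \<le> h powr (\<alpha> / 2)" using False \<alpha> by (intro ge_one_powr_ge_zero) auto
        then have "1 * 1 \<le> c * h powr (\<alpha> / 2)" using c by (intro mult_mono) auto
        moreover have "measure ?\<mu> A \<le> 1" using prob_space.prob_le_1[OF prob_space_distr[OF X]] .
        moreover have "0 \<le> measure ?\<nu> A" by simp
        ultimately show ?thesis by linarith
      qed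
    qed (use assms(12) B in \<open>auto simp: B_def\<close>)
    then show "\<bar>(\<integral>\<omega>. f (path_of T X \<omega>) \<partial>M) - (\<integral>\<omega>. f (path_of T (Xh h) \<omega>) \<partial>M)\<bar> \<le> 2 * B * c * h powr (\<alpha> / 2)"
      using X Xh[OF h] assms(12) by (simp add: integral_distr mult.assoc)
  qed
qed

end
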